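(* Let $p=1$ and fix $U_+,U_-\subset\mathbb{Z}$ such that $U_+\cap U_-=\varnothing$ and $N:=|U_+|+|U_-|=1$. There are $\epsilon_0>0$ and $\delta>0$ such that for any fixed $\epsilon\in(0,\epsilon_0)$ the resolvent operator $$R(\Omega)=(H_\epsilon-\Omega)^{-1}:\ l^2(\mathbb{Z})\times l^2(\mathbb{Z})\to l^2(\mathbb{Z})\times l^2(\mathbb{Z})$$ is bounded for any $\Omega\in\mathbb{C}$ with $\Omega\notin B_\delta(0)\cup[1,1+4\epsilon]\cup[-1-4\epsilon,-1]$. Moreover, $R(\Omega)$ has exactly $2N=2$ poles (counting multiplicities) inside $B_\delta(0)$ and admits the limits $$R^{\pm}(\Omega):=\lim_{\mu\downarrow0}R(\Omega\pm i\mu)$$ such that for any $\Omega\in[1,1+4\epsilon]\cup[-1-4\epsilon,-1]$ and any $\epsilon\in(0,\epsilon_0)$, there is $C>0$ such that $$\|R^{\pm}(\Omega)\|_{l^1_1\times l^1_1\to l^\infty\times l^\infty}\le C\epsilon^{-1}.$$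
   Context: Sequences are bi-infinite. $l^q_s(\mathbb{Z})$ is the space of sequences $u$ with $\{(1+n^2)^{s/2}u_n\}_{n\in\mathbb{Z}}\in l^q(\mathbb{Z})$, with the corresponding norm. $B_\delta(\lambda_0)\subset\mathbb{C}$ is the disk of radius $\delta$ centered at $\lambda_0$. Discrete soliton: let $\phi^{(0)}\in l^2(\mathbb{Z})$ be given by $\phi^{(0)}_n=1$ for $n\in U_+$, $\phi^{(0)}_n=-1$ for $n\in U_-$, and $\phi^{(0)}_n=0$ otherwise. It is known that for all sufficiently small $|\epsilon|$ the equation $$(1-\phi_n^{2p})\phi_n=\epsilon(\phi_{n+1}-2\phi_n+\phi_{n-1}),\quad n\in\mathbb{Z},$$ has a unique real solution $\phi=\phi(\epsilon)\in l^2(\mathbb{Z})$ near $\phi^{(0)}$; the map $\epsilon\mapsto\phi\in l^2(\mathbb{Z})$ is analytic, $\|\phi-\phi^{(0)}\|_{l^2}\le C|\epsilon|$, and $|\phi_n|\le Ce^{-\kappa|n|}$ for all $n$, with some $C,\kappa>0$ independent of $\epsilon$. ($\epsilon_0$ in the claim is taken small enough that this $\phi$ is defined.) Here $p=1$. Let $(\Delta u)_n=u_{n+1}-2u_n+u_{n-1}$ and let $\Phi$ be the multiplication operator $(\Phi u)_n=\phi_n^{2p}u_n$. The operator $H_\epsilon$ on $l^2(\mathbb{Z})\times l^2(\mathbb{Z})$ is $$H_\epsilon=\begin{bmatrix}-\epsilon\Delta+I-(1+p)\Phi & -p\Phi\\ p\Phi & \epsilon\Delta-I+(1+p)\Phi\end{bmatrix}.$$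 Poles of $R(\Omega)$ are the isolated eigenvalues of $H_\epsilon$ and are counted with algebraic multiplicity. The limits $R^\pm(\Omega)$ are understood as: for every $(f,g)\in l^1_1\times l^1_1$, each component of $R(\Omega\pm i\mu)(f,g)$ converges as $\mu\downarrow0$, and the limit sequence defines $R^\pm(\Omega)(f,g)$. *)

theory Defs
  imports "HOL-Analysis.Analysis" "HOL-Library.Function_Algebras"
begin

text \<open>Sequence spaces over the integers. The exponent \<open>q = \<infinity>\<close> is treated
  separately, and the norm on a product \<open>X \<times> X\<close> is the sum of the norms of the two components.\<close>

definition lqs :: "real \<Rightarrow> real \<Rightarrow> (int \<Rightarrow> 'a::real_normed_vector) set" where
  "lqs q s = {u. (\<lambda>n. ((1 + (real_of_int n)\<^sup>2) powr (s / 2) * norm (u n)) powr q) summable_on UNIV}"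

definition lqs_norm :: "real \<Rightarrow> real \<Rightarrow> (int \<Rightarrow> 'a::real_normed_vector) \<Rightarrow> real" where
  "lqs_norm q s u =
     (\<Sum>\<^sub>\<infinity>n. ((1 + (real_of_int n)\<^sup>2) powr (s / 2) * norm (u n)) powr q) powr (1 / q)"

definition linf :: "(int \<Rightarrow> 'a::real_normed_vector) set" where
  "linf = {u. bounded (range u)}"

definition linf_norm :: "(int \<Rightarrow> 'a::real_normed_vector) \<Rightarrow> real" where
  "linf_norm u = (SUP n. norm (u n))"

definition pair_norm :: "('b \<Rightarrow> real) \<Rightarrow> 'b \<times> 'b \<Rightarrow> real" where
  "pair_norm nrm w = nrm (fst w) + nrm (snd w)"

type_synonym state = "(int \<Rightarrow> complex) \<times> (int \<Rightarrow> complex)"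

abbreviation l2_pair :: "state set" where
  "l2_pair \<equiv> lqs 2 0 \<times> lqs 2 0"

abbreviation l11_pair :: "state set" where
  "l11_pair \<equiv> lqs 1 1 \<times> lqs 1 1"

abbreviation linf_pair :: "state set" where
  "linf_pair \<equiv> linf \<times> linf"

text \<open>\<open>op_norm_le X nX Y nY T K\<close>: the map \<open>T\<close> takes \<open>X\<close> into \<open>Y\<close> with
  operator norm at most \<open>K\<close>.\<close>

definition op_norm_le ::
  "state set \<Rightarrow> (state \<Rightarrow> real) \<Rightarrow> state set \<Rightarrow> (state \<Rightarrow> real) \<Rightarrow> (state \<Rightarrow> state) \<Rightarrow> real \<Rightarrow> bool" where
  "op_norm_le X nX Y nY T K \<longleftrightarrow> (\<forall>w\<in>X. T w \<in> Y \<and> nY (T w) \<le> K * nX w)"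

abbreviation op_norm_le_l2 :: "(state \<Rightarrow> state) \<Rightarrow> real \<Rightarrow> bool" where
  "op_norm_le_l2 \<equiv>
     op_norm_le l2_pair (pair_norm (lqs_norm 2 0)) l2_pair (pair_norm (lqs_norm 2 0))"

abbreviation op_norm_le_l11_linf :: "(state \<Rightarrow> state) \<Rightarrow> real \<Rightarrow> bool" where
  "op_norm_le_l11_linf \<equiv>
     op_norm_le l11_pair (pair_norm (lqs_norm 1 1)) linf_pair (pair_norm linf_norm)"


definition lap :: "(int \<Rightarrow> 'a::comm_ring_1) \<Rightarrow> int \<Rightarrow> 'a" where
  "lap u n = u (n + 1) - 2 * u n + u (n - 1)"

definition limit_soliton :: "int set \<Rightarrow> int set \<Rightarrow> int \<Rightarrow> real" where
  "limit_soliton Up Um n = (if n \<in> Up then 1 else if n \<in> Um then -1 else 0)"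

text \<open>A real \<open>l\<^sup>2\<close> solution at coupling \<open>\<epsilon>\<close> which is
  \<open>\<rho>\<close>-close to the \<open>\<epsilon> = 0\<close> profile.\<close>

definition soliton_near ::
  "nat \<Rightarrow> int set \<Rightarrow> int set \<Rightarrow> real \<Rightarrow> real \<Rightarrow> (int \<Rightarrow> real) \<Rightarrow> bool" where
  "soliton_near p Up Um \<rho> \<epsilon> \<phi> \<longleftrightarrow>
     \<phi> \<in> lqs 2 0 \<and>
     (\<forall>n. (1 - \<phi> n ^ (2 * p)) * \<phi> n = \<epsilon> * lap \<phi> n) \<and>
     lqs_norm 2 0 (\<phi> - limit_soliton Up Um) < \<rho>"

definition H_op :: "nat \<Rightarrow> real \<Rightarrow> (int \<Rightarrow> real) \<Rightarrow> state \<Rightarrow> state" where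
  "H_op p \<epsilon> \<phi> w =
     (let u = fst w; v = snd w; \<Phi> = (\<lambda>n. complex_of_real (\<phi> n ^ (2 * p))) in
       (\<lambda>n. - of_real \<epsilon> * lap u n + u n - (1 + of_nat p) * \<Phi> n * u n - of_nat p * \<Phi> n * v n,
        \<lambda>n. of_nat p * \<Phi> n * u n + of_real \<epsilon> * lap v n - v n + (1 + of_nat p) * \<Phi> n * v n))"


definition scale :: "complex \<Rightarrow> state \<Rightarrow> state" where
  "scale c w = (\<lambda>n. c * fst w n, \<lambda>n. c * snd w n)"

interpretation state: vector_space scale
  by unfold_locales (auto simp: scale_def prod_eq_iff fun_eq_iff algebra_simps)

definition shifted :: "(state \<Rightarrow> state) \<Rightarrow> complex \<Rightarrow> state \<Rightarrow> state" where
  "shifted H \<Omega> w = H w - scale \<Omega> w"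

definition resolvent :: "(state \<Rightarrow> state) \<Rightarrow> complex \<Rightarrow> state \<Rightarrow> state" where
  "resolvent H \<Omega> = inv_into l2_pair (shifted H \<Omega>)"

text \<open>\<open>H - \<Omega>\<close> is invertible on \<open>l\<^sup>2 \<times> l\<^sup>2\<close> with bounded inverse; only then is
  the value of \<open>resolvent H \<Omega>\<close> meaningful.\<close>

definition resolvent_bounded :: "(state \<Rightarrow> state) \<Rightarrow> complex \<Rightarrow> bool" where
  "resolvent_bounded H \<Omega> \<longleftrightarrow>
     bij_betw (shifted H \<Omega>) l2_pair l2_pair \<and> (\<exists>K. op_norm_le_l2 (resolvent H \<Omega>) K)"

definition eigenvalue :: "(state \<Rightarrow> state) \<Rightarrow> complex \<Rightarrow> bool" where
  "eigenvalue H z \<longleftrightarrow> (\<exists>w\<in>l2_pair. w \<noteq> 0 \<and> H w = scale z w)"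

text \<open>An isolated eigenvalue at which the singularity of the resolvent has finite order. The
  order condition rules out an essential singularity, which an isolated eigenvalue with a
  finite-dimensional generalized eigenspace may still be in infinite dimensions.\<close>

definition resolvent_pole :: "(state \<Rightarrow> state) \<Rightarrow> complex \<Rightarrow> bool" where
  "resolvent_pole H z \<longleftrightarrow>
     eigenvalue H z \<and>
     (\<exists>r>0. \<exists>m::nat. \<exists>K.
        \<forall>\<Omega>\<in>ball z r - {z}. resolvent_bounded H \<Omega> \<and>
          op_norm_le_l2 (resolvent H \<Omega>) (K / norm (\<Omega> - z) ^ m))"

definition gen_eigenspace :: "(state \<Rightarrow> state) \<Rightarrow> complex \<Rightarrow> state set" where
  "gen_eigenspace H z = {w \<in> l2_pair. \<exists>k. (shifted H z ^^ k) w = 0}"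

text \<open>A relation rather than a function of \<open>z\<close>, because the library's dimension
  function returns 0 on infinite-dimensional spaces.\<close>

definition has_alg_multiplicity :: "(state \<Rightarrow> state) \<Rightarrow> complex \<Rightarrow> nat \<Rightarrow> bool" where
  "has_alg_multiplicity H z m \<longleftrightarrow>
     (\<exists>B. finite B \<and> card B = m \<and> state.independent B \<and> state.span B = gen_eigenspace H z)"

text \<open>In the set \<open>S\<close> the resolvent has no singularities other than poles, and the
  multiplicities of these add up to \<open>k\<close>.\<close>

definition exactly_poles_in :: "(state \<Rightarrow> state) \<Rightarrow> complex set \<Rightarrow> nat \<Rightarrow> bool" where
  "exactly_poles_in H S k \<longleftrightarrow>
     (\<exists>P m. finite P \<and> P \<subseteq> S \<and>
        (\<forall>\<Omega>\<in>S - P. resolvent_bounded H \<Omega>) \<and>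
        (\<forall>z\<in>P. resolvent_pole H z \<and> has_alg_multiplicity H z (m z)) \<and>
        (\<Sum>z\<in>P. m z) = k)"

text \<open>\<open>T\<close> is the boundary value of the resolvent at the real point \<open>\<Omega>\<close>, from above for
  \<open>\<sigma> = 1\<close> and from below for \<open>\<sigma> = -1\<close>, as a componentwise limit on
  \<open>l\<^sup>1\<^sub>1 \<times> l\<^sup>1\<^sub>1\<close>.\<close>

definition limit_resolvent ::
  "(state \<Rightarrow> state) \<Rightarrow> real \<Rightarrow> real \<Rightarrow> (state \<Rightarrow> state) \<Rightarrow> bool" where
  "limit_resolvent H \<sigma> \<Omega> T \<longleftrightarrow>
     (\<forall>w\<in>l11_pair. \<forall>n.
        ((\<lambda>\<mu>. fst (resolvent H (Complex \<Omega> (\<sigma> * \<mu>)) w) n) \<longlongrightarrow> fst (T w) n) (at_right 0) \<and>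
        ((\<lambda>\<mu>. snd (resolvent H (Complex \<Omega> (\<sigma> * \<mu>)) w) n) \<longlongrightarrow> snd (T w) n) (at_right 0))"

definition bands :: "real \<Rightarrow> real set" where
  "bands \<epsilon> = {1 .. 1 + 4 * \<epsilon>} \<union> {- 1 - 4 * \<epsilon> .. - 1}"

end

theory Submission imports Defs begin

text \<open>At \<open>\<epsilon> = 0\<close> the site \<open>k\<close> carrying the soliton decouples from the rest of the lattice. The kernel
  vector \<open>(\<phi>, -\<phi>)\<close> of \<open>H\<close> comes from phase invariance, and \<open>(\<psi>, \<psi>)\<close> with
  \<open>-\<epsilon>\<Delta>\<psi> + \<psi> - 3\<phi>\<^sup>2\<psi> = \<phi>\<close> is mapped to it by \<open>H\<close>. Their values at \<open>k\<close> are independent, so every state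
  is \<open>x(\<phi>, -\<phi>) + y(\<psi>, \<psi>) + r\<close> with \<open>r\<close> vanishing at \<open>k\<close>. On the first two terms \<open>H - \<Omega>\<close> is an explicit
  Jordan block, singular only at \<open>\<Omega> = 0\<close>; this accounts for the double pole. The remainder \<open>r\<close> solves
  a Dirichlet problem on the two half lines off \<open>k\<close>. Its Green function
  \<open>\<Sum>\<^sub>j z\<^bsup>|n-m|+1+2j\<^esup>\<close>, \<open>j < min n m\<close>, where \<open>z + 1/z = 2 + (1 \<mp> \<Omega>)/\<epsilon>\<close>, is bounded by \<open>m\<close>
  for all \<open>|z| \<le> 1\<close>, band edges included. What is left of the potential is \<open>O(\<epsilon>\<^sup>2)\<close> and decays
  exponentially, while inverting the Dirichlet problem costs only \<open>1/\<epsilon>\<close>, so it is absorbed by a contraction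
  that is uniform in \<open>\<Omega>\<close>, including the boundary values on the bands.\<close>

section \<open>Fixed points and square summable sequences\<close>


text \<open>Two things stand against a direct perturbation argument: the potential at the soliton
  site has size one, and at the band edges the Green function of the full lattice, proportional to
  \<open>z ^ |n - m| / (1/z - z)\<close>, blows up. Splitting off the two Jordan vectors removes
  both at once, since a remainder that vanishes at \<open>k\<close> does not see the large potential
  and its Dirichlet condition cancels the edge singularity. The Jordan vectors leak off
  \<open>k\<close>, but their tails and the coupling of the remainder to \<open>k\<close> are each
  O(\<epsilon>), so the product is as small as the potential there. The price on the unit circle is
  that solutions are Lipschitz in \<open>z\<close> only with a factor growing linearly in the
  distance from \<open>k\<close>. Hence differences are measured in a sup norm with weight
  \<open>1 + gap\<close>, which the decay of the perturbation absorbs; square summability is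
  recovered afterwards, off the bands. Moreover bounded solutions of the Dirichlet problem are not
  unique for \<open>z\<close> on the unit circle other than 1 and -1, so on the bands a solution is
  constructed first and then shown to be the limit of the resolvents.\<close>

text \<open>Banach's iteration from zero, carried out coordinatewise so that no complete weighted
  space has to be set up. Contraction is asked only on the ball of radius \<open>R\<close>, because
  the soliton equation is cubic.\<close>

lemma weighted_sup_fixpoint:
  fixes T :: "('i \<Rightarrow> 'b::banach) \<Rightarrow> 'i \<Rightarrow> 'b" and \<nu> :: "'i \<Rightarrow> real"
  assumes \<nu>: "\<And>i. \<nu> i > 0" and q: "0 \<le> q" "q < 1" and R: "0 \<le> R"
    and self: "\<And>w i. (\<And>j. norm (w j) \<le> R * \<nu> j) \<Longrightarrow> norm (T w i) \<le> R * \<nu> i"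
    and contr: "\<And>w w' D i. (\<And>j. norm (w j) \<le> R * \<nu> j) \<Longrightarrow> (\<And>j. norm (w' j) \<le> R * \<nu> j) \<Longrightarrow>
        (\<And>j. norm (w j - w' j) \<le> D * \<nu> j) \<Longrightarrow> norm (T w i - T w' i) \<le> q * D * \<nu> i"
  shows "\<exists>w. (\<forall>i. norm (w i) \<le> R * \<nu> i) \<and> T w = w"
proof -
  define W where "W m = (T ^^ m) (\<lambda>_. 0)" for m
  have W0: "W 0 = (\<lambda>_. 0)" and WS: "W (Suc m) = T (W m)" for m
    by (simp_all add: W_def)
  have WR: "norm (W m i) \<le> R * \<nu> i" for m i
  proof (induction m arbitrary: i)
    case 0
    then show ?case using R \<nu>[of i] by (simp add: W0)
  next
    case (Suc m)
    then show ?case unfolding WS by (intro self)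
  qed
  have Wd: "norm (W (Suc m) i - W m i) \<le> q ^ m * R * \<nu> i" for m i
  proof (induction m arbitrary: i)
    case 0
    then show ?case using WR[of 1 i] by (simp add: W0)
  next
    case (Suc m)
    have "norm (T (W (Suc m)) i - T (W m) i) \<le> q * (q ^ m * R) * \<nu> i"
      by (intro contr WR) (use Suc in \<open>simp add: mult.assoc\<close>)
    then show ?case by (simp add: WS mult.assoc)
  qed
  define w where "w i = (\<Sum>m. W (Suc m) i - W m i)" for i
  have sm: "summable (\<lambda>m. W (Suc m) i - W m i)" for i
  proof (rule summable_comparison_test')
    show "summable (\<lambda>m. q ^ m * (R * \<nu> i))" using q by (intro summable_mult2 summable_geometric) auto
  qed (use Wd in \<open>simp add: mult.assoc\<close>)
  have lim: "(\<lambda>m. W m i) \<longlonglongrightarrow> w i" for i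
  proof -
    have "(\<lambda>n. \<Sum>m<n. W (Suc m) i - W m i) \<longlonglongrightarrow> w i"
      using summable_LIMSEQ[OF sm] by (simp add: w_def)
    then show ?thesis using sum_lessThan_telescope[of "\<lambda>m. W m i"] by (simp add: W0)
  qed
  have wR: "norm (w i) \<le> R * \<nu> i" for i
    by (rule LIMSEQ_le_const2[OF tendsto_norm[OF lim]]) (use WR in blast)
  \<comment> \<open>\<open>T w i\<close> may depend on every coordinate of \<open>w\<close>, so
    pointwise convergence is not enough; this rate, uniform relative to \<open>\<nu>\<close>, is
    what \<open>contr\<close> needs.\<close>
  have tail: "norm (w i - W m i) \<le> (q ^ m * R / (1 - q)) * \<nu> i" for m i
  proof -
    have "norm (W (m + n) i - W m i) \<le> (\<Sum>j<n. q ^ (m + j) * R * \<nu> i)" for n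
    proof (induction n)
      case (Suc n)
      have "norm (W (m + Suc n) i - W m i) \<le>
          norm (W (Suc (m + n)) i - W (m + n) i) + norm (W (m + n) i - W m i)"
        using norm_triangle_ineq[of "W (Suc (m + n)) i - W (m + n) i" "W (m + n) i - W m i"] by simp
      then show ?case using Suc Wd[of "m + n" i] by simp
    qed simp
    moreover have "(\<Sum>j<n. q ^ (m + j) * R * \<nu> i) \<le> (q ^ m * R / (1 - q)) * \<nu> i" for n
    proof -
      have "(\<Sum>j<n. q ^ j) \<le> 1 / (1 - q)"
        using sum_le_suminf[of "\<lambda>j. q ^ j" "{..<n}"] q
        by (simp add: suminf_geometric summable_geometric)
      then have "(q ^ m * R * \<nu> i) * (\<Sum>j<n. q ^ j) \<le> (q ^ m * R * \<nu> i) * (1 / (1 - q))"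
        by (intro mult_left_mono) (use q R \<nu>[of i] in auto)
      then show ?thesis by (simp add: power_add sum_distrib_left algebra_simps)
    qed
    ultimately have "norm (W (n + m) i - W m i) \<le> (q ^ m * R / (1 - q)) * \<nu> i" for n
      by (subst add.commute) (rule order_trans)
    moreover have "(\<lambda>n. norm (W (n + m) i - W m i)) \<longlonglongrightarrow> norm (w i - W m i)"
      using lim by (intro tendsto_norm tendsto_diff tendsto_const LIMSEQ_ignore_initial_segment)
    ultimately show ?thesis by (intro LIMSEQ_le_const2) auto
  qed
  have "T w i = w i" for i
  proof -
    have b: "norm (T w i - W (Suc m) i) \<le> q ^ m * (q * R / (1 - q) * \<nu> i)" for m
      using contr[OF wR WR tail, of i m] by (simp add: WS algebra_simps)
    have "(\<lambda>m. q ^ m * (q * R / (1 - q) * \<nu> i)) \<longlonglongrightarrow> 0"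
      using q by (intro tendsto_mult_left_zero LIMSEQ_power_zero) auto
    then have "(\<lambda>m. T w i - W (Suc m) i) \<longlonglongrightarrow> 0"
      by (rule Lim_null_comparison[rotated]) (use b in auto)
    moreover have "(\<lambda>m. T w i - W (Suc m) i) \<longlonglongrightarrow> T w i - w i"
      by (intro tendsto_diff tendsto_const LIMSEQ_Suc lim)
    ultimately show ?thesis using LIMSEQ_unique by fastforce
  qed
  then show ?thesis using wR by blast
qed

text \<open>The bound \<open>B\<close> only makes the supremum finite, so that its multiple by
  \<open>q\<close> can be absorbed; its size does not enter the conclusion.\<close>

lemma sup_absorb:
  fixes a :: "'i \<Rightarrow> real"
  assumes bd: "\<And>i. a i \<le> B" and step: "\<And>D i. (\<And>j. a j \<le> D) \<Longrightarrow> a i \<le> q * D + e" and q: "q < 1"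
  shows "a i \<le> e / (1 - q)"
proof -
  have bdd: "bdd_above (range a)" using bd by (intro bdd_aboveI[of _ B]) auto
  have le: "a j \<le> (SUP j. a j)" for j by (rule cSUP_upper[OF _ bdd]) simp
  have "(SUP j. a j) \<le> q * (SUP j. a j) + e" by (rule cSUP_least) (use step[OF le] in auto)
  then have "(SUP j. a j) \<le> e / (1 - q)" using q by (simp add: field_simps)
  then show ?thesis using le[of i] by linarith
qed

section \<open>Square summability tested on finite sets\<close>

text \<open>Membership and norm bound in one predicate: the triangle inequality of
  \<open>L2_set\<close> applies without summability side conditions, over any index type.\<close>

definition l2le :: "('i \<Rightarrow> 'a::real_normed_vector) \<Rightarrow> real \<Rightarrow> bool" where
  "l2le u M \<longleftrightarrow> (\<forall>A. finite A \<longrightarrow> L2_set (\<lambda>i. norm (u i)) A \<le> M)"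

lemma lqs_2_0: "u \<in> lqs 2 0 \<longleftrightarrow> (\<lambda>n. (norm (u n))\<^sup>2) summable_on UNIV"
  and lqs_norm_2_0: "lqs_norm 2 0 u = sqrt (\<Sum>\<^sub>\<infinity>n. (norm (u n))\<^sup>2)"
proof -
  \<comment> \<open>Needed because \<open>0 powr 0\<close> is 0.\<close>
  have nz: "1 + (real_of_int n)\<^sup>2 \<noteq> 0" for n
    by (metis add_pos_nonneg less_irrefl zero_le_power2 zero_less_one)
  have e: "((1 + (real_of_int n)\<^sup>2) powr (0 / 2) * norm (u n)) powr 2 = (norm (u n))\<^sup>2" for n
    using nz[of n] by simp
  show "u \<in> lqs 2 0 \<longleftrightarrow> (\<lambda>n. (norm (u n))\<^sup>2) summable_on UNIV"
    by (simp only: lqs_def e mem_Collect_eq)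
  show "lqs_norm 2 0 u = sqrt (\<Sum>\<^sub>\<infinity>n. (norm (u n))\<^sup>2)"
    by (simp only: lqs_norm_def e) (simp add: powr_half_sqrt infsum_nonneg)
qed

lemma l2le_nonneg: "l2le u M \<Longrightarrow> 0 \<le> M"
  unfolding l2le_def by (metis L2_set_empty finite.emptyI)

lemma l2le_iff: "l2le u M \<longleftrightarrow> u \<in> lqs 2 0 \<and> lqs_norm 2 0 u \<le> M"
proof
  assume *: "l2le u M"
  have M: "0 \<le> M" using * by (rule l2le_nonneg)
  have b: "(\<Sum>n\<in>A. (norm (u n))\<^sup>2) \<le> M\<^sup>2" if "finite A" for A
  proof -
    have "sqrt (\<Sum>n\<in>A. (norm (u n))\<^sup>2) \<le> M" using * that by (auto simp: l2le_def L2_set_def)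
    then show ?thesis by (simp add: real_sqrt_le_iff sqrt_le_D)
  qed
  have s: "(\<lambda>n. (norm (u n))\<^sup>2) summable_on UNIV"
    by (rule nonneg_bdd_above_summable_on) (use b in \<open>auto intro!: bdd_aboveI[of _ "M\<^sup>2"]\<close>)
  have "(\<Sum>\<^sub>\<infinity>n. (norm (u n))\<^sup>2) \<le> M\<^sup>2"
    by (rule infsum_le_finite_sums[OF s]) (use b in auto)
  then show "u \<in> lqs 2 0 \<and> lqs_norm 2 0 u \<le> M"
    using s M by (simp add: lqs_2_0 lqs_norm_2_0 real_le_lsqrt infsum_nonneg)
next
  assume *: "u \<in> lqs 2 0 \<and> lqs_norm 2 0 u \<le> M"
  show "l2le u M" unfolding l2le_def
  proof (intro allI impI)
    fix A :: "int set" assume "finite A"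
    then have "(\<Sum>n\<in>A. (norm (u n))\<^sup>2) \<le> (\<Sum>\<^sub>\<infinity>n. (norm (u n))\<^sup>2)"
      using * by (intro finite_sum_le_infsum) (auto simp: lqs_2_0)
    then show "L2_set (\<lambda>i. norm (u i)) A \<le> M"
      using * by (auto simp: L2_set_def lqs_norm_2_0 intro: order_trans[OF real_sqrt_le_mono])
  qed
qed

lemma l2le_lqs: "u \<in> lqs 2 0 \<Longrightarrow> l2le u (lqs_norm 2 0 u)"
  by (simp add: l2le_iff)

lemma l2le_pointwise: "l2le u M \<Longrightarrow> norm (u i) \<le> M"
  using L2_set_def[of "\<lambda>i. norm (u i)" "{i}"] by (force simp: l2le_def dest: spec[of _ "{i}"])

lemma l2le_mono_pointwise:
  assumes "l2le v M" "\<And>i. norm (u i) \<le> norm (v i)"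
  shows "l2le u M"
  using assms unfolding l2le_def
  by (meson L2_set_mono norm_ge_zero order_trans)

lemma l2le_mono: "l2le u M \<Longrightarrow> M \<le> N \<Longrightarrow> l2le u N"
  unfolding l2le_def by force

lemma L2_set_norm_add:
  "L2_set (\<lambda>i. norm (u i + v i)) A \<le> L2_set (\<lambda>i. norm (u i)) A + L2_set (\<lambda>i. norm (v i)) A"
proof -
  have "L2_set (\<lambda>i. norm (u i + v i)) A \<le> L2_set (\<lambda>i. norm (u i) + norm (v i)) A"
    by (intro L2_set_mono norm_triangle_ineq) auto
  also have "\<dots> \<le> L2_set (\<lambda>i. norm (u i)) A + L2_set (\<lambda>i. norm (v i)) A"
    by (rule L2_set_triangle_ineq)
  finally show ?thesis .
qed

lemma l2le_add:
  assumes "l2le u M" "l2le v N"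
  shows "l2le (\<lambda>i. u i + v i) (M + N)"
  unfolding l2le_def
  using assms by (fastforce simp: l2le_def intro: order_trans[OF L2_set_norm_add] add_mono)

lemma l2le_minus: "l2le u M \<Longrightarrow> l2le (\<lambda>i. - u i) M"
  by (simp add: l2le_def)

lemma l2le_diff: "l2le u M \<Longrightarrow> l2le v N \<Longrightarrow> l2le (\<lambda>i. u i - v i) (M + N)"
  using l2le_add[OF _ l2le_minus, of u M v N] by simp

lemma l2le_cmult:
  fixes u :: "'i \<Rightarrow> 'a::real_normed_div_algebra"
  assumes "l2le u M"
  shows "l2le (\<lambda>i. c * u i) (norm c * M)"
  using assms unfolding l2le_def
  by (simp add: norm_mult L2_set_right_distrib[symmetric] mult_left_mono)

lemma l2le_reindex:
  fixes f :: "'j \<Rightarrow> 'i"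
  assumes "l2le u M" "inj f"
  shows "l2le (\<lambda>i. u (f i)) M"
  unfolding l2le_def
proof (intro allI impI)
  fix A assume "finite (A :: 'j set)"
  moreover have "L2_set (\<lambda>i. norm (u i)) (f ` A) = L2_set (\<lambda>i. norm (u (f i))) A"
    using assms(2) by (simp add: L2_set_def sum.reindex inj_on_subset)
  ultimately show "L2_set (\<lambda>i. norm (u (f i))) A \<le> M"
    using assms(1) by (metis finite_imageI l2le_def)
qed

lemma l2le_nat_iff:
  fixes u :: "nat \<Rightarrow> 'a::real_normed_vector"
  shows "l2le u M \<longleftrightarrow> (\<forall>N. L2_set (\<lambda>i. norm (u i)) {..<N} \<le> M)"
proof
  assume *: "\<forall>N. L2_set (\<lambda>i. norm (u i)) {..<N} \<le> M"
  show "l2le u M" unfolding l2le_def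
  proof (intro allI impI)
    fix A :: "nat set" assume "finite A"
    then obtain N where "A \<subseteq> {..<N}" using finite_nat_bounded by blast
    then have "L2_set (\<lambda>i. norm (u i)) A \<le> L2_set (\<lambda>i. norm (u i)) {..<N}"
      unfolding L2_set_def by (intro real_sqrt_le_mono sum_mono2) auto
    then show "L2_set (\<lambda>i. norm (u i)) A \<le> M" using * order_trans by blast
  qed
qed (auto simp: l2le_def)


section \<open>The Dirichlet problem on a half line\<close>

text \<open>With \<open>S\<close> the right shift, \<open>z + 1/z - S - S\<^bsup>-1\<^esup> = (1 - zS)(1 - zS\<^bsup>-1\<^esup>)/z\<close>. The factor containing \<open>S\<^bsup>-1\<^esup>\<close> is
  inverted by \<open>tail_sum\<close>, the other one by the recursion of \<open>half_line\<close>. The value \<open>h 0\<close> is ignored.\<close>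

definition tail_sum :: "complex \<Rightarrow> (nat \<Rightarrow> complex) \<Rightarrow> nat \<Rightarrow> complex" where
  "tail_sum z h n = (\<Sum>i. z ^ (i + 1) * h (n + i))"

primrec half_line :: "complex \<Rightarrow> (nat \<Rightarrow> complex) \<Rightarrow> nat \<Rightarrow> complex" where
  "half_line z h 0 = 0"
| "half_line z h (Suc n) = z * half_line z h n + tail_sum z h (Suc n)"

text \<open>Without convergence \<open>tail_sum\<close> has no usable value. On the closed disk
  convergence comes from weighted summability of \<open>h\<close>, on the open disk from
  boundedness.\<close>

definition admissible :: "complex \<Rightarrow> (nat \<Rightarrow> complex) \<Rightarrow> bool" where
  "admissible z h \<longleftrightarrow> (\<forall>n. summable (\<lambda>i. z ^ (i + 1) * h (Suc n + i)))"

text \<open>The weight \<open>m\<close> is the bound on the Green function. It vanishes at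
  \<open>m = 0\<close>, in keeping with \<open>h 0\<close> being ignored.\<close>

definition l11le :: "(nat \<Rightarrow> complex) \<Rightarrow> real \<Rightarrow> bool" where
  "l11le h M \<longleftrightarrow> summable (\<lambda>m. real m * norm (h m)) \<and> (\<Sum>m. real m * norm (h m)) \<le> M"

lemma admissible_add:
  "admissible z h \<Longrightarrow> admissible z g \<Longrightarrow> admissible z (\<lambda>i. h i + g i)"
  by (simp add: admissible_def distrib_left summable_add)

lemma admissible_diff:
  "admissible z h \<Longrightarrow> admissible z g \<Longrightarrow> admissible z (\<lambda>i. h i - g i)"
  by (simp add: admissible_def right_diff_distrib summable_diff)

lemma half_line_add:
  assumes "admissible z h" "admissible z g"
  shows "half_line z (\<lambda>i. h i + g i) n = half_line z h n + half_line z g n"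
proof (induction n)
  case (Suc n)
  have "tail_sum z (\<lambda>i. h i + g i) (Suc n) = tail_sum z h (Suc n) + tail_sum z g (Suc n)"
    using assms unfolding tail_sum_def admissible_def distrib_left by (subst suminf_add) auto
  then show ?case using Suc by (simp add: algebra_simps)
qed simp

lemma tail_sum_rec:
  assumes h: "admissible z h"
  shows "tail_sum z h (Suc n) = z * (h (Suc n) + tail_sum z h (Suc (Suc n)))"
proof -
  have "tail_sum z h (Suc n) = z * h (Suc n) + (\<Sum>i. z ^ (i + 2) * h (Suc n + (i + 1)))"
    unfolding tail_sum_def
    using suminf_split_head[OF h[unfolded admissible_def, rule_format, of n]] by simp
  also have "(\<Sum>i. z ^ (i + 2) * h (Suc n + (i + 1))) = z * tail_sum z h (Suc (Suc n))"
    unfolding tail_sum_def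
    using suminf_mult[OF h[unfolded admissible_def, rule_format, of "Suc n"], of z]
    by (simp add: mult.assoc)
  finally show ?thesis by (simp add: distrib_left)
qed

text \<open>The two factors are undone in turn: the differences \<open>u (Suc n) - z * u n\<close>
  are the tail sums, and these satisfy \<open>tail_sum_rec\<close>.\<close>

lemma half_line_eq:
  assumes z: "z \<noteq> 0" and h: "admissible z h"
  shows "(z + 1 / z) * half_line z h (Suc n) - half_line z h (Suc (Suc n)) - half_line z h n = h (Suc n)"
  using z by (simp add: tail_sum_rec[OF h, of n] field_simps)

lemma norm_pow_le_one: "norm (z::complex) \<le> 1 \<Longrightarrow> norm (z ^ n) \<le> 1"
  by (simp add: norm_power power_le_one)

lemma l11le_tail:
  assumes "l11le h M"
  shows "summable (\<lambda>i. norm (h (Suc n + i)))"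
    and "summable (\<lambda>i. real (Suc n + i) * norm (h (Suc n + i)))"
    and "(\<Sum>i. real (Suc n + i) * norm (h (Suc n + i))) \<le> M"
proof -
  have s: "summable (\<lambda>m. real m * norm (h m))" and M: "(\<Sum>m. real m * norm (h m)) \<le> M"
    using assms by (auto simp: l11le_def)
  show s2: "summable (\<lambda>i. real (Suc n + i) * norm (h (Suc n + i)))"
    using summable_ignore_initial_segment[OF s, of "Suc n"] by (simp add: add.commute)
  show "summable (\<lambda>i. norm (h (Suc n + i)))"
  proof (rule summable_comparison_test'[OF s2, of 0])
    fix i
    have "1 * norm (h (Suc n + i)) \<le> real (Suc n + i) * norm (h (Suc n + i))"
      by (intro mult_right_mono) auto
    then show "norm (norm (h (Suc n + i))) \<le> real (Suc n + i) * norm (h (Suc n + i))" by simp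
  qed
  have "(\<Sum>i. real (Suc n + i) * norm (h (Suc n + i))) \<le> (\<Sum>m. real m * norm (h m))"
    unfolding suminf_split_initial_segment[OF s, of "Suc n"]
    by (simp add: add.commute sum_nonneg)
  then show "(\<Sum>i. real (Suc n + i) * norm (h (Suc n + i))) \<le> M" using M by simp
qed

lemma admissible_l11:
  assumes "norm z \<le> 1" "l11le h M"
  shows "admissible z h"
  unfolding admissible_def
proof
  fix n
  show "summable (\<lambda>i. z ^ (i + 1) * h (Suc n + i))"
  proof (rule summable_comparison_test'[OF l11le_tail(1)[OF assms(2), of n], of 0])
    show "norm (z ^ (i + 1) * h (Suc n + i)) \<le> norm (h (Suc n + i))" for i
      unfolding norm_mult by (intro mult_left_le_one_le norm_pow_le_one assms) auto
  qed
qed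

lemma admissible_bounded:
  assumes "norm z < 1" "\<And>n. norm (h (Suc n)) \<le> B"
  shows "admissible z h"
  unfolding admissible_def
proof
  fix n
  show "summable (\<lambda>i. z ^ (i + 1) * h (Suc n + i))"
  proof (rule summable_comparison_test'[of "\<lambda>i. norm z ^ i * B" 0])
    show "summable (\<lambda>i. norm z ^ i * B)"
      using assms by (intro summable_mult2 summable_geometric) auto
    fix i
    have "norm z ^ (i + 1) * norm (h (Suc n + i)) \<le> norm z ^ i * B"
      by (intro mult_mono) (use assms assms(2)[of "n + i"] in \<open>auto intro: mult_left_le_one_le\<close>)
    then show "norm (z ^ (i + 1) * h (Suc n + i)) \<le> norm z ^ i * B"
      by (simp add: norm_mult norm_power)
  qed
qed

lemma tail_sum_bounded:
  assumes z: "norm z \<le> r" "r < 1" and h: "\<And>n. norm (h (Suc n)) \<le> B"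
  shows "norm (tail_sum z h (Suc n)) \<le> B / (1 - r)"
proof -
  have B: "0 \<le> B" using h[of 0] norm_ge_zero order_trans by blast
  have r: "0 \<le> r" using z norm_ge_zero order_trans by blast
  have le: "norm (z ^ (i + 1) * h (Suc n + i)) \<le> r ^ i * B" for i
  proof -
    have "norm z ^ (i + 1) \<le> r ^ (i + 1)" using z by (intro power_mono) auto
    also have "\<dots> \<le> r ^ i" using r z by (simp add: mult_left_le_one_le)
    finally show ?thesis
      unfolding norm_mult norm_power by (intro mult_mono) (use h[of "n + i"] r in auto)
  qed
  have s: "summable (\<lambda>i. r ^ i * B)" using r z by (intro summable_mult2 summable_geometric) auto
  have "norm (tail_sum z h (Suc n)) \<le> (\<Sum>i. r ^ i * B)"
    unfolding tail_sum_def
    by (rule norm_suminf_le[OF le s])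
  also have "\<dots> = B / (1 - r)"
    using r z suminf_mult2[of "\<lambda>i. r ^ i" B] by (simp add: suminf_geometric summable_geometric)
  finally show ?thesis .
qed

text \<open>The differences \<open>y n = u (Suc n) - z * u n\<close> satisfy a recursion running
  backwards from infinity. Iterating it \<open>N\<close> times leaves
  \<open>z ^ N * y (n + N)\<close>, which vanishes for bounded \<open>u\<close> because
  \<open>norm z < 1\<close>; on the unit circle this argument breaks down.\<close>

lemma half_line_unique:
  assumes z: "z \<noteq> 0" "norm z < 1" and u0: "u 0 = 0" and ub: "\<And>n. norm (u n) \<le> B"
    and eq: "\<And>n. (z + 1 / z) * u (Suc n) - u (Suc (Suc n)) - u n = h (Suc n)"
  shows "u n = half_line z h n"
proof -
  define y where "y n = u (Suc n) - z * u n" for n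
  have yrec: "y n = z * h (Suc n) + z * y (Suc n)" for n
    unfolding y_def eq[of n, symmetric] using z by (simp add: field_simps)
  have B: "0 \<le> B" using ub[of 0] norm_ge_zero order_trans by blast
  have yb: "norm (y n) \<le> 2 * B" for n
  proof -
    have "norm (y n) \<le> norm (u (Suc n)) + norm z * norm (u n)"
      unfolding y_def by (metis norm_mult norm_triangle_ineq4)
    also have "\<dots> \<le> B + 1 * B" by (intro add_mono mult_mono ub) (use z in auto)
    finally show ?thesis by simp
  qed
  have ysum: "y n = (\<Sum>i<N. z ^ (i + 1) * h (Suc n + i)) + z ^ N * y (n + N)" for n N
  proof (induction N)
    case (Suc N)
    show ?case using Suc yrec[of "n + N"] by (simp add: algebra_simps)
  qed simp
  have "(\<lambda>i. z ^ (i + 1) * h (Suc n + i)) sums y n" for n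
    unfolding sums_def
  proof (rule LIM_zero_cancel, rule Lim_null_comparison)
    show "(\<lambda>N. norm z ^ N * (2 * B)) \<longlonglongrightarrow> 0"
      using z by (intro tendsto_mult_left_zero LIMSEQ_power_zero) auto
    show "\<forall>\<^sub>F N in sequentially. norm ((\<Sum>i<N. z ^ (i + 1) * h (Suc n + i)) - y n) \<le> norm z ^ N * (2 * B)"
    proof (rule always_eventually, rule allI)
      fix N
      have "(\<Sum>i<N. z ^ (i + 1) * h (Suc n + i)) - y n = - (z ^ N * y (n + N))"
        using ysum[of n N] by (simp add: algebra_simps)
      then show "norm ((\<Sum>i<N. z ^ (i + 1) * h (Suc n + i)) - y n) \<le> norm z ^ N * (2 * B)"
        by (simp add: norm_mult norm_power mult_left_mono[OF yb])
    qed
  qed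
  then have "y n = tail_sum z h (Suc n)" for n
    unfolding tail_sum_def by (rule sums_unique)
  then have "u (Suc n) = z * u n + tail_sum z h (Suc n)" for n
    by (metis y_def add_diff_cancel_left' add.commute diff_add_cancel)
  then show ?thesis by (induction n) (simp_all add: u0)
qed

lemma tail_sum_le:
  assumes "norm z \<le> 1" "l11le h M"
  shows "norm (tail_sum z h (Suc n)) \<le> (\<Sum>i. norm (h (Suc n + i)))"
proof -
  have le: "norm (z ^ (i + 1) * h (Suc n + i)) \<le> norm (h (Suc n + i))" for i
    unfolding norm_mult by (intro mult_left_le_one_le norm_pow_le_one assms) auto
  show ?thesis
    unfolding tail_sum_def
    by (rule norm_suminf_le[OF le l11le_tail(1)[OF assms(2)]])
qed

text \<open>Each \<open>norm (h m)\<close> with \<open>m > 0\<close> occurs in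
  \<open>min n m\<close> of the tails, hence at most \<open>m\<close> times.\<close>

lemma l11le_sum_tails:
  assumes "l11le h M"
  shows "(\<Sum>j<n. \<Sum>i. norm (h (Suc j + i))) \<le> M"
proof -
  define t where "t j = (\<Sum>i. norm (h (Suc j + i)))" for j
  note s = l11le_tail[OF assms]
  have trec: "t j = norm (h (Suc j)) + t (Suc j)" for j
    unfolding t_def using suminf_split_head[OF s(1)[of j]] by simp
  have eq: "(\<Sum>j<n. t j) = (\<Sum>m<Suc n. real m * norm (h m)) + real n * t n"
  proof (induction n)
    case (Suc n)
    show ?case
      using Suc trec[of n] by (simp add: algebra_simps)
  qed simp
  have "real n * t n = (\<Sum>i. real n * norm (h (Suc n + i)))"
    unfolding t_def using suminf_mult[OF s(1)[of n]] by metis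
  also have "\<dots> \<le> (\<Sum>i. real (Suc n + i) * norm (h (Suc n + i)))"
    by (intro suminf_le summable_mult s(1,2) mult_right_mono) auto
  finally have "(\<Sum>j<n. t j) \<le> (\<Sum>m<Suc n. real m * norm (h m)) + (\<Sum>i. real (Suc n + i) * norm (h (Suc n + i)))"
    unfolding eq by simp
  also have "\<dots> = (\<Sum>m. real m * norm (h m))"
    using assms suminf_split_initial_segment[of "\<lambda>m. real m * norm (h m)" "Suc n"]
    by (simp add: l11le_def add.commute)
  also have "\<dots> \<le> M" using assms by (simp add: l11le_def)
  finally show ?thesis by (simp add: t_def)
qed

text \<open>A step of the recursion adds at most one tail of norms, and the factor \<open>z\<close>
  does not enlarge what is already there. No decay in \<open>z\<close> is used, so the unit circle
  is included.\<close>

lemma half_line_bound_l11: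
  assumes z: "norm z \<le> 1" and h: "l11le h M"
  shows "norm (half_line z h n) \<le> M"
proof -
  have "norm (half_line z h n) \<le> (\<Sum>j<n. \<Sum>i. norm (h (Suc j + i)))"
  proof (induction n)
    case (Suc n)
    have "norm (half_line z h (Suc n)) \<le> norm (z * half_line z h n) + norm (tail_sum z h (Suc n))"
      using norm_triangle_ineq by simp
    also have "norm (z * half_line z h n) \<le> norm (half_line z h n)"
      unfolding norm_mult by (intro mult_left_le_one_le z) auto
    finally show ?case using Suc tail_sum_le[OF z h, of n] by simp
  qed simp
  then show ?thesis using l11le_sum_tails[OF h, of n] by linarith
qed

text \<open>Differences of powers cost a factor \<open>i + 1\<close>, which the weight in
  \<open>l11le\<close> pays for. A step of the recursion adds \<open>norm (z - w) * M\<close> twice,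
  once from the factor \<open>z\<close> and once from the tail sum; this accumulates to the growth
  in \<open>n\<close>.\<close>

lemma half_line_lipschitz:
  assumes z: "norm z \<le> 1" and w: "norm w \<le> 1" and h: "l11le h M"
  shows "norm (half_line z h n - half_line w h n) \<le> real n * (2 * norm (z - w) * M)"
proof (induction n)
  case (Suc n)
  have s: "summable (\<lambda>i. z ^ (i + 1) * h (Suc n + i))" "summable (\<lambda>i. w ^ (i + 1) * h (Suc n + i))"
    using admissible_l11[OF z h] admissible_l11[OF w h] by (auto simp: admissible_def)
  have le: "norm ((z ^ (i + 1) - w ^ (i + 1)) * h (Suc n + i))
      \<le> norm (z - w) * (real (Suc n + i) * norm (h (Suc n + i)))" for i
  proof -
    have "norm (z ^ (i + 1) - w ^ (i + 1)) \<le> real (i + 1) * norm (z - w)"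
      by (rule norm_power_diff[OF z w])
    also have "\<dots> \<le> real (Suc n + i) * norm (z - w)" by (intro mult_right_mono) auto
    finally have "norm (z ^ (i + 1) - w ^ (i + 1)) * norm (h (Suc n + i))
        \<le> real (Suc n + i) * norm (z - w) * norm (h (Suc n + i))"
      by (rule mult_right_mono) simp
    then show ?thesis unfolding norm_mult by (simp only: ac_simps)
  qed
  have s': "summable (\<lambda>i. norm (z - w) * (real (Suc n + i) * norm (h (Suc n + i))))"
    by (intro summable_mult l11le_tail(2)[OF h])
  have "tail_sum z h (Suc n) - tail_sum w h (Suc n) = (\<Sum>i. (z ^ (i + 1) - w ^ (i + 1)) * h (Suc n + i))"
    unfolding tail_sum_def left_diff_distrib by (rule suminf_diff[OF s])
  also have "norm \<dots> \<le> (\<Sum>i. norm (z - w) * (real (Suc n + i) * norm (h (Suc n + i))))"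
    by (rule norm_suminf_le[OF le s'])
  also have "\<dots> = norm (z - w) * (\<Sum>i. real (Suc n + i) * norm (h (Suc n + i)))"
    by (rule suminf_mult[OF l11le_tail(2)[OF h]])
  also have "\<dots> \<le> norm (z - w) * M"
    by (intro mult_left_mono l11le_tail(3)[OF h]) auto
  finally have t: "norm (tail_sum z h (Suc n) - tail_sum w h (Suc n)) \<le> norm (z - w) * M" .
  have "half_line z h (Suc n) - half_line w h (Suc n)
      = z * (half_line z h n - half_line w h n) + (z - w) * half_line w h n
        + (tail_sum z h (Suc n) - tail_sum w h (Suc n))"
    by (simp add: algebra_simps)
  also have "norm \<dots> \<le> norm (z * (half_line z h n - half_line w h n)) + norm ((z - w) * half_line w h n)
        + norm (tail_sum z h (Suc n) - tail_sum w h (Suc n))"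
    by (intro order_trans[OF norm_triangle_ineq] add_right_mono norm_triangle_ineq)
  also have "norm (z * (half_line z h n - half_line w h n)) \<le> norm (half_line z h n - half_line w h n)"
    unfolding norm_mult by (intro mult_left_le_one_le z) auto
  also have "norm ((z - w) * half_line w h n) \<le> norm (z - w) * M"
    unfolding norm_mult by (intro mult_left_mono half_line_bound_l11[OF w h]) auto
  finally show ?case using Suc t by (simp add: algebra_simps)
qed simp

lemma L2_set_Suc_shift:
  "L2_set f {..<Suc N} \<le> \<bar>f 0\<bar> + L2_set (\<lambda>n. f (Suc n)) {..<N}"
proof -
  have "L2_set f {..<Suc N} = sqrt ((f 0)\<^sup>2 + (\<Sum>n<N. (f (Suc n))\<^sup>2))"
    unfolding L2_set_def by (subst sum.lessThan_Suc_shift) simp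
  also have "\<dots> \<le> sqrt ((f 0)\<^sup>2) + sqrt (\<Sum>n<N. (f (Suc n))\<^sup>2)"
    by (intro sqrt_add_le_add_sqrt sum_nonneg) auto
  finally show ?thesis by (simp add: L2_set_def)
qed

text \<open>Both factors are inverted by absorbing a term with factor \<open>r < 1\<close>. On a
  finite section the shifted tail sums have one entry too many, whose crude pointwise bound costs
  the third power of \<open>1 / (1 - r)\<close>.\<close>

lemma half_line_l2:
  assumes z: "norm z \<le> r" "r < 1" and h: "l2le (\<lambda>n. h (Suc n)) M"
  shows "l2le (half_line z h) (2 * M / (1 - r) ^ 3)"
proof -
  have r: "0 \<le> r" using z norm_ge_zero order_trans by blast
  have M: "0 \<le> M" using h by (rule l2le_nonneg)
  define y where "y n = tail_sum z h (Suc n)" for n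
  have hb: "norm (h (Suc n)) \<le> M" for n using l2le_pointwise[OF h] .
  have "admissible z h" using z hb by (intro admissible_bounded[where B = M]) auto
  then have yrec: "y n = z * (h (Suc n) + y (Suc n))" for n
    unfolding y_def by (rule tail_sum_rec)
  have yb: "norm (y n) \<le> M / (1 - r)" for n
    unfolding y_def by (rule tail_sum_bounded[where h = h, OF z hb])
  have contr: "L2_set (\<lambda>n. norm (z * a n)) A \<le> r * L2_set (\<lambda>n. norm (a n)) A" for a and A :: "nat set"
    unfolding norm_mult L2_set_right_distrib[OF norm_ge_zero, symmetric]
    by (intro mult_right_mono z) auto
  have ly: "L2_set (\<lambda>n. norm (y n)) {..<N} \<le> 2 * M / (1 - r)\<^sup>2" for N
  proof -
    let ?S = "L2_set (\<lambda>n. norm (y n)) {..<N}"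
    have "?S = L2_set (\<lambda>n. norm (z * (h (Suc n) + y (Suc n)))) {..<N}"
      by (simp only: yrec[symmetric])
    also have "\<dots> \<le> r * L2_set (\<lambda>n. norm (h (Suc n) + y (Suc n))) {..<N}" by (rule contr)
    \<comment> \<open>The term \<open>M / (1 - r)\<close> accounts for the entry \<open>y N\<close>
      just outside the section.\<close>
    also have "\<dots> \<le> r * (M + (?S + M / (1 - r)))"
    proof (rule mult_left_mono[OF order_trans[OF L2_set_norm_add add_mono] r])
      show "L2_set (\<lambda>n. norm (h (Suc n))) {..<N} \<le> M" using h by (simp add: l2le_def)
      have "L2_set (\<lambda>n. norm (y (Suc n))) {..<N} \<le> L2_set (\<lambda>n. norm (y n)) {..<Suc N}"
        unfolding L2_set_def by (subst sum.lessThan_Suc_shift) simp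
      also have "\<dots> \<le> L2_set (\<lambda>n. norm (y n)) {..<N} + norm (y N)"
        unfolding L2_set_def by (simp add: order_trans[OF sqrt_add_le_add_sqrt] sum_nonneg)
      finally show "L2_set (\<lambda>n. norm (y (Suc n))) {..<N} \<le> ?S + M / (1 - r)"
        using yb[of N] by linarith
    qed
    also have "\<dots> \<le> M + r * ?S + M / (1 - r) - M"
    proof -
      have "r * (M + M / (1 - r)) \<le> M / (1 - r) + 0"
      proof -
        have "r * (2 - r) \<le> 1" using zero_le_power2[of "1 - r"] by (simp add: power2_eq_square algebra_simps)
        then have "M * (r * (2 - r)) \<le> M" using M mult_left_mono[of "r * (2 - r)" 1 M] by simp
        then have "M * (r * (2 - r)) / (1 - r) \<le> M / (1 - r)" using z by (intro divide_right_mono) auto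
        moreover have "r * (M + M / (1 - r)) = M * (r * (2 - r)) / (1 - r)" using z by (simp add: field_simps)
        ultimately show ?thesis by simp
      qed
      then show ?thesis by (simp add: algebra_simps)
    qed
    finally have "(1 - r) * ?S \<le> M / (1 - r)" by (simp add: algebra_simps)
    then have "?S \<le> M / (1 - r) / (1 - r)" using z by (simp add: pos_le_divide_eq mult.commute)
    also have "\<dots> = M / (1 - r)\<^sup>2" by (simp add: power2_eq_square)
    also have "\<dots> \<le> 2 * M / (1 - r)\<^sup>2" using M z by (simp add: divide_right_mono)
    finally show ?thesis .
  qed
  have "L2_set (\<lambda>n. norm (half_line z h n)) {..<N} \<le> 2 * M / (1 - r) ^ 3" for N
  proof (induction N)
    case 0
    then show ?case using M z by simp
  next
    case (Suc N)
    have "L2_set (\<lambda>n. norm (half_line z h n)) {..<Suc N} \<le> L2_set (\<lambda>n. norm (half_line z h (Suc n))) {..<N}"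
      using L2_set_Suc_shift[of "\<lambda>n. norm (half_line z h n)" N] by simp
    also have "\<dots> \<le> L2_set (\<lambda>n. norm (z * half_line z h n)) {..<N} + L2_set (\<lambda>n. norm (y n)) {..<N}"
      unfolding half_line.simps y_def[symmetric] by (rule L2_set_norm_add)
    also have "\<dots> \<le> r * (2 * M / (1 - r) ^ 3) + 2 * M / (1 - r)\<^sup>2"
      by (intro add_mono ly order_trans[OF contr] mult_left_mono Suc r)
    also have "2 * M / (1 - r)\<^sup>2 = (1 - r) * (2 * M / (1 - r) ^ 3)"
      using z by (simp add: power2_eq_square power3_eq_cube)
    also have "r * X + (1 - r) * X = X" for X by (simp add: algebra_simps)
    finally show ?case .
  qed
  then show ?thesis by (simp add: l2le_nat_iff)
qed


section \<open>The lattice cut at one site\<close>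

definition gap :: "int \<Rightarrow> int \<Rightarrow> nat" where
  "gap k n = nat \<bar>n - k\<bar>"

definition ray :: "int \<Rightarrow> int \<Rightarrow> (int \<Rightarrow> 'a) \<Rightarrow> nat \<Rightarrow> 'a" where
  "ray k \<sigma> h j = h (k + \<sigma> * int j)"

text \<open>At \<open>n = k\<close> both \<open>sgn\<close> and \<open>gap\<close> are 0 and
  \<open>half_line\<close> starts from 0, so the Dirichlet condition is built in. The value
  \<open>h k\<close> is never read.\<close>

definition cut_solve :: "int \<Rightarrow> complex \<Rightarrow> (int \<Rightarrow> complex) \<Rightarrow> int \<Rightarrow> complex" where
  "cut_solve k z h n = half_line z (ray k (sgn (n - k)) h) (gap k n)"

definition cut_admissible :: "int \<Rightarrow> complex \<Rightarrow> (int \<Rightarrow> complex) \<Rightarrow> bool" where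
  "cut_admissible k z h \<longleftrightarrow> (\<forall>\<sigma>\<in>{1, -1}. admissible z (ray k \<sigma> h))"

definition cut_l11le :: "int \<Rightarrow> (int \<Rightarrow> complex) \<Rightarrow> real \<Rightarrow> bool" where
  "cut_l11le k h M \<longleftrightarrow> (\<forall>\<sigma>\<in>{1, -1}. l11le (ray k \<sigma> h) M)"

lemma gap_self [simp]: "gap k k = 0"
  by (simp add: gap_def)

lemma gap_ray: "\<sigma> \<in> {1, -1} \<Longrightarrow> gap k (k + \<sigma> * int j) = j"
  by (auto simp: gap_def)

lemma half_power_neighbour:
  assumes "\<bar>m - n\<bar> \<le> 1"
  shows "(1 / 2 :: real) ^ gap k m \<le> 2 * (1 / 2) ^ gap k n"
proof -
  have "gap k n \<le> Suc (gap k m)" using assms by (auto simp: gap_def)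
  then have "(1 / 2 :: real) ^ Suc (gap k m) \<le> (1 / 2) ^ gap k n"
    by (intro power_decreasing) auto
  then show ?thesis by simp
qed

lemma ray_cases:
  obtains \<sigma> :: int and j where "\<sigma> \<in> {1, -1}" "n = k + \<sigma> * int j" "n \<noteq> k \<longrightarrow> 0 < j"
proof -
  let ?\<sigma> = "if n \<ge> k then 1 else - 1 :: int"
  have "?\<sigma> \<in> {1, -1}" "n = k + ?\<sigma> * int (gap k n)" "n \<noteq> k \<longrightarrow> 0 < gap k n"
    by (auto simp: gap_def)
  then show ?thesis by (rule that)
qed

lemma ray_neighbours:
  fixes f :: "int \<Rightarrow> 'a::ab_semigroup_add"
  assumes "\<sigma> \<in> {1, -1}"
  shows "f (k + \<sigma> * int (Suc i) + 1) + f (k + \<sigma> * int (Suc i) - 1)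
    = f (k + \<sigma> * int (Suc (Suc i))) + f (k + \<sigma> * int i)"
proof (cases "\<sigma> = 1")
  case True
  then have "k + \<sigma> * int (Suc i) + 1 = k + \<sigma> * int (Suc (Suc i))" "k + \<sigma> * int (Suc i) - 1 = k + \<sigma> * int i"
    by auto
  then show ?thesis by presburger
next
  case False
  then have "k + \<sigma> * int (Suc i) + 1 = k + \<sigma> * int i" "k + \<sigma> * int (Suc i) - 1 = k + \<sigma> * int (Suc (Suc i))"
    using assms by auto
  then show ?thesis by (simp only: add.commute)
qed

lemma cut_solve_self [simp]: "cut_solve k z h k = 0"
  by (simp add: cut_solve_def)

lemma cut_solve_ray:
  assumes "\<sigma> \<in> {1, -1}"
  shows "cut_solve k z h (k + \<sigma> * int j) = half_line z (ray k \<sigma> h) j"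
proof (cases "j = 0")
  case False
  then have "sgn (\<sigma> * int j) = \<sigma>" using assms by auto
  then show ?thesis using gap_ray[OF assms] by (simp add: cut_solve_def)
qed simp

lemma cut_admissible_add:
  "cut_admissible k z h \<Longrightarrow> cut_admissible k z g \<Longrightarrow> cut_admissible k z (\<lambda>n. h n + g n)"
  using admissible_add by (fastforce simp: cut_admissible_def ray_def[abs_def])

lemma cut_admissible_diff:
  "cut_admissible k z h \<Longrightarrow> cut_admissible k z g \<Longrightarrow> cut_admissible k z (\<lambda>n. h n - g n)"
  using admissible_diff by (fastforce simp: cut_admissible_def ray_def[abs_def])

lemma cut_solve_add:
  assumes "cut_admissible k z h" "cut_admissible k z g"
  shows "cut_solve k z (\<lambda>n. h n + g n) n = cut_solve k z h n + cut_solve k z g n"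
proof (rule ray_cases[of n k])
  fix \<sigma> :: int and j assume "\<sigma> \<in> {1, -1}" and n: "n = k + \<sigma> * int j"
  moreover from this have "half_line z (ray k \<sigma> (\<lambda>n. h n + g n)) j
      = half_line z (ray k \<sigma> h) j + half_line z (ray k \<sigma> g) j"
    using half_line_add[of z "ray k \<sigma> h" "ray k \<sigma> g"] assms
    by (auto simp: cut_admissible_def ray_def[abs_def])
  ultimately show ?thesis by (simp only: cut_solve_ray)
qed

lemma cut_solve_diff:
  assumes "cut_admissible k z h" "cut_admissible k z g"
  shows "cut_solve k z (\<lambda>n. h n - g n) n = cut_solve k z h n - cut_solve k z g n"
  using cut_solve_add[OF cut_admissible_diff[OF assms] assms(2), of n] by (simp add: algebra_simps)

lemma cut_solve_eq:
  assumes z: "z \<noteq> 0" and h: "cut_admissible k z h" and n: "n \<noteq> k"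
  shows "(z + 1 / z) * cut_solve k z h n - cut_solve k z h (n + 1) - cut_solve k z h (n - 1) = h n"
proof (rule ray_cases[of n k])
  fix \<sigma> :: int and j assume \<sigma>: "\<sigma> \<in> {1, -1}" and "n = k + \<sigma> * int j" "n \<noteq> k \<longrightarrow> 0 < j"
  then obtain i where i: "n = k + \<sigma> * int (Suc i)" using n by (cases j) auto
  note ray_neighbours[OF \<sigma>, of "cut_solve k z h" k i]
  moreover have "admissible z (ray k \<sigma> h)" using h \<sigma> by (auto simp: cut_admissible_def)
  note half_line_eq[OF z this, of i]
  ultimately show ?thesis
    unfolding i cut_solve_ray[OF \<sigma>] diff_diff_eq by (simp add: ray_def)
qed

lemma cut_solve_unique:
  assumes z: "z \<noteq> 0" "norm z < 1" and uk: "u k = 0" and ub: "\<And>n. norm (u n) \<le> B"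
    and eq: "\<And>n. n \<noteq> k \<Longrightarrow> (z + 1 / z) * u n - u (n + 1) - u (n - 1) = h n"
  shows "u = cut_solve k z h"
proof
  fix n
  show "u n = cut_solve k z h n"
  proof (rule ray_cases[of n k])
    fix \<sigma> :: int and j assume \<sigma>: "\<sigma> \<in> {1, -1}" and n: "n = k + \<sigma> * int j"
    have "ray k \<sigma> u j = half_line z (ray k \<sigma> h) j"
    proof (rule half_line_unique[OF z, where B = B])
      fix i
      define m where "m = k + \<sigma> * int (Suc i)"
      have m: "m \<noteq> k" using \<sigma> by (auto simp: m_def)
      have "u (m + 1) + u (m - 1) = u (k + \<sigma> * int (Suc (Suc i))) + u (k + \<sigma> * int i)"
        unfolding m_def by (rule ray_neighbours[OF \<sigma>])
      then show "(z + 1 / z) * ray k \<sigma> u (Suc i) - ray k \<sigma> u (Suc (Suc i)) - ray k \<sigma> u i = ray k \<sigma> h (Suc i)"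
        using eq[OF m] unfolding ray_def m_def[symmetric] diff_diff_eq by simp
    qed (simp_all add: ray_def uk ub)
    then show ?thesis by (simp add: n cut_solve_ray[OF \<sigma>]) (simp add: ray_def)
  qed
qed

lemma cut_admissible_l11:
  "norm z \<le> 1 \<Longrightarrow> cut_l11le k h M \<Longrightarrow> cut_admissible k z h"
  unfolding cut_admissible_def cut_l11le_def using admissible_l11 by blast

lemma cut_admissible_bounded:
  assumes "norm z < 1" "\<And>n. n \<noteq> k \<Longrightarrow> norm (h n) \<le> B"
  shows "cut_admissible k z h"
  unfolding cut_admissible_def by (auto intro!: admissible_bounded[where B = B] assms simp: ray_def)

lemma cut_solve_bound_l11:
  assumes "norm z \<le> 1" "cut_l11le k h M"
  shows "norm (cut_solve k z h n) \<le> M"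
proof (rule ray_cases[of n k])
  fix \<sigma> :: int and j assume \<sigma>: "\<sigma> \<in> {1, -1}" and n: "n = k + \<sigma> * int j"
  then show ?thesis
    using half_line_bound_l11[OF assms(1), of "ray k \<sigma> h" M j] assms(2)
    by (simp only: n cut_solve_ray cut_l11le_def)
qed

lemma cut_solve_lipschitz:
  assumes "norm z \<le> 1" "norm w \<le> 1" "cut_l11le k h M"
  shows "norm (cut_solve k z h n - cut_solve k w h n) \<le> real (gap k n) * (2 * norm (z - w) * M)"
proof (rule ray_cases[of n k])
  fix \<sigma> :: int and j assume \<sigma>: "\<sigma> \<in> {1, -1}" and n: "n = k + \<sigma> * int j"
  then show ?thesis
    using half_line_lipschitz[OF assms(1,2), of "ray k \<sigma> h" M j] assms(3)
    by (simp only: n cut_solve_ray cut_l11le_def gap_ray)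
qed

lemma l2le_extend:
  fixes f :: "'j \<Rightarrow> 'i"
  assumes f: "inj f" and u: "l2le (\<lambda>j. u (f j)) M" and z: "\<And>i. i \<notin> range f \<Longrightarrow> u i = 0"
  shows "l2le u M"
  unfolding l2le_def
proof (intro allI impI)
  fix A :: "'i set" assume A: "finite A"
  have "(\<Sum>i\<in>A. (norm (u i))\<^sup>2) = (\<Sum>i\<in>f ` (f -` A). (norm (u i))\<^sup>2)"
    using A z by (intro sum.mono_neutral_right) auto
  also have "\<dots> = (\<Sum>j\<in>f -` A. (norm (u (f j)))\<^sup>2)"
    using f by (subst sum.reindex) (auto intro: inj_on_subset)
  finally show "L2_set (\<lambda>i. norm (u i)) A \<le> M"
    using u finite_vimageI[OF A f] by (simp add: L2_set_def l2le_def)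
qed

lemma l2le_rays:
  assumes "\<And>\<sigma>. \<sigma> \<in> {1, -1} \<Longrightarrow> l2le (ray k \<sigma> u) M"
  shows "l2le u (2 * M)"
proof -
  have 1: "l2le (\<lambda>n. if k \<le> n then u n else 0) M"
  proof (rule l2le_extend[of "\<lambda>j. k + int j"])
    show "l2le (\<lambda>j. if k \<le> k + int j then u (k + int j) else 0) M"
      using assms[of 1] by (simp add: ray_def[abs_def])
    show "(if k \<le> i then u i else 0) = 0" if "i \<notin> range (\<lambda>j. k + int j)" for i
      using that by (auto simp: image_iff) (metis add_diff_inverse diff_ge_0_iff_ge int_nat_eq le_add_diff_inverse zle_iff_zadd)
  qed (auto simp: inj_def)
  have 2: "l2le (\<lambda>n. if k \<le> n then 0 else u n) M"
  proof (rule l2le_extend[of "\<lambda>j. k - int j"])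
    show "l2le (\<lambda>j. if k \<le> k - int j then 0 else u (k - int j)) M"
      by (rule l2le_mono_pointwise[OF assms[of "-1"]]) (auto simp: ray_def)
    show "(if k \<le> i then 0 else u i) = 0" if "i \<notin> range (\<lambda>j. k - int j)" for i
    proof (rule ccontr)
      assume "\<not> ?thesis"
      then have "i = k - int (nat (k - i))" by (auto split: if_splits)
      then show False using that by blast
    qed
  qed (auto simp: inj_def)
  have "l2le (\<lambda>n. (if k \<le> n then u n else 0) + (if k \<le> n then 0 else u n)) (M + M)"
    by (rule l2le_add[OF 1 2])
  then show ?thesis by (rule l2le_mono_pointwise[THEN l2le_mono]) auto
qed

lemma cut_solve_l2:
  assumes z: "norm z \<le> r" "r < 1" and h: "l2le (\<lambda>n. if n = k then 0 else h n) M"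
  shows "l2le (cut_solve k z h) (4 * M / (1 - r) ^ 3)"
proof -
  have "l2le (ray k \<sigma> (cut_solve k z h)) (2 * M / (1 - r) ^ 3)" if \<sigma>: "\<sigma> \<in> {1, -1}" for \<sigma>
  proof -
    have "l2le (\<lambda>j. if k + \<sigma> * int (Suc j) = k then 0 else h (k + \<sigma> * int (Suc j))) M"
      by (rule l2le_reindex[OF h, of "\<lambda>j. k + \<sigma> * int (Suc j)"]) (use \<sigma> in \<open>auto simp: inj_def\<close>)
    then have "l2le (\<lambda>j. ray k \<sigma> h (Suc j)) M"
      by (rule l2le_mono_pointwise) (use \<sigma> in \<open>auto simp: ray_def\<close>)
    then have "l2le (half_line z (ray k \<sigma> h)) (2 * M / (1 - r) ^ 3)"
      by (rule half_line_l2[OF z])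
    then show ?thesis by (simp add: ray_def[of _ _ "cut_solve k z h", abs_def] cut_solve_ray[OF \<sigma>])
  qed
  from l2le_rays[OF this] show ?thesis by simp
qed

section \<open>Geometric decay and weighted summability about the cut site\<close>

lemma sum_half_powers: "(\<Sum>j<N. (1 / 2 :: real) ^ j) \<le> 2"
  using sum_le_suminf[of "\<lambda>j. (1 / 2 :: real) ^ j" "{..<N}"]
  by (simp add: suminf_geometric summable_geometric)

lemma l2le_geometric:
  assumes "\<And>n. norm (h n) \<le> c * (1 / 2) ^ gap k n"
  shows "l2le h (4 * c)"
proof -
  have c: "0 \<le> c" using order_trans[OF norm_ge_zero assms[of k]] by simp
  have "l2le (ray k \<sigma> h) (2 * c)" if \<sigma>: "\<sigma> \<in> {1, -1}" for \<sigma>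
    unfolding l2le_nat_iff
  proof
    fix N
    have "L2_set (\<lambda>j. norm (ray k \<sigma> h j)) {..<N} \<le> (\<Sum>j<N. norm (ray k \<sigma> h j))"
      by (rule L2_set_le_sum) auto
    also have "\<dots> \<le> (\<Sum>j<N. c * (1 / 2) ^ j)"
      by (intro sum_mono) (metis assms gap_ray[OF \<sigma>] ray_def)
    also have "\<dots> \<le> c * 2"
      unfolding sum_distrib_left[symmetric] by (intro mult_left_mono sum_half_powers c)
    finally show "L2_set (\<lambda>j. norm (ray k \<sigma> h j)) {..<N} \<le> 2 * c" by simp
  qed
  from l2le_rays[OF this] show ?thesis by simp
qed

lemma cut_l11le_geometric:
  assumes "\<And>n. n \<noteq> k \<Longrightarrow> norm (h n) \<le> c * (1 / 2) ^ gap k n"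
  shows "cut_l11le k h (2 * c)"
  unfolding cut_l11le_def l11le_def
proof
  fix \<sigma> :: int assume \<sigma>: "\<sigma> \<in> {1, -1}"
  have "(\<lambda>j. real (Suc j) * (1 / 2) ^ j) sums (1 / (1 - 1 / 2)\<^sup>2)"
    using geometric_deriv_sums[of "1 / 2 :: real"] by simp
  from sums_mult[OF this, of "c / 2"]
  have "(\<lambda>j. real (Suc j) * (c * (1 / 2) ^ Suc j)) sums (2 * c)"
    by (simp add: power2_eq_square mult_ac)
  then have s: "(\<lambda>j. real j * (c * (1 / 2) ^ j)) sums (2 * c)"
    using sums_Suc[of "\<lambda>j. real j * (c * (1 / 2) ^ j)"] by fastforce
  have le: "norm (real j * norm (ray k \<sigma> h j)) \<le> real j * (c * (1 / 2) ^ j)" for j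
  proof (cases "j = 0")
    case False
    then have "k + \<sigma> * int j \<noteq> k" using \<sigma> by auto
    from assms[OF this] show ?thesis
      by (simp add: gap_ray[OF \<sigma>] ray_def mult_left_mono)
  qed simp
  have sm: "summable (\<lambda>j. real j * norm (ray k \<sigma> h j))"
    by (rule summable_comparison_test'[OF sums_summable[OF s], of 0]) (rule le)
  moreover have "(\<Sum>j. real j * norm (ray k \<sigma> h j)) \<le> (\<Sum>j. real j * (c * (1 / 2) ^ j))"
    by (rule suminf_le[OF _ sm sums_summable[OF s]]) (use le in simp)
  ultimately show "summable (\<lambda>m. real m * norm (ray k \<sigma> h m)) \<and> (\<Sum>m. real m * norm (ray k \<sigma> h m)) \<le> 2 * c"
    using sums_unique[OF s] by simp
qed

lemma l11le_add:
  assumes "l11le h M" "l11le g N"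
  shows "l11le (\<lambda>j. h j + g j) (M + N)"
  unfolding l11le_def
proof
  have sh: "summable (\<lambda>m. real m * norm (h m))" and sg: "summable (\<lambda>m. real m * norm (g m))"
    using assms by (auto simp: l11le_def)
  note s = summable_add[OF sh sg]
  have le: "real j * norm (h j + g j) \<le> real j * norm (h j) + real j * norm (g j)" for j
    unfolding distrib_left[symmetric] by (intro mult_left_mono norm_triangle_ineq) auto
  show sm: "summable (\<lambda>j. real j * norm (h j + g j))"
    by (rule summable_comparison_test'[OF s, of 0]) (use le in auto)
  show "(\<Sum>j. real j * norm (h j + g j)) \<le> M + N"
    using suminf_le[OF le sm s] suminf_add[OF sh sg] assms by (simp add: l11le_def)
qed

lemma l11le_cmult:
  assumes "l11le h M"
  shows "l11le (\<lambda>j. c * h j) (norm c * M)"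
proof -
  have s: "summable (\<lambda>m. real m * norm (h m))" using assms by (simp add: l11le_def)
  have e: "real m * norm (c * h m) = norm c * (real m * norm (h m))" for m
    by (simp only: norm_mult ac_simps)
  show ?thesis
    using assms summable_mult[OF s, of "norm c"] suminf_mult[OF s, of "norm c"]
    unfolding l11le_def e by (simp add: mult_left_mono)
qed

lemma cut_l11le_add:
  "cut_l11le k h M \<Longrightarrow> cut_l11le k g N \<Longrightarrow> cut_l11le k (\<lambda>n. h n + g n) (M + N)"
  using l11le_add by (fastforce simp: cut_l11le_def ray_def[abs_def])

lemma cut_l11le_cmult:
  "cut_l11le k h M \<Longrightarrow> cut_l11le k (\<lambda>n. c * h n) (norm c * M)"
  using l11le_cmult by (fastforce simp: cut_l11le_def ray_def[abs_def])

lemma lqs_1_1: "u \<in> lqs 1 1 \<longleftrightarrow> (\<lambda>n. sqrt (1 + (real_of_int n)\<^sup>2) * norm (u n)) summable_on UNIV"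
  and lqs_norm_1_1: "lqs_norm 1 1 u = (\<Sum>\<^sub>\<infinity>n. sqrt (1 + (real_of_int n)\<^sup>2) * norm (u n))"
proof -
  have "0 \<le> 1 + (real_of_int n)\<^sup>2" for n by simp
  then have e: "((1 + (real_of_int n)\<^sup>2) powr (1 / 2) * norm (u n)) powr 1
      = sqrt (1 + (real_of_int n)\<^sup>2) * norm (u n)" for n
    by (simp add: powr_half_sqrt)
  show "u \<in> lqs 1 1 \<longleftrightarrow> (\<lambda>n. sqrt (1 + (real_of_int n)\<^sup>2) * norm (u n)) summable_on UNIV"
    by (simp only: lqs_def e mem_Collect_eq)
  show "lqs_norm 1 1 u = (\<Sum>\<^sub>\<infinity>n. sqrt (1 + (real_of_int n)\<^sup>2) * norm (u n))"
    by (simp only: lqs_norm_def e) (simp add: infsum_nonneg)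
qed

lemma lqs_1_1_finite_sum:
  assumes "u \<in> lqs 1 1" "finite A"
  shows "(\<Sum>n\<in>A. sqrt (1 + (real_of_int n)\<^sup>2) * norm (u n)) \<le> lqs_norm 1 1 u"
  unfolding lqs_norm_1_1
  by (rule finite_sum_le_infsum) (use assms in \<open>auto simp: lqs_1_1\<close>)

lemma l2le_lqs_1_1:
  assumes "u \<in> lqs 1 1"
  shows "l2le u (lqs_norm 1 1 u)"
  unfolding l2le_def
proof (intro allI impI)
  fix A :: "int set" assume A: "finite A"
  have "L2_set (\<lambda>n. norm (u n)) A \<le> (\<Sum>n\<in>A. norm (u n))"
    by (rule L2_set_le_sum) auto
  also have "\<dots> \<le> (\<Sum>n\<in>A. sqrt (1 + (real_of_int n)\<^sup>2) * norm (u n))"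
  proof (rule sum_mono)
    fix n
    show "norm (u n) \<le> sqrt (1 + (real_of_int n)\<^sup>2) * norm (u n)"
      using mult_right_mono[of 1 "sqrt (1 + (real_of_int n)\<^sup>2)" "norm (u n)"] by simp
  qed
  also have "\<dots> \<le> lqs_norm 1 1 u" by (rule lqs_1_1_finite_sum[OF assms A])
  finally show "L2_set (\<lambda>n. norm (u n)) A \<le> lqs_norm 1 1 u" .
qed

text \<open>The weight of \<open>lqs 1 1\<close> is centred at 0, while the Green function grows
  with the distance from \<open>k\<close>. Comparing the two by
  \<open>|n - k| \<le> |n| + |k|\<close> is what makes the final constant depend on
  \<open>k\<close>.\<close>

lemma cut_l11le_lqs_1_1:
  assumes "u \<in> lqs 1 1"
  shows "cut_l11le k u ((1 + real_of_int \<bar>k\<bar>) * lqs_norm 1 1 u)"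
  unfolding cut_l11le_def l11le_def
proof
  fix \<sigma> :: int assume \<sigma>: "\<sigma> \<in> {1, -1}"
  let ?f = "\<lambda>j. k + \<sigma> * int j" and ?c = "1 + real_of_int \<bar>k\<bar>"
  have w: "real j \<le> ?c * sqrt (1 + (real_of_int (?f j))\<^sup>2)" for j
  proof -
    define a where "a = \<bar>real_of_int (?f j)\<bar>"
    have "a \<le> sqrt (1 + (real_of_int (?f j))\<^sup>2)" unfolding a_def by (intro real_le_rsqrt) simp
    moreover have "1 \<le> sqrt (1 + (real_of_int (?f j))\<^sup>2)" by simp
    moreover have "real j \<le> a + real_of_int \<bar>k\<bar>" using \<sigma> unfolding a_def by auto
    ultimately show ?thesis
      using mult_left_mono[of 1 "sqrt (1 + (real_of_int (?f j))\<^sup>2)" "real_of_int \<bar>k\<bar>"]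
      by (simp add: algebra_simps)
  qed
  have b: "(\<Sum>j<N. real j * norm (ray k \<sigma> u j)) \<le> ?c * lqs_norm 1 1 u" for N
  proof -
    have inj: "inj_on ?f {..<N}" using \<sigma> by (auto simp: inj_on_def)
    have "(\<Sum>j<N. real j * norm (ray k \<sigma> u j))
        \<le> (\<Sum>j<N. ?c * (sqrt (1 + (real_of_int (?f j))\<^sup>2) * norm (u (?f j))))"
      unfolding mult.assoc[symmetric] ray_def by (intro sum_mono mult_right_mono w) auto
    also have "\<dots> = ?c * (\<Sum>n\<in>?f ` {..<N}. sqrt (1 + (real_of_int n)\<^sup>2) * norm (u n))"
      unfolding sum.reindex[OF inj] by (simp add: sum_distrib_left)
    also have "\<dots> \<le> ?c * lqs_norm 1 1 u"
      by (intro mult_left_mono lqs_1_1_finite_sum assms) auto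
    finally show ?thesis .
  qed
  have s: "summable (\<lambda>j. real j * norm (ray k \<sigma> u j))"
    by (rule summableI_nonneg_bounded) (use b in auto)
  then show "summable (\<lambda>j. real j * norm (ray k \<sigma> u j)) \<and> (\<Sum>j. real j * norm (ray k \<sigma> u j)) \<le> ?c * lqs_norm 1 1 u"
    using suminf_le_const[OF s b] by simp
qed


section \<open>The soliton and its Jordan partner\<close>

definition peak :: "int \<Rightarrow> real \<Rightarrow> int \<Rightarrow> real" where
  "peak k s n = (if n = k then s else 0)"

text \<open>Weights for which \<open>lap\<close> is bounded in the weighted sup norm. The
  exponential one yields decay of the soliton, the constant one uniqueness among bounded
  solutions.\<close>

definition slowly_varying :: "(int \<Rightarrow> real) \<Rightarrow> bool" where
  "slowly_varying \<nu> \<longleftrightarrow> (\<forall>n. 0 < \<nu> n) \<and> (\<forall>m n. \<bar>m - n\<bar> \<le> 1 \<longrightarrow> \<nu> m \<le> 2 * \<nu> n)"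

lemma slowly_varying_const: "slowly_varying (\<lambda>_. 1)"
  by (simp add: slowly_varying_def)

lemma slowly_varying_half_power: "slowly_varying (\<lambda>n. (1 / 2) ^ gap k n)"
  using half_power_neighbour by (simp add: slowly_varying_def)

lemma lap_bound:
  fixes u :: "int \<Rightarrow> real"
  assumes \<nu>: "slowly_varying \<nu>" and u: "\<And>j. \<bar>u j\<bar> \<le> D * \<nu> j"
  shows "\<bar>lap u n\<bar> \<le> 6 * D * \<nu> n"
proof -
  have p: "0 < \<nu> n" using \<nu> by (simp add: slowly_varying_def)
  have D: "0 \<le> D" using order_trans[OF abs_ge_zero u[of n]] p by (simp add: zero_le_mult_iff)
  have nb: "D * \<nu> m \<le> 2 * (D * \<nu> n)" if "\<bar>m - n\<bar> \<le> 1" for m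
    using \<nu> that mult_left_mono[OF _ D, of "\<nu> m" "2 * \<nu> n"] by (simp add: slowly_varying_def)
  have "\<bar>lap u n\<bar> \<le> \<bar>u (n + 1)\<bar> + 2 * \<bar>u n\<bar> + \<bar>u (n - 1)\<bar>"
    unfolding lap_def by linarith
  also have "\<dots> \<le> 6 * (D * \<nu> n)"
    using u[of "n + 1"] u[of n] u[of "n - 1"] nb[of "n + 1"] nb[of "n - 1"] by linarith
  finally show ?thesis by simp
qed

lemma lap_add: "lap (\<lambda>n. u n + v n) n = lap u n + lap v n"
  and lap_diff: "lap (\<lambda>n. u n - v n) n = lap u n - lap v n"
  by (simp_all add: lap_def algebra_simps)

text \<open>Writing \<open>\<phi> = peak k s + \<eta>\<close>, the linear part of \<open>(1 - \<phi>\<^sup>2)\<phi>\<close> in \<open>\<eta>\<close> is \<open>-2\<eta>\<close> at \<open>k\<close> and \<open>\<eta>\<close> elsewhere.\<close>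

definition soliton_map :: "int \<Rightarrow> real \<Rightarrow> real \<Rightarrow> (int \<Rightarrow> real) \<Rightarrow> int \<Rightarrow> real" where
  "soliton_map k s \<epsilon> \<eta> n =
    (if n = k then - (3 * s * (\<eta> n)\<^sup>2 + \<eta> n ^ 3 + \<epsilon> * lap (\<lambda>n. peak k s n + \<eta> n) n) / 2
     else \<eta> n ^ 3 + \<epsilon> * lap (\<lambda>n. peak k s n + \<eta> n) n)"

lemma soliton_map_fixed:
  assumes s: "s \<in> {1, -1 :: real}"
  shows "soliton_map k s \<epsilon> \<eta> n = \<eta> n \<longleftrightarrow>
    (1 - (peak k s n + \<eta> n)\<^sup>2) * (peak k s n + \<eta> n) = \<epsilon> * lap (\<lambda>n. peak k s n + \<eta> n) n"
proof -
  have s2: "s\<^sup>2 = 1" using s by auto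
  have "(1 - (s + x)\<^sup>2) * (s + x) = - 2 * x - 3 * s * x\<^sup>2 - x ^ 3" for x
  proof -
    have "(1 - (s + x)\<^sup>2) * (s + x)
        = - 2 * x - 3 * s * x\<^sup>2 - x ^ 3 + (1 - s\<^sup>2) * (s + 3 * x)"
      by (simp add: power2_eq_square power3_eq_cube algebra_simps)
    then show ?thesis using s2 by simp
  qed
  note e = this[of "\<eta> n"]
  show ?thesis
  proof (cases "n = k")
    case True
    then show ?thesis unfolding soliton_map_def peak_def using e by auto
  next
    case False
    have "(1 - (\<eta> n)\<^sup>2) * \<eta> n = \<eta> n - \<eta> n ^ 3"
      by (simp add: power2_eq_square power3_eq_cube algebra_simps)
    then show ?thesis using False unfolding soliton_map_def peak_def by auto
  qed
qed

text \<open>At \<open>k\<close> the quadratic term dominates, with factor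
  \<open>(3/5 + 3/100 + 6/100) / 2 < 1/2\<close>; elsewhere only the cubic and the lattice term
  remain, with factor \<open>3/100 + 6/100\<close>.\<close>

lemma soliton_map_contraction:
  assumes s: "s \<in> {1, -1}" and \<epsilon>: "0 \<le> \<epsilon>" "\<epsilon> \<le> 1 / 100" and \<nu>: "slowly_varying \<nu>"
    and b: "\<And>j. \<bar>\<eta> j\<bar> \<le> 1 / 10" "\<And>j. \<bar>\<eta>' j\<bar> \<le> 1 / 10" and d: "\<And>j. \<bar>\<eta> j - \<eta>' j\<bar> \<le> D * \<nu> j"
  shows "\<bar>soliton_map k s \<epsilon> \<eta> n - soliton_map k s \<epsilon> \<eta>' n\<bar> \<le> 1 / 2 * D * \<nu> n"
proof -
  define x y where "x = \<eta> n" and "y = \<eta>' n"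
  have xb: "\<bar>x\<bar> \<le> 1 / 10" and yb: "\<bar>y\<bar> \<le> 1 / 10" and xy: "\<bar>x - y\<bar> \<le> D * \<nu> n"
    using b d by (auto simp: x_def y_def)
  have Dn: "0 \<le> D * \<nu> n" using xy by linarith
  have q2: "\<bar>x\<^sup>2 - y\<^sup>2\<bar> \<le> 1 / 5 * (D * \<nu> n)"
  proof -
    have "x\<^sup>2 - y\<^sup>2 = (x + y) * (x - y)" by (simp add: power2_eq_square algebra_simps)
    also have "\<bar>\<dots>\<bar> \<le> 1 / 5 * (D * \<nu> n)"
      unfolding abs_mult by (rule mult_mono) (use xb yb xy in linarith)+
    finally show ?thesis .
  qed
  have q3: "\<bar>x ^ 3 - y ^ 3\<bar> \<le> 3 / 100 * (D * \<nu> n)"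
  proof -
    have "\<bar>x * x\<bar> \<le> 1 / 10 * (1 / 10)" "\<bar>x * y\<bar> \<le> 1 / 10 * (1 / 10)" "\<bar>y * y\<bar> \<le> 1 / 10 * (1 / 10)"
      unfolding abs_mult by (intro mult_mono; use xb yb in linarith)+
    then have "\<bar>x * x + x * y + y * y\<bar> \<le> 3 / 100" by linarith
    moreover have "x ^ 3 - y ^ 3 = (x * x + x * y + y * y) * (x - y)"
      by (simp add: power3_eq_cube algebra_simps)
    ultimately show ?thesis
      unfolding abs_mult using xy by (simp only: abs_mult) (rule mult_mono, auto)
  qed
  define l where "l = lap (\<lambda>n. \<eta> n - \<eta>' n) n"
  have "\<bar>l\<bar> \<le> 6 * D * \<nu> n" unfolding l_def by (rule lap_bound[OF \<nu> d])
  then have el: "\<bar>\<epsilon> * l\<bar> \<le> 6 / 100 * (D * \<nu> n)"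
    using mult_mono[of "\<bar>\<epsilon>\<bar>" "1 / 100" "\<bar>l\<bar>" "6 * D * \<nu> n"] \<epsilon> by (simp add: abs_mult)
  have le: "\<epsilon> * lap (\<lambda>n. peak k s n + \<eta> n) n - \<epsilon> * lap (\<lambda>n. peak k s n + \<eta>' n) n = \<epsilon> * l"
    unfolding l_def lap_add lap_diff by (simp add: algebra_simps)
  show ?thesis
  proof (cases "n = k")
    case True
    have "soliton_map k s \<epsilon> \<eta> n - soliton_map k s \<epsilon> \<eta>' n
        = - (3 * (s * (x\<^sup>2 - y\<^sup>2)) + (x ^ 3 - y ^ 3) + \<epsilon> * l) / 2"
      using True unfolding soliton_map_def le[symmetric] x_def y_def by (simp add: field_simps)
    moreover have "\<bar>s * (x\<^sup>2 - y\<^sup>2)\<bar> \<le> 1 / 5 * (D * \<nu> n)" using s q2 by (auto simp: abs_mult)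
    moreover have "\<bar>- (3 * t + a + b) / 2\<bar> \<le> 1 / 2 * e"
      if "\<bar>t\<bar> \<le> 1 / 5 * e" "\<bar>a\<bar> \<le> 3 / 100 * e" "\<bar>b\<bar> \<le> 6 / 100 * e" "0 \<le> e" for t a b e :: real
      using that unfolding abs_le_iff by (simp add: field_simps)
    ultimately show ?thesis using q3 el Dn by (simp only: mult.assoc)
  next
    case False
    have "soliton_map k s \<epsilon> \<eta> n - soliton_map k s \<epsilon> \<eta>' n = (x ^ 3 - y ^ 3) + \<epsilon> * l"
      using False unfolding soliton_map_def le[symmetric] x_def y_def by (simp add: algebra_simps)
    then show ?thesis using q3 el Dn by linarith
  qed
qed

text \<open>Only \<open>k\<close> and its two neighbours feel the Laplacian of the peak. The value
  there is \<epsilon> in modulus, and at the neighbours the bound is attained.\<close>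

lemma soliton_map_zero_bound:
  assumes "s \<in> {1, -1}" "0 \<le> \<epsilon>"
  shows "\<bar>soliton_map k s \<epsilon> (\<lambda>_. 0) n\<bar> \<le> 2 * \<epsilon> * (1 / 2) ^ gap k n"
proof -
  consider "n = k" | "n = k + 1" | "n = k - 1" | "n \<notin> {k - 1, k, k + 1}" by auto
  then show ?thesis
    by cases (use assms in \<open>auto simp: soliton_map_def peak_def lap_def gap_def abs_mult\<close>)
qed

lemma soliton_exists:
  assumes s: "s \<in> {1, -1}" and \<epsilon>: "0 < \<epsilon>" "\<epsilon> \<le> 1 / 100"
  shows "\<exists>\<eta>. (\<forall>n. \<bar>\<eta> n\<bar> \<le> 4 * \<epsilon> * (1 / 2) ^ gap k n) \<and> soliton_map k s \<epsilon> \<eta> = \<eta>"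
proof -
  let ?\<nu> = "\<lambda>n. (1 / 2 :: real) ^ gap k n"
  have small: "\<bar>\<eta> n\<bar> \<le> 1 / 10" if "\<And>j. norm (\<eta> j) \<le> 4 * \<epsilon> * ?\<nu> j" for \<eta> :: "int \<Rightarrow> real" and n
  proof -
    have "4 * \<epsilon> * ?\<nu> n \<le> 1 / 10 * 1" using \<epsilon> by (intro mult_mono power_le_one) auto
    then show ?thesis using that[of n] by simp
  qed
  have contr: "norm (soliton_map k s \<epsilon> \<eta> n - soliton_map k s \<epsilon> \<eta>' n) \<le> 1 / 2 * D * ?\<nu> n"
    if "\<And>j. norm (\<eta> j) \<le> 4 * \<epsilon> * ?\<nu> j" "\<And>j. norm (\<eta>' j) \<le> 4 * \<epsilon> * ?\<nu> j" "\<And>j. norm (\<eta> j - \<eta>' j) \<le> D * ?\<nu> j"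
    for \<eta> \<eta>' D n
    unfolding real_norm_def
    by (rule soliton_map_contraction[OF s _ _ slowly_varying_half_power small[OF that(1)] small[OF that(2)]])
      (use \<epsilon> that(3) in auto)
  have "\<exists>\<eta>. (\<forall>n. norm (\<eta> n) \<le> 4 * \<epsilon> * ?\<nu> n) \<and> soliton_map k s \<epsilon> \<eta> = \<eta>"
  \<comment> \<open>The radius \<open>4 * \<epsilon>\<close> is the size
    \<open>2 * \<epsilon>\<close> of the map at zero divided by \<open>1 - q\<close>.\<close>
  proof (rule weighted_sup_fixpoint[where q = "1 / 2"])
    fix \<eta> :: "int \<Rightarrow> real" and n assume *: "\<And>j. norm (\<eta> j) \<le> 4 * \<epsilon> * ?\<nu> j"
    have "norm (soliton_map k s \<epsilon> \<eta> n - soliton_map k s \<epsilon> (\<lambda>_. 0) n) \<le> 1 / 2 * (4 * \<epsilon>) * ?\<nu> n"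
      by (rule contr) (use * \<epsilon> in auto)
    then show "norm (soliton_map k s \<epsilon> \<eta> n) \<le> 4 * \<epsilon> * ?\<nu> n"
      using soliton_map_zero_bound[OF s, of \<epsilon> k n] \<epsilon> by simp
  qed (use contr \<epsilon> in auto)
  then show ?thesis by simp
qed

text \<open>The weight is constant because a competing solution is known only to be bounded; its
  decay is a consequence of the equality.\<close>

lemma soliton_map_fixed_unique:
  assumes s: "s \<in> {1, -1}" and \<epsilon>: "0 < \<epsilon>" "\<epsilon> \<le> 1 / 100"
    and b: "\<And>j. \<bar>\<eta> j\<bar> \<le> 1 / 10" "\<And>j. \<bar>\<eta>' j\<bar> \<le> 1 / 10"
    and f: "soliton_map k s \<epsilon> \<eta> = \<eta>" "soliton_map k s \<epsilon> \<eta>' = \<eta>'"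
  shows "\<eta> = \<eta>'"
proof
  fix n
  have "\<bar>\<eta> n - \<eta>' n\<bar> \<le> 0 / (1 - 1 / 2)"
  proof (rule sup_absorb[where a = "\<lambda>n. \<bar>\<eta> n - \<eta>' n\<bar>" and B = "1 / 5" and q = "1 / 2"])
    show "\<bar>\<eta> n - \<eta>' n\<bar> \<le> 1 / 5" for n using b(1)[of n] b(2)[of n] by linarith
    show "\<bar>\<eta> n - \<eta>' n\<bar> \<le> 1 / 2 * D + 0" if "\<And>j. \<bar>\<eta> j - \<eta>' j\<bar> \<le> D" for D n
      using soliton_map_contraction[OF s _ \<epsilon>(2) slowly_varying_const, of \<eta> \<eta>' D k n] \<epsilon> b that
      by (simp add: f)
  qed simp
  then show "\<eta> n = \<eta>' n" by simp
qed

text \<open>The \<open>l\<^sup>2\<close> distance bounds the sup distance, so every nearby solution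
  lies where \<open>soliton_map\<close> contracts; this is the origin of the radius 1/10. Conversely
  the constructed solution is within \<open>16 * \<epsilon>\<close> of the peak.\<close>

lemma soliton_near_iff:
  assumes s: "s \<in> {1, -1}" and lim: "limit_soliton Up Um = peak k s" and \<epsilon>: "0 < \<epsilon>" "\<epsilon> \<le> 1 / 1000"
    and \<eta>: "\<And>n. \<bar>\<eta> n\<bar> \<le> 4 * \<epsilon> * (1 / 2) ^ gap k n" "soliton_map k s \<epsilon> \<eta> = \<eta>"
  shows "soliton_near 1 Up Um (1 / 10) \<epsilon> \<phi> \<longleftrightarrow> \<phi> = (\<lambda>n. peak k s n + \<eta> n)"
proof
  assume *: "soliton_near 1 Up Um (1 / 10) \<epsilon> \<phi>"
  define \<zeta> where "\<zeta> n = \<phi> n - peak k s n" for n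
  have \<phi>: "\<phi> = (\<lambda>n. peak k s n + \<zeta> n)" by (simp add: \<zeta>_def)
  have p: "l2le (peak k s) (4 * 1)"
    by (rule l2le_geometric[where k = k]) (use s in \<open>auto simp: peak_def\<close>)
  have "\<phi> \<in> lqs 2 0" "lqs_norm 2 0 (\<phi> - peak k s) < 1 / 10"
    using * by (auto simp: soliton_near_def lim)
  then have "l2le \<zeta> (1 / 10)"
    using l2le_diff[OF l2le_lqs p] by (simp add: l2le_iff \<zeta>_def[abs_def] fun_diff_def)
  then have b: "\<bar>\<zeta> n\<bar> \<le> 1 / 10" for n using l2le_pointwise by fastforce
  have "soliton_map k s \<epsilon> \<zeta> = \<zeta>"
    using * unfolding fun_eq_iff soliton_map_fixed[OF s] \<phi>[symmetric]
    by (simp add: soliton_near_def \<zeta>_def)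
  moreover have "\<bar>\<eta> n\<bar> \<le> 1 / 10" for n
  proof -
    have "4 * \<epsilon> * (1 / 2) ^ gap k n \<le> 1 / 10 * 1" using \<epsilon> by (intro mult_mono power_le_one) auto
    then show ?thesis using \<eta>(1)[of n] by simp
  qed
  ultimately have "\<zeta> = \<eta>" by (intro soliton_map_fixed_unique[OF s _ _ b]) (use \<epsilon> \<eta> in auto)
  then show "\<phi> = (\<lambda>n. peak k s n + \<eta> n)" using \<phi> by simp
next
  assume \<phi>: "\<phi> = (\<lambda>n. peak k s n + \<eta> n)"
  have p: "l2le (peak k s) (4 * 1)"
    by (rule l2le_geometric[where k = k]) (use s in \<open>auto simp: peak_def\<close>)
  have e: "l2le \<eta> (4 * (4 * \<epsilon>))" by (rule l2le_geometric[where k = k]) (use \<eta> in auto)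
  have "\<phi> - peak k s = \<eta>" by (simp add: \<phi> fun_eq_iff)
  then have "lqs_norm 2 0 (\<phi> - peak k s) \<le> 4 * (4 * \<epsilon>)" using e by (simp add: l2le_iff)
  moreover have "\<phi> \<in> lqs 2 0" using l2le_add[OF p e] unfolding \<phi> by (simp add: l2le_iff)
  moreover have "(1 - \<phi> n ^ (2 * 1)) * \<phi> n = \<epsilon> * lap \<phi> n" for n
    using soliton_map_fixed[OF s, of k \<epsilon> \<eta> n] \<eta>(2) by (simp add: \<phi>)
  ultimately show "soliton_near 1 Up Um (1 / 10) \<epsilon> \<phi>"
    using \<epsilon> by (simp add: soliton_near_def lim)
qed

text \<open>Fixed points solve \<open>-\<epsilon>\<Delta>\<psi> + \<psi> - 3\<phi>\<^sup>2\<psi> = \<phi>\<close>; at \<open>k\<close>, where \<open>1 - 3\<phi>\<^sup>2\<close> is close to \<open>-2\<close>, the equation has been divided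
  by \<open>-2\<close>.\<close>

definition jordan_map :: "int \<Rightarrow> (int \<Rightarrow> real) \<Rightarrow> real \<Rightarrow> (int \<Rightarrow> real) \<Rightarrow> int \<Rightarrow> real" where
  "jordan_map k \<phi> \<epsilon> \<psi> n =
    (if n = k then - (\<phi> n + \<epsilon> * lap \<psi> n + 3 * (((\<phi> n)\<^sup>2 - 1) * \<psi> n)) / 2
     else \<phi> n + \<epsilon> * lap \<psi> n + 3 * ((\<phi> n)\<^sup>2 * \<psi> n))"

text \<open>The map is affine, so \<open>lin\<close> holds without restriction to a ball. To leading
  order the equation at \<open>k\<close> reads \<open>- 2 * \<psi> k = s\<close>; that
  \<open>\<psi> k\<close> stays away from 0 is what allows \<open>(\<psi>, \<psi>)\<close> to serve
  as a coordinate at \<open>k\<close>.\<close>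

lemma jordan_exists:
  fixes s \<epsilon> :: real
  assumes s: "s \<in> {1, -1}" and \<epsilon>: "0 < \<epsilon>" "\<epsilon> \<le> 1 / 1000"
    and \<phi>k: "\<bar>\<phi> k - s\<bar> \<le> 4 * \<epsilon>" and \<phi>: "\<And>n. n \<noteq> k \<Longrightarrow> \<bar>\<phi> n\<bar> \<le> 4 * \<epsilon> * (1 / 2) ^ gap k n"
  shows "\<exists>\<psi>. (\<forall>n. - \<epsilon> * lap \<psi> n + \<psi> n - 3 * (\<phi> n)\<^sup>2 * \<psi> n = \<phi> n) \<and>
    \<bar>\<psi> k + s / 2\<bar> \<le> 1 / 4 \<and> (\<forall>n. n \<noteq> k \<longrightarrow> \<bar>\<psi> n\<bar> \<le> 17 * \<epsilon> * (1 / 2) ^ gap k n)"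
proof -
  let ?\<nu> = "\<lambda>n. (1 / 2 :: real) ^ gap k n"
  have \<phi>k2: "\<bar>(\<phi> k)\<^sup>2 - 1\<bar> \<le> 9 * \<epsilon>"
  proof -
    have "(\<phi> k)\<^sup>2 - 1 = (\<phi> k + s) * (\<phi> k - s)" using s by (auto simp: power2_eq_square algebra_simps)
    also have "\<bar>\<dots>\<bar> \<le> 9 / 4 * (4 * \<epsilon>)"
      unfolding abs_mult using \<phi>k \<epsilon> s by (intro mult_mono) auto
    finally show ?thesis by simp
  qed
  have \<phi>2: "(\<phi> n)\<^sup>2 \<le> \<epsilon> / 60" if "n \<noteq> k" for n
  proof -
    have "4 * \<epsilon> * ?\<nu> n \<le> 4 * \<epsilon> * 1" using \<epsilon> by (intro mult_left_mono power_le_one) auto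
    then have "\<bar>\<phi> n\<bar> * \<bar>\<phi> n\<bar> \<le> (4 * \<epsilon>) * (4 / 1000)"
      using \<phi>[OF that] \<epsilon> by (intro mult_mono) linarith+
    then show ?thesis using \<epsilon> by (simp add: power2_eq_square)
  qed
  have step: "\<bar>\<epsilon> * lap \<psi> n + 3 * (c * \<psi> n)\<bar> \<le> (6 * \<epsilon> + 3 * C) * D * ?\<nu> n"
    if "\<And>j. \<bar>\<psi> j\<bar> \<le> D * ?\<nu> j" "\<bar>c\<bar> \<le> C" for \<psi> D n c C
  proof -
    have "\<bar>\<epsilon> * lap \<psi> n\<bar> \<le> \<epsilon> * (6 * D * ?\<nu> n)"
      unfolding abs_mult using \<epsilon> lap_bound[OF slowly_varying_half_power that(1), of n]
      by (simp add: mult_left_mono)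
    moreover have "\<bar>c * \<psi> n\<bar> \<le> C * (D * ?\<nu> n)"
      unfolding abs_mult using that by (intro mult_mono) (auto intro: order_trans[OF abs_ge_zero])
    ultimately have "\<bar>\<epsilon> * lap \<psi> n + 3 * (c * \<psi> n)\<bar> \<le> \<epsilon> * (6 * D * ?\<nu> n) + 3 * (C * (D * ?\<nu> n))"
      by linarith
    then show ?thesis by (simp add: algebra_simps)
  qed
  have stepk: "\<bar>\<epsilon> * lap \<psi> k + 3 * (((\<phi> k)\<^sup>2 - 1) * \<psi> k)\<bar> \<le> 33 * \<epsilon> * D" if "\<And>j. \<bar>\<psi> j\<bar> \<le> D * ?\<nu> j" for \<psi> D
    using step[OF that \<phi>k2, of k] by simp
  have stepn: "\<bar>\<epsilon> * lap \<psi> n + 3 * ((\<phi> n)\<^sup>2 * \<psi> n)\<bar> \<le> 6.05 * \<epsilon> * (D * ?\<nu> n)"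
    if "\<And>j. \<bar>\<psi> j\<bar> \<le> D * ?\<nu> j" "n \<noteq> k" for \<psi> D n
    using step[OF that(1), of "(\<phi> n)\<^sup>2" "\<epsilon> / 60" n] \<phi>2[OF that(2)] by simp
  have lin: "\<bar>jordan_map k \<phi> \<epsilon> \<psi> n - jordan_map k \<phi> \<epsilon> \<psi>' n\<bar> \<le> 1 / 4 * D * ?\<nu> n"
    if d: "\<And>j. \<bar>\<psi> j - \<psi>' j\<bar> \<le> D * ?\<nu> j" for \<psi> \<psi>' D n
  proof -
    have Dn: "0 \<le> D * ?\<nu> n" using d[of n] by linarith
    have De: "\<epsilon> * (D * ?\<nu> n) \<le> 1 / 1000 * (D * ?\<nu> n)" using \<epsilon> Dn by (intro mult_right_mono) auto
    show ?thesis
    proof (cases "n = k")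
      case True
      define X where "X = \<epsilon> * lap (\<lambda>j. \<psi> j - \<psi>' j) k + 3 * (((\<phi> k)\<^sup>2 - 1) * (\<psi> k - \<psi>' k))"
      have "jordan_map k \<phi> \<epsilon> \<psi> n - jordan_map k \<phi> \<epsilon> \<psi>' n = - X / 2"
        by (simp add: X_def jordan_map_def True lap_diff algebra_simps diff_divide_distrib add_divide_distrib)
      moreover have "\<bar>X\<bar> \<le> 33 * \<epsilon> * D" unfolding X_def by (rule stepk[OF d])
      ultimately show ?thesis using De Dn True by simp
    next
      case False
      have "jordan_map k \<phi> \<epsilon> \<psi> n - jordan_map k \<phi> \<epsilon> \<psi>' n
          = \<epsilon> * lap (\<lambda>j. \<psi> j - \<psi>' j) n + 3 * ((\<phi> n)\<^sup>2 * (\<psi> n - \<psi>' n))"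
        by (simp add: jordan_map_def False lap_diff algebra_simps)
      then show ?thesis using stepn[OF d False] De Dn by simp
    qed
  qed
  have zero: "\<bar>jordan_map k \<phi> \<epsilon> (\<lambda>_. 0) n\<bar> \<le> 1 * ?\<nu> n" for n
  proof (cases "n = k")
    case True
    then show ?thesis using \<phi>k \<epsilon> s by (auto simp: jordan_map_def lap_def)
  next
    case False
    have "4 * \<epsilon> * ?\<nu> n \<le> 1 * ?\<nu> n" using \<epsilon> by (intro mult_right_mono) auto
    then have "\<bar>\<phi> n\<bar> \<le> 1 * ?\<nu> n" using \<phi>[OF False] by (rule order_trans[rotated])
    then show ?thesis using False by (simp add: jordan_map_def lap_def)
  qed
  have "\<exists>\<psi>. (\<forall>n. norm (\<psi> n) \<le> 2 * ?\<nu> n) \<and> jordan_map k \<phi> \<epsilon> \<psi> = \<psi>"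
  proof (rule weighted_sup_fixpoint[where q = "1 / 4"])
    fix \<psi> :: "int \<Rightarrow> real" and n assume *: "\<And>j. norm (\<psi> j) \<le> 2 * ?\<nu> j"
    have "\<bar>jordan_map k \<phi> \<epsilon> \<psi> n - jordan_map k \<phi> \<epsilon> (\<lambda>_. 0) n\<bar> \<le> 1 / 4 * 2 * ?\<nu> n"
      by (rule lin) (use * in auto)
    moreover have "0 < ?\<nu> n" by simp
    ultimately show "norm (jordan_map k \<phi> \<epsilon> \<psi> n) \<le> 2 * ?\<nu> n"
      using zero[of n] unfolding real_norm_def by linarith
  qed (use lin in auto)
  then obtain \<psi> where b: "\<And>n. \<bar>\<psi> n\<bar> \<le> 2 * ?\<nu> n" and f: "\<And>n. jordan_map k \<phi> \<epsilon> \<psi> n = \<psi> n"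
    by (auto simp: fun_eq_iff)
  have "- \<epsilon> * lap \<psi> n + \<psi> n - 3 * (\<phi> n)\<^sup>2 * \<psi> n = \<phi> n" for n
    using f[of n] by (cases "n = k") (auto simp: jordan_map_def algebra_simps)
  moreover have "\<bar>\<psi> k + s / 2\<bar> \<le> 1 / 4"
  proof -
    define X where "X = \<epsilon> * lap \<psi> k + 3 * (((\<phi> k)\<^sup>2 - 1) * \<psi> k)"
    have "\<psi> k = - (\<phi> k + X) / 2" using f[of k] by (simp add: jordan_map_def X_def)
    moreover have "\<bar>X\<bar> \<le> 33 * \<epsilon> * 2" unfolding X_def by (rule stepk[OF b])
    moreover have "\<bar>\<phi> k - s + X\<bar> \<le> 4 * \<epsilon> + 33 * \<epsilon> * 2"
      using \<phi>k calculation(2) by (intro order_trans[OF abs_triangle_ineq add_mono])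
    moreover have "\<bar>\<psi> k + s / 2\<bar> = \<bar>\<phi> k - s + X\<bar> / 2"
      using calculation(1) by (simp add: abs_if)
    ultimately show ?thesis using \<epsilon> by simp
  qed
  \<comment> \<open>The ball of radius 2 gives no smallness in \<epsilon>. Inserting the fixed point
    once into its equation does, because \<open>4 + 2 * 6.05 < 17\<close>.\<close>
  moreover have "\<bar>\<psi> n\<bar> \<le> 17 * \<epsilon> * ?\<nu> n" if "n \<noteq> k" for n
  proof -
    have "\<bar>\<psi> n\<bar> \<le> \<bar>\<phi> n\<bar> + 6.05 * \<epsilon> * (2 * ?\<nu> n)"
    proof -
      have "\<psi> n = \<phi> n + (\<epsilon> * lap \<psi> n + 3 * ((\<phi> n)\<^sup>2 * \<psi> n))"
        using f[of n] that by (simp add: jordan_map_def)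
      then have "\<bar>\<psi> n\<bar> \<le> \<bar>\<phi> n\<bar> + \<bar>\<epsilon> * lap \<psi> n + 3 * ((\<phi> n)\<^sup>2 * \<psi> n)\<bar>"
        by (metis abs_triangle_ineq)
      then show ?thesis using stepn[OF b that] by linarith
    qed
    moreover have "0 \<le> \<epsilon> * ?\<nu> n" using \<epsilon> by simp
    ultimately show ?thesis using \<phi>[OF that] by simp
  qed
  ultimately show ?thesis by blast
qed


section \<open>The spectral parameter\<close>

text \<open>The two roots of \<open>r\<^sup>2 - s * r + 1\<close> are inverse to each other, so one
  lies in the open disk unless both are on the unit circle, and then \<open>s = 2 * Re r\<close> is
  in the excluded interval.\<close>

lemma joukowski_root:
  assumes "s \<notin> complex_of_real ` {-2..2}"
  shows "\<exists>z. z \<noteq> 0 \<and> norm z < 1 \<and> z + 1 / z = s"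
proof -
  define r where "r = (s + csqrt (s\<^sup>2 - 4)) / 2"
  have r2: "r\<^sup>2 - s * r + 1 = 0"
  proof -
    have "2 * r = s + csqrt (s\<^sup>2 - 4)" by (simp add: r_def)
    then have "(2 * r - s)\<^sup>2 = s\<^sup>2 - 4" by simp
    then have "4 * (r\<^sup>2 - s * r + 1) = 0" by (simp add: power2_eq_square algebra_simps)
    then show ?thesis unfolding mult_eq_0_iff by simp
  qed
  then have r0: "r \<noteq> 0" by auto
  have rs: "r + 1 / r = s" using r2 r0 by (simp add: field_simps power2_eq_square)
  have "norm r \<noteq> 1"
  proof
    assume r1: "norm r = 1"
    have "1 / r = cnj r"
      using r1 r0 by (metis complex_norm_square divide_eq_eq mult.commute of_real_1 power_one)
    then have "s = complex_of_real (2 * Re r)" using rs complex_add_cnj[of r] by simp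
    moreover have "2 * Re r \<in> {-2..2}" using abs_Re_le_cmod[of r] r1 by auto
    ultimately show False using assms by blast
  qed
  then consider "norm r < 1" | "norm (1 / r) < 1" using r0 by (fastforce simp: norm_divide divide_simps)
  then show ?thesis
  proof cases
    case 1
    then show ?thesis using r0 rs by blast
  next
    case 2
    then show ?thesis using r0 rs by (intro exI[of _ "1 / r"]) (auto simp: add.commute)
  qed
qed

text \<open>Inside the unit disk the second factor is negative, so imaginary parts change sign. This
  turns the side from which a band is approached into a half of the disk.\<close>

lemma Im_joukowski:
  assumes "z \<noteq> 0"
  shows "Im (z + 1 / z) = Im z * (1 - 1 / (norm z)\<^sup>2)"
  by (simp add: Im_divide cmod_power2 algebra_simps)

text \<open>The sign condition selects which of the two conjugate roots on the unit circle is approached.\<close>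

lemma joukowski_boundary:
  fixes s \<sigma> :: real
  assumes s: "- 2 \<le> s" and \<sigma>: "\<sigma> \<in> {1, -1}"
  shows "\<exists>w. w \<noteq> 0 \<and> norm w \<le> 1 \<and> w + 1 / w = complex_of_real s \<and>
    (\<forall>z t. z \<noteq> 0 \<longrightarrow> norm z < 1 \<longrightarrow> z + 1 / z = t \<longrightarrow> \<sigma> * Im t \<le> 0 \<longrightarrow> (norm (z - w))\<^sup>2 \<le> norm (t - complex_of_real s))"
proof -
  \<comment> \<open>Since \<open>z * (t - s) = (z - w) * (z - 1 / w)\<close>, the nearer root is
    within the square root of the distance of the parameters. A square root is all that survives at
    the band edges, where \<open>w = 1 / w\<close>.\<close>
  have main: "(norm (z - w))\<^sup>2 \<le> norm (t - complex_of_real s)"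
    if w: "w \<noteq> 0" "w + 1 / w = complex_of_real s" and z: "z \<noteq> 0" "norm z < 1" "z + 1 / z = t"
      and le: "norm (z - w) \<le> norm (z - 1 / w)" for w z t
  proof -
    have "z * t = z * z + 1" unfolding z(3)[symmetric] using z(1) by (simp add: distrib_left)
    then have "z * (t - complex_of_real s) = z * z + 1 - z * (w + 1 / w)"
      by (simp only: right_diff_distrib w(2))
    also have "\<dots> = (z - w) * (z - 1 / w)"
    proof -
      have "z * z + 1 - z * (w + i) = (z - w) * (z - i)" if "w * i = 1" for i
        using that by (simp add: algebra_simps)
      then show ?thesis using w(1) by simp
    qed
    finally have "norm (z - w) * norm (z - 1 / w) = norm z * norm (t - complex_of_real s)"
      by (metis norm_mult)
    also have "\<dots> \<le> norm (t - complex_of_real s)" using z by (intro mult_left_le_one_le) auto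
    finally show ?thesis
      using mult_left_mono[OF le, of "norm (z - w)"] by (simp add: power2_eq_square)
  qed
  have sgn: "0 \<le> \<sigma> * Im z" if "z \<noteq> 0" "norm z < 1" "z + 1 / z = t" "\<sigma> * Im t \<le> 0" for z t
  proof -
    have "(norm z)\<^sup>2 < 1" using that by (simp add: power_less_one_iff abs_square_less_1)
    then have "1 - 1 / (norm z)\<^sup>2 < 0" using that by (simp add: field_simps)
    moreover have "\<sigma> * Im z * (1 - 1 / (norm z)\<^sup>2) \<le> 0"
      using that Im_joukowski[OF that(1)] by (simp add: mult.assoc)
    ultimately show ?thesis by (simp add: mult_le_0_iff)
  qed
  show ?thesis
  proof (cases "s \<le> 2")
    case True
    define h where "h = sqrt (1 - (s / 2)\<^sup>2)"
    have "\<bar>s / 2\<bar> \<le> 1" using s True by simp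
    then have s4: "(s / 2)\<^sup>2 \<le> 1" by (simp add: abs_square_le_1)
    then have h: "0 \<le> h" "h\<^sup>2 = 1 - (s / 2)\<^sup>2" by (simp_all add: h_def)
    define w where "w = Complex (s / 2) (\<sigma> * h)"
    have nw: "norm w = 1" using h \<sigma> by (auto simp: w_def cmod_def power_mult_distrib)
    then have w0: "w \<noteq> 0" by auto
    have inv: "1 / w = cnj w"
      using nw w0 by (metis complex_norm_square divide_eq_eq mult.commute of_real_1 power_one)
    have ws: "w + 1 / w = complex_of_real s" unfolding inv by (simp add: complex_eq_iff w_def)
    have "norm (z - w) \<le> norm (z - 1 / w)" if "0 \<le> \<sigma> * Im z" for z
    proof -
      have "0 \<le> h * (\<sigma> * Im z)" using h that by simp
      then have "(Im z - \<sigma> * h)\<^sup>2 \<le> (Im z + \<sigma> * h)\<^sup>2"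
        by (simp add: power2_eq_square algebra_simps)
      then show ?thesis unfolding inv by (simp add: cmod_def w_def)
    qed
    then show ?thesis using w0 nw ws main sgn by (metis order_refl)
  next
    \<comment> \<open>Both roots are real here, and the one in the unit disk is the nearer to every
      point of the open disk, whatever the sign of \<open>Im t\<close>. This covers the component
      whose band does not contain the spectral parameter.\<close>
    case False
    define h where "h = sqrt ((s / 2)\<^sup>2 - 1)"
    have s4: "1 \<le> (s / 2)\<^sup>2" using False by simp
    then have h: "0 \<le> h" "h\<^sup>2 = (s / 2)\<^sup>2 - 1" by (simp_all add: h_def)
    define x where "x = s / 2 - h"
    have "x * (s / 2 + h) = 1" using h by (simp add: x_def power2_eq_square algebra_simps)
    then have x0: "x \<noteq> 0" and ix: "1 / x = s / 2 + h"
      by (auto simp del: mult_eq_0_iff simp: divide_eq_eq mult.commute)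
    have ix1: "0 < 1 / x" "1 \<le> 1 / x" using ix h False by simp_all
    then have x1: "0 < x" and xle: "x \<le> 1" by (simp_all add: le_divide_eq split: if_splits)
    have ws: "complex_of_real x + 1 / complex_of_real x = complex_of_real s"
    proof -
      have "x + 1 / x = s" using ix by (simp add: x_def)
      then show ?thesis by (metis of_real_1 of_real_add of_real_divide)
    qed
    have "norm (z - complex_of_real x) \<le> norm (z - 1 / complex_of_real x)" if z: "norm z < 1" for z
    proof -
      have "Re z \<le> s / 2" using abs_Re_le_cmod[of z] z False by linarith
      then have "0 \<le> (1 / x - x) * (1 / x + x - 2 * Re z)"
        using ix1 xle ix x_def by (intro mult_nonneg_nonneg) linarith+
      then have "(Re z - x)\<^sup>2 \<le> (Re z - 1 / x)\<^sup>2"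
        by (simp add: power2_eq_square algebra_simps)
      moreover have "1 / complex_of_real x = complex_of_real (1 / x)" by simp
      ultimately show ?thesis by (simp only: cmod_def) (simp del: of_real_divide)
    qed
    then show ?thesis
      using x0 x1 xle ws main by (intro exI[of _ "complex_of_real x"]) auto
  qed
qed

section \<open>Reduction to the complement of the Jordan block\<close>

text \<open>Later estimates use \<open>\<phi>\<close> and \<open>\<psi>\<close> only through these
  bounds: order one at \<open>k\<close>, O(\<epsilon>) with geometric decay elsewhere. The limit on
  \<epsilon> leaves room in all of them; the sharpest demands are those of the perturbation, near
  \<open>1600 * \<epsilon> \<le> 1\<close>.\<close>

locale soliton_background =
  fixes k :: int and s \<epsilon> :: real and \<phi> \<psi> :: "int \<Rightarrow> real"
  assumes s: "s \<in> {1, -1}"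
    and eps: "0 < \<epsilon>" "\<epsilon> \<le> 1 / 10000"
    and phi_k: "\<bar>\<phi> k - s\<bar> \<le> 4 * \<epsilon>"
    and phi_off: "n \<noteq> k \<Longrightarrow> \<bar>\<phi> n\<bar> \<le> 4 * \<epsilon> * (1 / 2) ^ gap k n"
    and phi_eq: "(1 - (\<phi> n)\<^sup>2) * \<phi> n = \<epsilon> * lap \<phi> n"
    and psi_k: "\<bar>\<psi> k + s / 2\<bar> \<le> 1 / 4"
    and psi_off: "n \<noteq> k \<Longrightarrow> \<bar>\<psi> n\<bar> \<le> 17 * \<epsilon> * (1 / 2) ^ gap k n"
    and psi_eq: "- \<epsilon> * lap \<psi> n + \<psi> n - 3 * (\<phi> n)\<^sup>2 * \<psi> n = \<phi> n"
begin

abbreviation P :: "int \<Rightarrow> complex" where "P n \<equiv> complex_of_real (\<phi> n)"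
abbreviation Q :: "int \<Rightarrow> complex" where "Q n \<equiv> complex_of_real (\<psi> n)"
abbreviation e :: complex where "e \<equiv> complex_of_real \<epsilon>"
definition H :: "state \<Rightarrow> state" where "H = H_op 1 \<epsilon> \<phi>"

text \<open>A state with components \<open>f\<close>, \<open>g\<close> agrees at \<open>k\<close> with \<open>coordX f g (\<phi>, -\<phi>) + coordY f g (\<psi>, \<psi>)\<close>;
  \<open>cX\<close> and \<open>cY\<close> are these coordinates of \<open>(H - \<Omega>)(u, v)\<close> for \<open>u\<close>, \<open>v\<close> vanishing at \<open>k\<close>.\<close>

definition coordX :: "(int \<Rightarrow> complex) \<Rightarrow> (int \<Rightarrow> complex) \<Rightarrow> complex" where
  "coordX f g = (f k - g k) / (2 * P k)"

definition coordY :: "(int \<Rightarrow> complex) \<Rightarrow> (int \<Rightarrow> complex) \<Rightarrow> complex" where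
  "coordY f g = (f k + g k) / (2 * Q k)"

definition cX :: "(int \<Rightarrow> complex) \<Rightarrow> (int \<Rightarrow> complex) \<Rightarrow> complex" where
  "cX u v = - e * (u (k + 1) + u (k - 1) + v (k + 1) + v (k - 1)) / (2 * P k)"

definition cY :: "(int \<Rightarrow> complex) \<Rightarrow> (int \<Rightarrow> complex) \<Rightarrow> complex" where
  "cY u v = e * (v (k + 1) + v (k - 1) - u (k + 1) - u (k - 1)) / (2 * Q k)"

text \<open>The equations off \<open>k\<close> are divided by \<epsilon>, and the second one also
  changes sign, so that both take the form \<open>dispersion\<close> = source +
  perturbation.\<close>

definition src1 :: "(int \<Rightarrow> complex) \<Rightarrow> (int \<Rightarrow> complex) \<Rightarrow> int \<Rightarrow> complex" where
  "src1 f g n = (f n - coordX f g * P n - coordY f g * Q n) / e"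

definition src2 :: "(int \<Rightarrow> complex) \<Rightarrow> (int \<Rightarrow> complex) \<Rightarrow> int \<Rightarrow> complex" where
  "src2 f g n = (- g n - coordX f g * P n + coordY f g * Q n) / e"

text \<open>Linear in \<open>(u, v)\<close> and free of \<Omega> and of the Jordan coordinates: the
  spectral parameter enters the reduced system only through \<open>z\<close> and
  \<open>\<zeta>\<close>.\<close>

definition pert1 :: "(int \<Rightarrow> complex) \<Rightarrow> (int \<Rightarrow> complex) \<Rightarrow> int \<Rightarrow> complex" where
  "pert1 u v n = (2 * (P n)\<^sup>2 * u n + (P n)\<^sup>2 * v n + cX u v * P n + cY u v * Q n) / e"

definition pert2 :: "(int \<Rightarrow> complex) \<Rightarrow> (int \<Rightarrow> complex) \<Rightarrow> int \<Rightarrow> complex" where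
  "pert2 u v n = ((P n)\<^sup>2 * u n + 2 * (P n)\<^sup>2 * v n + cX u v * P n - cY u v * Q n) / e"

definition comb :: "complex \<Rightarrow> complex \<Rightarrow> (int \<Rightarrow> complex) \<Rightarrow> (int \<Rightarrow> complex) \<Rightarrow> state" where
  "comb x y u v = (\<lambda>n. x * P n + y * Q n + u n, \<lambda>n. - x * P n + y * Q n + v n)"

abbreviation dispersion :: "complex \<Rightarrow> (int \<Rightarrow> complex) \<Rightarrow> int \<Rightarrow> complex" where
  "dispersion z u n \<equiv> (z + 1 / z) * u n - u (n + 1) - u (n - 1)"

text \<open>With these roots \<open>- e * lap u + (1 - \<Omega>) * u\<close> is \<open>e\<close>
  times \<open>dispersion z u\<close>, and \<open>\<zeta>\<close> does the same for the other sign
  of \<Omega>. The closed disk is allowed in order to include boundary values on the bands.\<close>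

definition spectral :: "complex \<Rightarrow> complex \<Rightarrow> complex \<Rightarrow> bool" where
  "spectral \<Omega> z \<zeta> \<longleftrightarrow> z \<noteq> 0 \<and> \<zeta> \<noteq> 0 \<and> norm z \<le> 1 \<and> norm \<zeta> \<le> 1 \<and>
     z + 1 / z = 2 + (1 - \<Omega>) / e \<and> \<zeta> + 1 / \<zeta> = 2 + (1 + \<Omega>) / e"

lemma e0: "e \<noteq> 0"
  using eps by simp

lemma phi_k_bounds: "9 / 10 \<le> \<bar>\<phi> k\<bar>" "\<bar>\<phi> k\<bar> \<le> 11 / 10"
  using phi_k eps s by auto

lemma psi_k_bounds: "1 / 4 \<le> \<bar>\<psi> k\<bar>" "\<bar>\<psi> k\<bar> \<le> 3 / 4"
  using psi_k s unfolding abs_real_def by (auto split: if_splits)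

lemma PQ_nz: "P k \<noteq> 0" "Q k \<noteq> 0"
  using phi_k_bounds psi_k_bounds by auto

lemma phi_geometric: "\<bar>\<phi> n\<bar> \<le> 11 / 10 * (1 / 2) ^ gap k n"
proof (cases "n = k")
  case False
  have "4 * \<epsilon> * (1 / 2) ^ gap k n \<le> 11 / 10 * (1 / 2) ^ gap k n"
    using eps by (intro mult_right_mono) auto
  then show ?thesis using phi_off[OF False] by linarith
qed (use phi_k_bounds in simp)

lemma psi_geometric: "\<bar>\<psi> n\<bar> \<le> 3 / 4 * (1 / 2) ^ gap k n"
proof (cases "n = k")
  case False
  have "17 * \<epsilon> * (1 / 2) ^ gap k n \<le> 3 / 4 * (1 / 2) ^ gap k n"
    using eps by (intro mult_right_mono) auto
  then show ?thesis using psi_off[OF False] by linarith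
qed (use psi_k_bounds in simp)

lemma P_eq: "- e * lap P n + P n - P n * P n * P n = 0"
proof -
  have "- \<epsilon> * lap \<phi> n + \<phi> n - \<phi> n * \<phi> n * \<phi> n = 0"
    using phi_eq[of n] by (simp add: power2_eq_square algebra_simps)
  then have "complex_of_real (- \<epsilon> * lap \<phi> n + \<phi> n - \<phi> n * \<phi> n * \<phi> n) = 0" by simp
  then show ?thesis by (simp add: lap_def)
qed

lemma Q_eq: "- e * lap Q n + Q n - 3 * (P n * P n * Q n) = P n"
proof -
  have "complex_of_real (- \<epsilon> * lap \<psi> n + \<psi> n - 3 * (\<phi> n)\<^sup>2 * \<psi> n) = P n" using psi_eq[of n] by simp
  then show ?thesis by (simp add: lap_def power2_eq_square mult.assoc)
qed

lemma shifted_fst: "fst (shifted H \<Omega> (u, v)) n =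
    - e * lap u n + u n - 2 * (P n * P n * u n) - P n * P n * v n - \<Omega> * u n"
  and shifted_snd: "snd (shifted H \<Omega> (u, v)) n =
    P n * P n * u n + e * lap v n - v n + 2 * (P n * P n * v n) - \<Omega> * v n"
  by (simp_all add: shifted_def H_def H_op_def scale_def Let_def power2_eq_square algebra_simps)

lemma shifted_comb:
  "fst (shifted H \<Omega> (comb x y u v)) n = (y - \<Omega> * x) * P n - \<Omega> * y * Q n + fst (shifted H \<Omega> (u, v)) n"
  "snd (shifted H \<Omega> (comb x y u v)) n = - (y - \<Omega> * x) * P n - \<Omega> * y * Q n + snd (shifted H \<Omega> (u, v)) n"
proof -
  let ?p = "- e * lap P n + P n - P n * P n * P n" and ?q = "- e * lap Q n + Q n - 3 * (P n * P n * Q n)"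
  have "fst (shifted H \<Omega> (comb x y u v)) n
      = x * ?p + y * ?q - \<Omega> * x * P n - \<Omega> * y * Q n + fst (shifted H \<Omega> (u, v)) n"
    unfolding comb_def shifted_fst by (simp add: lap_def algebra_simps)
  then show "fst (shifted H \<Omega> (comb x y u v)) n = (y - \<Omega> * x) * P n - \<Omega> * y * Q n + fst (shifted H \<Omega> (u, v)) n"
    unfolding P_eq Q_eq by (simp add: algebra_simps)
  have "snd (shifted H \<Omega> (comb x y u v)) n
      = x * ?p - y * ?q + \<Omega> * x * P n - \<Omega> * y * Q n + snd (shifted H \<Omega> (u, v)) n"
    unfolding comb_def shifted_snd by (simp add: lap_def algebra_simps)
  then show "snd (shifted H \<Omega> (comb x y u v)) n = - (y - \<Omega> * x) * P n - \<Omega> * y * Q n + snd (shifted H \<Omega> (u, v)) n"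
    unfolding P_eq Q_eq by (simp add: algebra_simps)
qed

lemma shifted_off:
  assumes "spectral \<Omega> z \<zeta>"
  shows "fst (shifted H \<Omega> (u, v)) n = e * dispersion z u n - 2 * (P n * P n * u n) - P n * P n * v n"
    and "snd (shifted H \<Omega> (u, v)) n = - e * dispersion \<zeta> v n + P n * P n * u n + 2 * (P n * P n * v n)"
proof -
  have z: "e * (z + 1 / z) = 2 * e + 1 - \<Omega>" and \<zeta>: "e * (\<zeta> + 1 / \<zeta>) = 2 * e + 1 + \<Omega>"
  proof -
    have "z + 1 / z = 2 + (1 - \<Omega>) / e" "\<zeta> + 1 / \<zeta> = 2 + (1 + \<Omega>) / e"
      using assms by (simp_all add: spectral_def)
    then show "e * (z + 1 / z) = 2 * e + 1 - \<Omega>" "e * (\<zeta> + 1 / \<zeta>) = 2 * e + 1 + \<Omega>"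
      using e0 by (simp_all only: distrib_left) simp_all
  qed
  have "e * dispersion z u n = e * (z + 1 / z) * u n - e * u (n + 1) - e * u (n - 1)"
    by (simp only: right_diff_distrib mult.assoc)
  then show "fst (shifted H \<Omega> (u, v)) n = e * dispersion z u n - 2 * (P n * P n * u n) - P n * P n * v n"
    unfolding shifted_fst z by (simp add: lap_def algebra_simps)
  have "e * dispersion \<zeta> v n = e * (\<zeta> + 1 / \<zeta>) * v n - e * v (n + 1) - e * v (n - 1)"
    by (simp only: right_diff_distrib mult.assoc)
  then show "snd (shifted H \<Omega> (u, v)) n = - e * dispersion \<zeta> v n + P n * P n * u n + 2 * (P n * P n * v n)"
    unfolding shifted_snd minus_mult_left[symmetric] \<zeta> by (simp add: lap_def algebra_simps)
qed

text \<open>At \<open>k\<close> the potential acts on zero, so the difference and the sum of the two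
  components give the first two equations. They express \<open>y - \<Omega> * x\<close> and
  \<open>- \<Omega> * y\<close>, the only combinations of \<open>x\<close> and \<open>y\<close>
  occurring off \<open>k\<close>, through \<open>u\<close> and \<open>v\<close>. The system for
  \<open>u\<close> and \<open>v\<close> is therefore closed and regular at 0; only recovering
  \<open>x\<close> and \<open>y\<close> divides by \<Omega>.\<close>

lemma shifted_comb_iff:
  assumes sp: "spectral \<Omega> z \<zeta>" and u: "u k = 0" and v: "v k = 0"
  shows "shifted H \<Omega> (comb x y u v) = (f, g) \<longleftrightarrow>
    y - \<Omega> * x + cX u v = coordX f g \<and> - \<Omega> * y + cY u v = coordY f g \<and>
    (\<forall>n. n \<noteq> k \<longrightarrow> dispersion z u n = src1 f g n + pert1 u v n \<and> dispersion \<zeta> v n = src2 f g n + pert2 u v n)"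
proof -
  define a b where "a = y - \<Omega> * x" and "b = - \<Omega> * y"
  have eq: "shifted H \<Omega> (comb x y u v) = (f, g) \<longleftrightarrow>
      (\<forall>n. a * P n + b * Q n + fst (shifted H \<Omega> (u, v)) n = f n \<and>
           - a * P n + b * Q n + snd (shifted H \<Omega> (u, v)) n = g n)"
    unfolding prod_eq_iff fun_eq_iff fst_conv snd_conv shifted_comb a_def b_def by auto
  define U V where "U = e * (u (k + 1) + u (k - 1))" and "V = e * (v (k + 1) + v (k - 1))"
  have atk: "fst (shifted H \<Omega> (u, v)) k = - U" "snd (shifted H \<Omega> (u, v)) k = V"
    unfolding shifted_off[OF sp] U_def V_def using u v by (simp_all add: algebra_simps)
  have cX: "cX u v = - (U + V) / (2 * P k)" and cY: "cY u v = (V - U) / (2 * Q k)"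
    by (simp_all add: cX_def cY_def U_def V_def algebra_simps)
  have k: "a * P k + b * Q k + fst (shifted H \<Omega> (u, v)) k = f k \<and>
      - a * P k + b * Q k + snd (shifted H \<Omega> (u, v)) k = g k
    \<longleftrightarrow> a + cX u v = coordX f g \<and> b + cY u v = coordY f g"
  proof -
    have X: "a + cX u v = coordX f g \<longleftrightarrow> 2 * (a * P k) - (U + V) = f k - g k"
      unfolding cX coordX_def using PQ_nz by (simp add: field_simps)
    have Y: "b + cY u v = coordY f g \<longleftrightarrow> 2 * (b * Q k) + (V - U) = f k + g k"
      unfolding cY coordY_def using PQ_nz by (simp add: field_simps)
    have key: "p + q - U' = F \<and> - p + q + V' = G \<longleftrightarrow> 2 * p - (U' + V') = F - G \<and> 2 * q + (V' - U') = F + G"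
      for p q U' V' F G :: complex
    proof
      assume *: "2 * p - (U' + V') = F - G \<and> 2 * q + (V' - U') = F + G"
      have "2 * (p + q - U') = (2 * p - (U' + V')) + (2 * q + (V' - U'))"
        "2 * (- p + q + V') = (2 * q + (V' - U')) - (2 * p - (U' + V'))" by (simp_all add: algebra_simps)
      then have "2 * (p + q - U') = 2 * F" "2 * (- p + q + V') = 2 * G" using * by simp_all
      then show "p + q - U' = F \<and> - p + q + V' = G" by (metis mult_cancel_left zero_neq_numeral)
    next
      assume "p + q - U' = F \<and> - p + q + V' = G"
      then have "F = p + q - U'" "G = - p + q + V'" by simp_all
      then show "2 * p - (U' + V') = F - G \<and> 2 * q + (V' - U') = F + G" by simp
    qed
    show ?thesis unfolding atk X Y key[symmetric] by simp
  qed
  have off: "a * P n + b * Q n + fst (shifted H \<Omega> (u, v)) n = f n \<and>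
      - a * P n + b * Q n + snd (shifted H \<Omega> (u, v)) n = g n
    \<longleftrightarrow> dispersion z u n = src1 f g n + pert1 u v n \<and> dispersion \<zeta> v n = src2 f g n + pert2 u v n"
    if ab: "a + cX u v = coordX f g" "b + cY u v = coordY f g" for n
  proof -
    have a: "a = coordX f g - cX u v" and b: "b = coordY f g - cY u v" using ab by (simp_all add: algebra_simps)
    have d1: "dispersion z u n = src1 f g n + pert1 u v n \<longleftrightarrow> e * dispersion z u n = e * (src1 f g n + pert1 u v n)"
      using e0 by simp
    have d2: "dispersion \<zeta> v n = src2 f g n + pert2 u v n \<longleftrightarrow> e * dispersion \<zeta> v n = e * (src2 f g n + pert2 u v n)"
      using e0 by simp
    have s1: "e * (src1 f g n + pert1 u v n) = f n - a * P n - b * Q n + 2 * (P n * P n * u n) + P n * P n * v n"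
      unfolding src1_def pert1_def a b using e0 by (simp add: field_simps power2_eq_square)
    have s2: "e * (src2 f g n + pert2 u v n) = - g n - a * P n + b * Q n + P n * P n * u n + 2 * (P n * P n * v n)"
      unfolding src2_def pert2_def a b using e0 by (simp add: field_simps power2_eq_square)
    have l1: "p + q + (d - r - t) = F \<longleftrightarrow> d = F - p - q + r + t"
      and l2: "- p + q + (- d + r + t) = F \<longleftrightarrow> d = - F - p + q + r + t" for p q d r t F :: complex
    proof -
      have "p + q + (d - r - t) - F = d - (F - p - q + r + t)" by (simp add: algebra_simps)
      then have "p + q + (d - r - t) - F = 0 \<longleftrightarrow> d - (F - p - q + r + t) = 0" by (simp only:)
      then show "p + q + (d - r - t) = F \<longleftrightarrow> d = F - p - q + r + t" by (simp only: right_minus_eq)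
      have "- p + q + (- d + r + t) - F = - (d - (- F - p + q + r + t))" by (simp add: algebra_simps)
      then have "- p + q + (- d + r + t) - F = 0 \<longleftrightarrow> d - (- F - p + q + r + t) = 0"
        by (simp only: neg_equal_0_iff_equal)
      then show "- p + q + (- d + r + t) = F \<longleftrightarrow> d = - F - p + q + r + t" by (simp only: right_minus_eq)
    qed
    show ?thesis
      unfolding shifted_off[OF sp] d1 d2 s1 s2 minus_mult_left[symmetric] l1 l2 ..
  qed
  have aux: "(\<forall>n. A n) \<longleftrightarrow> p \<and> q \<and> (\<forall>n. n \<noteq> k \<longrightarrow> B n)"
    if "A k \<longleftrightarrow> p \<and> q" "\<And>n. p \<Longrightarrow> q \<Longrightarrow> A n \<longleftrightarrow> B n" for A B p q
    using that by metis
  show ?thesis unfolding eq a_def[symmetric] b_def[symmetric]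
    by (rule aux, rule k, rule off)
qed

lemma comb_exists:
  obtains x y u v where "w = comb x y u v" "u k = 0" "v k = 0"
    "u = (\<lambda>n. fst w n - x * P n - y * Q n)" "v = (\<lambda>n. snd w n + x * P n - y * Q n)"
proof -
  define x y where "x = coordX (fst w) (snd w)" and "y = coordY (fst w) (snd w)"
  have "x * P k = (fst w k - snd w k) / 2" "y * Q k = (fst w k + snd w k) / 2"
    using PQ_nz by (simp_all add: x_def y_def coordX_def coordY_def)
  then have "fst w k - x * P k - y * Q k = 0" "snd w k + x * P k - y * Q k = 0"
    by (simp_all only:) (simp_all add: field_simps)
  then show ?thesis
    by (intro that[of x y "\<lambda>n. fst w n - x * P n - y * Q n" "\<lambda>n. snd w n + x * P n - y * Q n"])
      (auto simp: comb_def x_def y_def)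
qed

section \<open>Size of the coupling and of the perturbation\<close>

lemma coord_bounds:
  assumes "norm (f k) \<le> A" "norm (g k) \<le> B"
  shows "norm (coordX f g) \<le> A + B" "norm (coordY f g) \<le> 2 * (A + B)"
proof -
  have "0 \<le> A" "0 \<le> B" using assms norm_ge_zero order_trans by blast+
  then have AB: "0 \<le> A + B" by simp
  have "norm (coordX f g) = norm (f k - g k) / (2 * \<bar>\<phi> k\<bar>)"
    by (simp add: coordX_def norm_divide norm_mult)
  also have "\<dots> \<le> (A + B) / 1"
    using phi_k_bounds assms AB by (intro frac_le) (auto intro: order_trans[OF norm_triangle_ineq4])
  finally show "norm (coordX f g) \<le> A + B" by simp
  have "norm (coordY f g) = norm (f k + g k) / (2 * \<bar>\<psi> k\<bar>)"
    by (simp add: coordY_def norm_divide norm_mult)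
  also have "\<dots> \<le> (A + B) / (1 / 2)"
    using psi_k_bounds assms AB by (intro frac_le) (auto intro: order_trans[OF norm_triangle_ineq])
  finally show "norm (coordY f g) \<le> 2 * (A + B)" by simp
qed

text \<open>At distance one the weight is 2, so the four neighbouring values add up to at most
  \<open>8 * D\<close>; the divisors are at least 9/5 and 1/2 in modulus.\<close>

lemma c_bounds:
  assumes "\<And>n. norm (u n) \<le> D * (1 + real (gap k n))" "\<And>n. norm (v n) \<le> D * (1 + real (gap k n))"
  shows "norm (cX u v) \<le> 5 * \<epsilon> * D" "norm (cY u v) \<le> 16 * \<epsilon> * D"
proof -
  have D: "0 \<le> D" using order_trans[OF norm_ge_zero assms(1)[of k]] by simp
  have g: "gap k (k + 1) = 1" "gap k (k - 1) = 1" by (simp_all add: gap_def)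
  have nb: "norm (u (k + 1)) \<le> 2 * D" "norm (u (k - 1)) \<le> 2 * D" "norm (v (k + 1)) \<le> 2 * D" "norm (v (k - 1)) \<le> 2 * D"
    using assms(1)[of "k + 1"] assms(1)[of "k - 1"] assms(2)[of "k + 1"] assms(2)[of "k - 1"] by (simp_all add: g)
  have "norm (u (k + 1) + u (k - 1) + v (k + 1) + v (k - 1)) \<le> 8 * D"
    using nb norm_triangle_ineq[of "u (k + 1) + u (k - 1) + v (k + 1)" "v (k - 1)"]
      norm_triangle_ineq[of "u (k + 1) + u (k - 1)" "v (k + 1)"] norm_triangle_ineq[of "u (k + 1)" "u (k - 1)"]
    by linarith
  then have "norm (cX u v) \<le> \<epsilon> * (8 * D) / (9 / 5)"
    unfolding cX_def norm_divide norm_mult using eps phi_k_bounds D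
    by (intro frac_le mult_mono) auto
  also have "\<dots> \<le> 5 * \<epsilon> * D" using eps D by (simp add: field_simps)
  finally show "norm (cX u v) \<le> 5 * \<epsilon> * D" .
  have "norm (v (k + 1) + v (k - 1) - u (k + 1) - u (k - 1)) \<le> 8 * D"
    using nb norm_triangle_ineq4[of "v (k + 1) + v (k - 1) - u (k + 1)" "u (k - 1)"]
      norm_triangle_ineq4[of "v (k + 1) + v (k - 1)" "u (k + 1)"] norm_triangle_ineq[of "v (k + 1)" "v (k - 1)"]
    by linarith
  then have "norm (cY u v) \<le> \<epsilon> * (8 * D) / (1 / 2)"
    unfolding cY_def norm_divide norm_mult using eps psi_k_bounds D
    by (intro frac_le mult_mono) auto
  then show "norm (cY u v) \<le> 16 * \<epsilon> * D" by simp
qed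

text \<open>Off \<open>k\<close> the square of \<open>\<phi>\<close> decays twice as fast as needed;
  one copy of the decay absorbs the weight \<open>1 + gap\<close>, the other remains. The constant
  400 covers \<open>3 * 16 + 5 * 4 + 16 * 17 = 340\<close>.\<close>

lemma pert_bounds:
  assumes u: "\<And>n. norm (u n) \<le> D * (1 + real (gap k n))" and v: "\<And>n. norm (v n) \<le> D * (1 + real (gap k n))"
    and n: "n \<noteq> k"
  shows "norm (pert1 u v n) \<le> 400 * \<epsilon> * D * (1 / 2) ^ gap k n"
    and "norm (pert2 u v n) \<le> 400 * \<epsilon> * D * (1 / 2) ^ gap k n"
proof -
  let ?\<nu> = "(1 / 2 :: real) ^ gap k n"
  have D: "0 \<le> D" using order_trans[OF norm_ge_zero u[of k]] by simp
  have g: "(1 + real (gap k n)) * ?\<nu> \<le> 1"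
  proof -
    have "Suc (gap k n) \<le> 2 ^ gap k n" by (simp add: Suc_leI less_exp)
    then have "real (Suc (gap k n)) \<le> 2 ^ gap k n" by (metis of_nat_le_iff of_nat_numeral of_nat_power)
    then show ?thesis by (simp add: power_divide field_simps)
  qed
  have P2: "norm ((P n)\<^sup>2 * a) \<le> 16 * \<epsilon>\<^sup>2 * D * ?\<nu>" if a: "norm a \<le> D * (1 + real (gap k n))" for a
  proof -
    have "norm ((P n)\<^sup>2 * a) \<le> (4 * \<epsilon> * ?\<nu>)\<^sup>2 * (D * (1 + real (gap k n)))"
      unfolding norm_mult norm_power using phi_off[OF n] D by (intro mult_mono power_mono a) auto
    also have "\<dots> = 16 * \<epsilon>\<^sup>2 * D * ?\<nu> * ((1 + real (gap k n)) * ?\<nu>)"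
      by (simp add: power2_eq_square algebra_simps)
    also have "\<dots> \<le> 16 * \<epsilon>\<^sup>2 * D * ?\<nu> * 1" using D by (intro mult_left_mono g) auto
    finally show ?thesis by simp
  qed
  have twice: "norm (2 * (P n)\<^sup>2 * a) = 2 * norm ((P n)\<^sup>2 * a)" for a
    by (simp add: norm_mult)
  have X: "norm (cX u v * P n) \<le> (5 * \<epsilon> * D) * (4 * \<epsilon> * ?\<nu>)"
    unfolding norm_mult using phi_off[OF n] D eps by (intro mult_mono c_bounds u v) auto
  have Y: "norm (cY u v * Q n) \<le> (16 * \<epsilon> * D) * (17 * \<epsilon> * ?\<nu>)"
    unfolding norm_mult using psi_off[OF n] D eps by (intro mult_mono c_bounds u v) auto
  have tot: "16 * \<epsilon>\<^sup>2 * D * ?\<nu> * 3 + (5 * \<epsilon> * D) * (4 * \<epsilon> * ?\<nu>) + (16 * \<epsilon> * D) * (17 * \<epsilon> * ?\<nu>)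
      \<le> (400 * \<epsilon> * D * ?\<nu>) * \<epsilon>"
  proof -
    have "0 \<le> \<epsilon> * \<epsilon> * D * ?\<nu>" using D eps by simp
    then show ?thesis by (simp add: power2_eq_square algebra_simps)
  qed
  have tri: "norm (a + b + c + d) \<le> norm a + norm b + norm c + norm d" for a b c d :: complex
    by (intro order_trans[OF norm_triangle_ineq] add_right_mono norm_triangle_ineq)
  have tri': "norm (a + b + c - d) \<le> norm a + norm b + norm c + norm d" for a b c d :: complex
    using tri[of a b c "- d"] by simp
  have "norm (2 * (P n)\<^sup>2 * u n + (P n)\<^sup>2 * v n + cX u v * P n + cY u v * Q n) \<le> (400 * \<epsilon> * D * ?\<nu>) * \<epsilon>"
    using tri[of "2 * (P n)\<^sup>2 * u n" "(P n)\<^sup>2 * v n" "cX u v * P n" "cY u v * Q n"]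
      P2[OF u] P2[OF v] twice[of "u n"] X Y tot by linarith
  then show "norm (pert1 u v n) \<le> 400 * \<epsilon> * D * ?\<nu>"
    unfolding pert1_def norm_divide using eps by (simp add: pos_divide_le_eq)
  have "norm ((P n)\<^sup>2 * u n + 2 * (P n)\<^sup>2 * v n + cX u v * P n - cY u v * Q n) \<le> (400 * \<epsilon> * D * ?\<nu>) * \<epsilon>"
    using tri'[of "(P n)\<^sup>2 * u n" "2 * (P n)\<^sup>2 * v n" "cX u v * P n" "cY u v * Q n"]
      P2[OF u] P2[OF v] twice[of "v n"] X Y tot by linarith
  then show "norm (pert2 u v n) \<le> 400 * \<epsilon> * D * ?\<nu>"
    unfolding pert2_def norm_divide using eps by (simp add: pos_divide_le_eq)
qed

lemma pert_diff:
  "pert1 (\<lambda>n. u n - u' n) (\<lambda>n. v n - v' n) = (\<lambda>n. pert1 u v n - pert1 u' v' n)"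
  "pert2 (\<lambda>n. u n - u' n) (\<lambda>n. v n - v' n) = (\<lambda>n. pert2 u v n - pert2 u' v' n)"
  using e0 PQ_nz
  by (simp_all add: fun_eq_iff pert1_def pert2_def cX_def cY_def diff_divide_distrib add_divide_distrib algebra_simps)

text \<open>Because \<open>400 * \<epsilon> \<le> 1/4\<close> and the weighted geometric sum
  contributes a factor 2, applying \<open>cut_solve\<close> to the perturbation gains a factor 1/2.
  This is the contraction behind everything that follows.\<close>

lemma pert_l11:
  assumes "\<And>n. norm (u n) \<le> D * (1 + real (gap k n))" "\<And>n. norm (v n) \<le> D * (1 + real (gap k n))"
  shows "cut_l11le k (pert1 u v) (D / 2)" "cut_l11le k (pert2 u v) (D / 2)"
proof -
  have D: "0 \<le> D" using order_trans[OF norm_ge_zero assms(1)[of k]] by simp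
  have "norm a \<le> D / 4 * (1 / 2) ^ j" if "norm a \<le> 400 * \<epsilon> * D * (1 / 2) ^ j" for a :: complex and j
  proof -
    have "(400 * \<epsilon>) * (D * (1 / 2) ^ j) \<le> 1 / 4 * (D * (1 / 2) ^ j)"
      using eps D by (intro mult_right_mono) auto
    then show ?thesis using that by simp
  qed
  then have "norm (pert1 u v n) \<le> D / 4 * (1 / 2) ^ gap k n" "norm (pert2 u v n) \<le> D / 4 * (1 / 2) ^ gap k n"
    if "n \<noteq> k" for n using pert_bounds[OF assms that] by blast+
  from cut_l11le_geometric[OF this(1)] cut_l11le_geometric[OF this(2)]
  show "cut_l11le k (pert1 u v) (D / 2)" "cut_l11le k (pert2 u v) (D / 2)" by simp_all
qed

section \<open>The reduced system on the closed disk\<close>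

text \<open>The pair is encoded as one function on \<open>bool \<times> int\<close> to fit the fixed
  point theorem. The iteration takes place in the weighted ball, but \<open>cut_solve\<close> maps
  it to bounded sequences, so the fixed point obeys the unweighted bound
  \<open>B + 2 * B / 2\<close>.\<close>

lemma reduced_exists:
  assumes z: "norm z \<le> 1" "norm \<zeta> \<le> 1" and B: "0 \<le> B"
    and g: "\<And>n. norm (g1 n) \<le> B" "\<And>n. norm (g2 n) \<le> B"
  shows "\<exists>u v. (\<forall>n. norm (u n) \<le> 2 * B \<and> norm (v n) \<le> 2 * B) \<and>
    (\<forall>n. u n = g1 n + cut_solve k z (pert1 u v) n) \<and> (\<forall>n. v n = g2 n + cut_solve k \<zeta> (pert2 u v) n)"
proof -
  let ?\<nu> = "\<lambda>i :: bool \<times> int. 1 + real (gap k (snd i))"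
  let ?u = "\<lambda>W :: bool \<times> int \<Rightarrow> complex. \<lambda>n. W (True, n)" and ?v = "\<lambda>W :: bool \<times> int \<Rightarrow> complex. \<lambda>n. W (False, n)"
  define T where "T W i = (case i of (b, n) \<Rightarrow> if b then g1 n + cut_solve k z (pert1 (?u W) (?v W)) n
      else g2 n + cut_solve k \<zeta> (pert2 (?u W) (?v W)) n)" for W and i :: "bool \<times> int"
  have half: "norm (cut_solve k z (pert1 u v) n) \<le> D / 2" "norm (cut_solve k \<zeta> (pert2 u v) n) \<le> D / 2"
    if "\<And>n. norm (u n) \<le> D * (1 + real (gap k n))" "\<And>n. norm (v n) \<le> D * (1 + real (gap k n))" for u v D n
    using cut_solve_bound_l11[OF z(1) pert_l11(1)[OF that]] cut_solve_bound_l11[OF z(2) pert_l11(2)[OF that]] by auto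
  have Tb: "norm (T W i) \<le> 2 * B" if W: "\<And>j. norm (W j) \<le> 2 * B * ?\<nu> j" for W i
  proof -
    have *: "norm (?u W n) \<le> 2 * B * (1 + real (gap k n))" "norm (?v W n) \<le> 2 * B * (1 + real (gap k n))" for n
      using W[of "(True, n)"] W[of "(False, n)"] by auto
    show ?thesis
      using half[OF *, of "snd i"] g[of "snd i"] unfolding T_def
      by (auto split: prod.split intro: order_trans[OF norm_triangle_ineq])
  qed
  have "\<exists>W. (\<forall>i. norm (W i) \<le> 2 * B * ?\<nu> i) \<and> T W = W"
  proof (rule weighted_sup_fixpoint[where q = "1 / 2"])
    show "0 < ?\<nu> i" for i by simp
    show "norm (T W i) \<le> 2 * B * ?\<nu> i" if "\<And>j. norm (W j) \<le> 2 * B * ?\<nu> j" for W i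
    proof -
      have "2 * B * 1 \<le> 2 * B * ?\<nu> i" using B by (intro mult_left_mono) auto
      then show ?thesis using Tb[OF that, of i] by simp
    qed
    fix W W' :: "bool \<times> int \<Rightarrow> complex" and D and i :: "bool \<times> int"
    assume W: "\<And>j. norm (W j) \<le> 2 * B * ?\<nu> j" and W': "\<And>j. norm (W' j) \<le> 2 * B * ?\<nu> j"
      and d: "\<And>j. norm (W j - W' j) \<le> D * ?\<nu> j"
    have D: "0 \<le> D" using order_trans[OF norm_ge_zero d[of "(True, k)"]] by simp
    have ud: "norm (?u W n - ?u W' n) \<le> D * (1 + real (gap k n))" "norm (?v W n - ?v W' n) \<le> D * (1 + real (gap k n))" for n
      using d[of "(True, n)"] d[of "(False, n)"] by auto
    have Wu: "norm (?u W n) \<le> 2 * B * (1 + real (gap k n))" "norm (?v W n) \<le> 2 * B * (1 + real (gap k n))"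
      and Wu': "norm (?u W' n) \<le> 2 * B * (1 + real (gap k n))" "norm (?v W' n) \<le> 2 * B * (1 + real (gap k n))" for n
      using W[of "(True, n)"] W[of "(False, n)"] W'[of "(True, n)"] W'[of "(False, n)"] by auto
    note a = cut_admissible_l11[OF z(1) pert_l11(1)[OF Wu]] cut_admissible_l11[OF z(2) pert_l11(2)[OF Wu]]
      cut_admissible_l11[OF z(1) pert_l11(1)[OF Wu']] cut_admissible_l11[OF z(2) pert_l11(2)[OF Wu']]
    have "norm (T W i - T W' i) \<le> D / 2"
      using half[OF ud, of "snd i"]
      unfolding T_def pert_diff cut_solve_diff[OF a(1,3)] cut_solve_diff[OF a(2,4)]
      by (auto split: prod.split)
    also have "\<dots> \<le> 1 / 2 * D * ?\<nu> i" using D by (simp add: algebra_simps)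
    finally show "norm (T W i - T W' i) \<le> 1 / 2 * D * ?\<nu> i" .
  qed (use B in auto)
  then obtain W where W: "\<And>i. norm (W i) \<le> 2 * B * ?\<nu> i" "T W = W" by blast
  show ?thesis
  proof (intro exI conjI allI)
    show "norm (?u W n) \<le> 2 * B" "norm (?v W n) \<le> 2 * B" for n
      using Tb[OF W(1), of "(True, n)"] Tb[OF W(1), of "(False, n)"] unfolding W(2) by auto
    show "?u W n = g1 n + cut_solve k z (pert1 (?u W) (?v W)) n" for n
      using fun_cong[OF W(2), of "(True, n)"] by (simp add: T_def)
    show "?v W n = g2 n + cut_solve k \<zeta> (pert2 (?u W) (?v W)) n" for n
      using fun_cong[OF W(2), of "(False, n)"] by (simp add: T_def)
  qed
qed

text \<open>The contraction absorbs everything except the defect, and the bound \<open>B\<close>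
  serves only finiteness. With \<open>\<delta> = 0\<close> this gives uniqueness; with a small
  defect growing in \<open>gap\<close> it gives stability under a change of the roots.\<close>

lemma reduced_estimate:
  assumes z: "norm z \<le> 1" "norm \<zeta> \<le> 1"
    and b: "\<And>n. norm (u n) \<le> B" "\<And>n. norm (v n) \<le> B"
    and r: "\<And>n. norm (u n - cut_solve k z (pert1 u v) n) \<le> \<delta> * (1 + real (gap k n))"
      "\<And>n. norm (v n - cut_solve k \<zeta> (pert2 u v) n) \<le> \<delta> * (1 + real (gap k n))"
  shows "norm (u n) \<le> 2 * \<delta> * (1 + real (gap k n))" "norm (v n) \<le> 2 * \<delta> * (1 + real (gap k n))"
proof -
  define a where "a i = norm (if fst i then u (snd i) else v (snd i)) / (1 + real (gap k (snd i)))" for i :: "bool \<times> int"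
  have B: "0 \<le> B" using b(1) norm_ge_zero order_trans by blast
  have "a i \<le> \<delta> / (1 - 1 / 2)" for i
  proof (rule sup_absorb[where a = a and B = B and q = "1 / 2"])
    show "a i \<le> B" for i
    proof -
      have "B * 1 \<le> B * (1 + real (gap k (snd i)))" using B by (intro mult_left_mono) auto
      then have "norm (if fst i then u (snd i) else v (snd i)) \<le> B * (1 + real (gap k (snd i)))"
        using b[of "snd i"] by auto
      then show ?thesis unfolding a_def by (simp add: pos_divide_le_eq)
    qed
    fix D and i :: "bool \<times> int" assume D: "\<And>j. a j \<le> D"
    have u: "norm (u n) \<le> D * (1 + real (gap k n))" and v: "norm (v n) \<le> D * (1 + real (gap k n))" for n
      using D[of "(True, n)"] D[of "(False, n)"] by (auto simp: a_def pos_divide_le_eq)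
    have D0: "0 \<le> D" using order_trans[OF norm_ge_zero u[of k]] by simp
    let ?n = "snd i"
    have le: "D / 2 \<le> D / 2 * (1 + real (gap k ?n))" using D0 by (simp add: algebra_simps)
    have "norm (u ?n) \<le> norm (u ?n - cut_solve k z (pert1 u v) ?n) + norm (cut_solve k z (pert1 u v) ?n)"
      "norm (v ?n) \<le> norm (v ?n - cut_solve k \<zeta> (pert2 u v) ?n) + norm (cut_solve k \<zeta> (pert2 u v) ?n)"
      using norm_triangle_ineq[of "u ?n - cut_solve k z (pert1 u v) ?n" "cut_solve k z (pert1 u v) ?n"]
        norm_triangle_ineq[of "v ?n - cut_solve k \<zeta> (pert2 u v) ?n" "cut_solve k \<zeta> (pert2 u v) ?n"] by auto
    then have "norm (u ?n) \<le> (1 / 2 * D + \<delta>) * (1 + real (gap k ?n))"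
      "norm (v ?n) \<le> (1 / 2 * D + \<delta>) * (1 + real (gap k ?n))"
      using r[of ?n] le cut_solve_bound_l11[OF z(1) pert_l11(1)[OF u v], of ?n]
        cut_solve_bound_l11[OF z(2) pert_l11(2)[OF u v], of ?n] by (simp_all add: distrib_right)
    then show "a i \<le> 1 / 2 * D + \<delta>" unfolding a_def by (simp add: pos_divide_le_eq)
  qed simp
  from this[of "(True, n)"] this[of "(False, n)"]
  show "norm (u n) \<le> 2 * \<delta> * (1 + real (gap k n))" "norm (v n) \<le> 2 * \<delta> * (1 + real (gap k n))"
    by (auto simp: a_def pos_divide_le_eq)
qed

end


section \<open>The resolvent off the bands\<close>

lemma lqs_2_0_iff_l2le: "u \<in> lqs 2 0 \<longleftrightarrow> (\<exists>M. l2le u M)"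
  using l2le_iff by blast

lemma lqs_norm_2_0_nonneg: "0 \<le> lqs_norm 2 0 u"
  by (simp add: lqs_norm_2_0 infsum_nonneg)

lemma lqs_norm_1_1_nonneg: "0 \<le> lqs_norm 1 1 u"
  by (simp add: lqs_norm_1_1 infsum_nonneg)

lemma lqs_2_0_add: "u \<in> lqs 2 0 \<Longrightarrow> v \<in> lqs 2 0 \<Longrightarrow> (\<lambda>n. u n + v n) \<in> lqs 2 0"
  and lqs_2_0_diff: "u \<in> lqs 2 0 \<Longrightarrow> v \<in> lqs 2 0 \<Longrightarrow> (\<lambda>n. u n - v n) \<in> lqs 2 0"
  unfolding lqs_2_0_iff_l2le using l2le_add l2le_diff by blast+

lemma lqs_2_0_mult:
  fixes u :: "int \<Rightarrow> complex"
  assumes "u \<in> lqs 2 0" "\<And>n. norm (a n) \<le> c"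
  shows "(\<lambda>n. a n * u n) \<in> lqs 2 0"
proof -
  obtain M where M: "l2le u M" using assms(1) lqs_2_0_iff_l2le by blast
  have "0 \<le> c" using assms(2)[of 0] norm_ge_zero order_trans by blast
  then have "norm (a n * u n) \<le> norm (complex_of_real c * u n)" for n
    unfolding norm_mult using assms(2)[of n] by (intro mult_right_mono) auto
  then have "l2le (\<lambda>n. a n * u n) (norm (complex_of_real c) * M)"
    by (rule l2le_mono_pointwise[OF l2le_cmult[OF M]])
  then show ?thesis using lqs_2_0_iff_l2le by blast
qed

lemma lqs_2_0_shift: "u \<in> lqs 2 0 \<Longrightarrow> (\<lambda>n. u (n + i)) \<in> lqs 2 0"
  unfolding lqs_2_0_iff_l2le using l2le_reindex[of u _ "\<lambda>n. n + i"] by (auto simp: inj_def)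

lemma lqs_2_0_lap:
  fixes u :: "int \<Rightarrow> complex"
  assumes "u \<in> lqs 2 0"
  shows "lap u \<in> lqs 2 0"
proof -
  have "(\<lambda>n. u (n + 1) - 2 * u n + u (n + - 1)) \<in> lqs 2 0"
    by (intro lqs_2_0_add lqs_2_0_diff lqs_2_0_shift lqs_2_0_mult[where c = 2] assms) auto
  then show ?thesis by (simp add: lap_def[abs_def])
qed

context soliton_background
begin

lemma shifted_diff: "shifted H \<Omega> (w - w') = shifted H \<Omega> w - shifted H \<Omega> w'"
  by (simp add: prod_eq_iff fun_eq_iff shifted_def H_def H_op_def scale_def Let_def lap_def algebra_simps)

lemma P_le: "norm (P n) \<le> 11 / 10" and Q_le: "norm (Q n) \<le> 3 / 4"
proof -
  have "(1 / 2 :: real) ^ gap k n \<le> 1" by (simp add: power_le_one)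
  then show "norm (P n) \<le> 11 / 10" "norm (Q n) \<le> 3 / 4"
    using phi_geometric[of n] psi_geometric[of n] by simp_all
qed

lemma P_l2: "l2le P (22 / 5)" and Q_l2: "l2le Q 3"
  using l2le_geometric[of P "11 / 10" k] l2le_geometric[of Q "3 / 4" k] phi_geometric psi_geometric by auto

lemma comb_l2:
  assumes u: "l2le u M" and v: "l2le v M"
  shows "l2le (fst (comb x y u v)) (5 * norm x + 3 * norm y + M)"
    and "l2le (snd (comb x y u v)) (5 * norm x + 3 * norm y + M)"
proof -
  have "l2le (\<lambda>n. x * P n) (norm x * (22 / 5))" "l2le (\<lambda>n. - x * P n) (norm (- x) * (22 / 5))"
    "l2le (\<lambda>n. y * Q n) (norm y * 3)"
    by (intro l2le_cmult P_l2 Q_l2)+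
  note l = l2le_add[OF l2le_add[OF this(1,3)] u] l2le_add[OF l2le_add[OF this(2,3)] v]
  show "l2le (fst (comb x y u v)) (5 * norm x + 3 * norm y + M)"
    "l2le (snd (comb x y u v)) (5 * norm x + 3 * norm y + M)"
    unfolding comb_def fst_conv snd_conv by (rule l2le_mono[OF l(1)] l2le_mono[OF l(2)]; simp)+
qed

lemma comb_l2_pair: "u \<in> lqs 2 0 \<Longrightarrow> v \<in> lqs 2 0 \<Longrightarrow> comb x y u v \<in> l2_pair"
proof -
  assume "u \<in> lqs 2 0" "v \<in> lqs 2 0"
  then have "l2le u (max (lqs_norm 2 0 u) (lqs_norm 2 0 v))" "l2le v (max (lqs_norm 2 0 u) (lqs_norm 2 0 v))"
    by (auto simp: l2le_iff)
  from comb_l2[OF this, of x y] show ?thesis by (auto simp: l2le_iff mem_Times_iff)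
qed

lemma shifted_l2_pair:
  assumes "w \<in> l2_pair"
  shows "shifted H \<Omega> w \<in> l2_pair"
proof -
  obtain u v where w: "w = (u, v)" by fastforce
  have u: "u \<in> lqs 2 0" and v: "v \<in> lqs 2 0" using assms w by auto
  have PP: "norm (P n * P n) \<le> 2" for n
  proof -
    have "norm (P n) * norm (P n) \<le> 11 / 10 * (11 / 10)" by (intro mult_mono P_le) auto
    then show ?thesis by (simp add: norm_mult)
  qed
  have "(\<lambda>n. - e * lap u n + u n - 2 * (P n * P n * u n) - P n * P n * v n - \<Omega> * u n) \<in> lqs 2 0"
    by (intro lqs_2_0_add lqs_2_0_diff lqs_2_0_mult[OF lqs_2_0_lap[OF u] order_refl]
        lqs_2_0_mult[OF lqs_2_0_mult[OF u PP], of "\<lambda>_. 2" 2] lqs_2_0_mult[OF v PP] lqs_2_0_mult[OF u order_refl] u) auto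
  then have 1: "fst (shifted H \<Omega> w) \<in> lqs 2 0" unfolding w shifted_fst[symmetric] .
  have "(\<lambda>n. P n * P n * u n + e * lap v n - v n + 2 * (P n * P n * v n) - \<Omega> * v n) \<in> lqs 2 0"
    by (intro lqs_2_0_add lqs_2_0_diff lqs_2_0_mult[OF lqs_2_0_lap[OF v] order_refl]
        lqs_2_0_mult[OF lqs_2_0_mult[OF v PP], of "\<lambda>_. 2" 2] lqs_2_0_mult[OF u PP] lqs_2_0_mult[OF v order_refl] v) auto
  then have 2: "snd (shifted H \<Omega> w) \<in> lqs 2 0" unfolding w shifted_snd[symmetric] .
  show ?thesis using 1 2 by (simp add: mem_Times_iff)
qed

lemma src_l2:
  assumes f: "l2le f M" and g: "l2le g M"
  shows "l2le (\<lambda>n. if n = k then 0 else src1 f g n) (2 * M / \<epsilon>)"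
    and "l2le (\<lambda>n. if n = k then 0 else src2 f g n) (2 * M / \<epsilon>)"
proof -
  have M: "0 \<le> M" using f by (rule l2le_nonneg)
  let ?X = "coordX f g" and ?Y = "coordY f g"
  let ?P = "\<lambda>n. if n = k then 0 else P n" and ?Q = "\<lambda>n. if n = k then 0 else Q n"
  have X: "norm ?X \<le> 2 * M" and Y: "norm ?Y \<le> 4 * M"
    using coord_bounds[OF l2le_pointwise[OF f] l2le_pointwise[OF g]] by auto
  have P: "l2le ?P (4 * (4 * \<epsilon>))" and Q: "l2le ?Q (4 * (17 * \<epsilon>))"
    by (rule l2le_geometric[where k = k]; use phi_off psi_off eps in auto)+
  have "norm ?X * (4 * (4 * \<epsilon>)) + norm ?Y * (4 * (17 * \<epsilon>)) \<le> 2 * M * (4 * (4 * \<epsilon>)) + 4 * M * (4 * (17 * \<epsilon>))"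
    using X Y eps by (intro add_mono mult_right_mono) auto
  also have "\<dots> = 304 * \<epsilon> * M" by simp
  also have "\<dots> \<le> 1 * M" using eps M by (intro mult_right_mono) auto
  finally have tot: "norm ?X * (4 * (4 * \<epsilon>)) + norm ?Y * (4 * (17 * \<epsilon>)) \<le> M" by simp
  have e: "norm (1 / e) = 1 / \<epsilon>" using eps by (simp add: norm_divide)
  have tot': "norm (1 / e) * (M + norm ?X * (4 * (4 * \<epsilon>)) + norm ?Y * (4 * (17 * \<epsilon>))) \<le> 2 * M / \<epsilon>"
    unfolding e using tot eps by (simp add: divide_right_mono)
  have "l2le (\<lambda>n. 1 / e * (f n - ?X * ?P n - ?Y * ?Q n)) (2 * M / \<epsilon>)"
    by (rule l2le_mono[OF l2le_cmult[OF l2le_diff[OF l2le_diff[OF f l2le_cmult[OF P]] l2le_cmult[OF Q]]] tot'])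
  then show "l2le (\<lambda>n. if n = k then 0 else src1 f g n) (2 * M / \<epsilon>)"
    by (rule l2le_mono_pointwise) (simp add: src1_def)
  have "l2le (\<lambda>n. 1 / e * (- g n - ?X * ?P n + ?Y * ?Q n)) (2 * M / \<epsilon>)"
    by (rule l2le_mono[OF l2le_cmult[OF l2le_add[OF l2le_diff[OF l2le_minus[OF g] l2le_cmult[OF P]] l2le_cmult[OF Q]]] tot'])
  then show "l2le (\<lambda>n. if n = k then 0 else src2 f g n) (2 * M / \<epsilon>)"
    by (rule l2le_mono_pointwise) (simp add: src2_def)
qed

lemma pert_l2:
  assumes "\<And>n. norm (u n) \<le> D * (1 + real (gap k n))" "\<And>n. norm (v n) \<le> D * (1 + real (gap k n))"
  shows "l2le (\<lambda>n. if n = k then 0 else pert1 u v n) D" "l2le (\<lambda>n. if n = k then 0 else pert2 u v n) D"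
proof -
  have D: "0 \<le> D" using order_trans[OF norm_ge_zero assms(1)[of k]] by simp
  have "(1600 * \<epsilon>) * D \<le> 1 * D" using eps D by (intro mult_right_mono) auto
  then have le: "4 * (400 * \<epsilon> * D) \<le> D" by simp
  have "norm (if n = k then 0 else pert1 u v n) \<le> 400 * \<epsilon> * D * (1 / 2) ^ gap k n"
    "norm (if n = k then 0 else pert2 u v n) \<le> 400 * \<epsilon> * D * (1 / 2) ^ gap k n" for n
    using pert_bounds[OF assms] eps D by auto
  from l2le_mono[OF l2le_geometric[OF this(1)] le] l2le_mono[OF l2le_geometric[OF this(2)] le]
  show "l2le (\<lambda>n. if n = k then 0 else pert1 u v n) D" "l2le (\<lambda>n. if n = k then 0 else pert2 u v n) D" .
qed

lemma off_bounded:
  assumes "l2le (\<lambda>n. if n = k then 0 else h n) M" "n \<noteq> k"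
  shows "norm (h n) \<le> M"
  using l2le_pointwise[OF assms(1), of n] assms(2) by simp

section \<open>Bounded inverse away from the bands and zero\<close>

text \<open>In the notation of \<open>solution_exists\<close> the factors are
  \<open>2 * \<kappa> + 30\<close> and \<open>B / M\<close>. The constant blows up as
  \<open>r\<close> tends to 1, that is, towards the bands.\<close>

definition resolvent_const :: "real \<Rightarrow> real" where
  "resolvent_const r = (8 / (1 - r) ^ 3 + 30) * (8 / (\<epsilon> * (1 - r) ^ 3))"

lemma resolvent_const_nonneg: "r < 1 \<Longrightarrow> 0 \<le> resolvent_const r"
  unfolding resolvent_const_def using eps by (intro mult_nonneg_nonneg add_nonneg_nonneg divide_nonneg_nonneg) auto

lemma solution_exists:
  assumes sp: "spectral \<Omega> z \<zeta>" and z: "norm z \<le> r" "norm \<zeta> \<le> r" and r: "r < 1" and \<Omega>: "\<Omega> \<noteq> 0"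
    and f: "l2le f M" and g: "l2le g M"
  shows "\<exists>w. shifted H \<Omega> w = (f, g) \<and>
    l2le (fst w) (resolvent_const r * (1 + 1 / norm \<Omega>)\<^sup>2 * M) \<and> l2le (snd w) (resolvent_const r * (1 + 1 / norm \<Omega>)\<^sup>2 * M)"
proof -
  define \<kappa> where "\<kappa> = 4 / (1 - r) ^ 3"
  have r0: "0 \<le> r" using z norm_ge_zero order_trans by blast
  have M: "0 \<le> M" using f by (rule l2le_nonneg)
  have "(1 - r) ^ 3 \<le> 1" using r r0 by (intro power_le_one) auto
  moreover have "0 < (1 - r) ^ 3" using r by simp
  ultimately have \<kappa>: "4 \<le> \<kappa>" unfolding \<kappa>_def by (simp add: pos_le_divide_eq)
  have cs: "l2le (cut_solve k a h) (\<kappa> * N)" if "norm a \<le> r" "l2le (\<lambda>n. if n = k then 0 else h n) N" for a h N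
    using cut_solve_l2[OF that(1) r that(2)] by (simp add: \<kappa>_def)
  have adm: "cut_admissible k a h" if "norm a \<le> r" "l2le (\<lambda>n. if n = k then 0 else h n) N" for a h N
    using that r off_bounded[OF that(2)] by (intro cut_admissible_bounded) auto
  note sl = src_l2[OF f g]
  define B where "B = \<kappa> * (2 * M / \<epsilon>)"
  have B: "l2le (cut_solve k z (src1 f g)) B" "l2le (cut_solve k \<zeta> (src2 f g)) B"
    unfolding B_def using cs[OF z(1) sl(1)] cs[OF z(2) sl(2)] by auto
  have B0: "0 \<le> B" using B(1) by (rule l2le_nonneg)
  have MB: "M \<le> B"
  proof -
    have "M * \<epsilon> \<le> M * 1" using eps M by (intro mult_left_mono) auto
    then have "M \<le> M / \<epsilon>" using eps by (simp add: pos_le_divide_eq)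
    also have "\<dots> \<le> 1 * (2 * M / \<epsilon>)" using M eps by (simp add: divide_right_mono)
    also have "\<dots> \<le> B" unfolding B_def using \<kappa> M eps by (intro mult_right_mono) auto
    finally show ?thesis .
  qed
  have z1: "norm z \<le> 1" "norm \<zeta> \<le> 1" using sp by (auto simp: spectral_def)
  obtain u v where b: "\<And>n. norm (u n) \<le> 2 * B" "\<And>n. norm (v n) \<le> 2 * B"
    and u: "\<And>n. u n = cut_solve k z (src1 f g) n + cut_solve k z (pert1 u v) n"
    and v: "\<And>n. v n = cut_solve k \<zeta> (src2 f g) n + cut_solve k \<zeta> (pert2 u v) n"
    using reduced_exists[OF z1 B0, of "cut_solve k z (src1 f g)" "cut_solve k \<zeta> (src2 f g)"]
      l2le_pointwise[OF B(1)] l2le_pointwise[OF B(2)] by metis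
  have bw: "norm (u n) \<le> 2 * B * (1 + real (gap k n))" "norm (v n) \<le> 2 * B * (1 + real (gap k n))" for n
  proof -
    have "2 * B * 1 \<le> 2 * B * (1 + real (gap k n))" using B0 by (intro mult_left_mono) auto
    then show "norm (u n) \<le> 2 * B * (1 + real (gap k n))" "norm (v n) \<le> 2 * B * (1 + real (gap k n))"
      using b[of n] by auto
  qed
  note pl = pert_l2[OF bw]
  have u': "u = cut_solve k z (\<lambda>n. src1 f g n + pert1 u v n)" and v': "v = cut_solve k \<zeta> (\<lambda>n. src2 f g n + pert2 u v n)"
    by (rule ext, subst cut_solve_add[OF adm[OF z(1) sl(1)] adm[OF z(1) pl(1)]], rule u)
      (rule ext, subst cut_solve_add[OF adm[OF z(2) sl(2)] adm[OF z(2) pl(2)]], rule v)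
  have uk: "u k = 0" "v k = 0" by (subst u', simp) (subst v', simp)
  have disp: "dispersion z u n = src1 f g n + pert1 u v n \<and> dispersion \<zeta> v n = src2 f g n + pert2 u v n"
    if "n \<noteq> k" for n
  proof -
    have nz: "z \<noteq> 0" "\<zeta> \<noteq> 0" using sp by (auto simp: spectral_def)
    have "dispersion z (cut_solve k z (\<lambda>n. src1 f g n + pert1 u v n)) n = src1 f g n + pert1 u v n"
      by (rule cut_solve_eq[OF nz(1) cut_admissible_add[OF adm[OF z(1) sl(1)] adm[OF z(1) pl(1)]] that])
    moreover have "dispersion \<zeta> (cut_solve k \<zeta> (\<lambda>n. src2 f g n + pert2 u v n)) n = src2 f g n + pert2 u v n"
      by (rule cut_solve_eq[OF nz(2) cut_admissible_add[OF adm[OF z(2) sl(2)] adm[OF z(2) pl(2)]] that])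
    ultimately show ?thesis using u' v' by metis
  qed
  \<comment> \<open>Back substitution in the Jordan block: one division by \<Omega> for
    \<open>y\<close> and a second one for \<open>x\<close>, hence a bound of order two in
    \<open>1 / norm \<Omega>\<close>.\<close>
  define y x where "y = (cY u v - coordY f g) / \<Omega>" and "x = (y + cX u v - coordX f g) / \<Omega>"
  have xy: "y - \<Omega> * x + cX u v = coordX f g" "- \<Omega> * y + cY u v = coordY f g"
    using \<Omega> by (simp_all add: x_def y_def)
  have eq: "shifted H \<Omega> (comb x y u v) = (f, g)"
    unfolding shifted_comb_iff[OF sp, of u v, OF uk] using xy disp by blast
  define t where "t = 1 / norm \<Omega>"
  have t: "0 \<le> t" by (simp add: t_def)
  have small: "c * \<epsilon> * (2 * B) \<le> B" if "0 \<le> c" "c \<le> 16" for c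
  proof -
    have "(c * \<epsilon>) * (2 * B) \<le> (16 * (1 / 10000)) * (2 * B)"
      using that eps B0 by (intro mult_mono) auto
    then show ?thesis using B0 by linarith
  qed
  have cX: "norm (cX u v) \<le> B" and cY: "norm (cY u v) \<le> B"
    using c_bounds[OF bw] small[of 5] small[of 16] by auto
  have X: "norm (coordX f g) \<le> 2 * M" and Y: "norm (coordY f g) \<le> 4 * M"
    using coord_bounds[OF l2le_pointwise[OF f] l2le_pointwise[OF g]] by auto
  have "norm (cY u v - coordY f g) \<le> 5 * B"
    using norm_triangle_ineq4[of "cY u v" "coordY f g"] cY Y MB by linarith
  then have ny: "norm y \<le> 5 * B * t"
    unfolding y_def t_def norm_divide by (simp add: divide_right_mono)
  have "norm (y + cX u v - coordX f g) \<le> 5 * B * t + 3 * B"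
    using norm_triangle_ineq4[of "y + cX u v" "coordX f g"] norm_triangle_ineq[of y "cX u v"] cX X MB ny by linarith
  then have nx: "norm x \<le> (5 * B * t + 3 * B) * t"
    unfolding x_def norm_divide by (simp add: t_def divide_right_mono)
  \<comment> \<open>The solution was found in a sup norm; one application of
    \<open>cut_solve\<close> to a square summable right-hand side places it in
    \<open>l\<^sup>2\<close>.\<close>
  have ul: "l2le u (B + \<kappa> * (2 * B))"
    using l2le_add[OF B(1) cs[OF z(1) pl(1)]] by (subst (asm) u[symmetric]) simp
  have vl: "l2le v (B + \<kappa> * (2 * B))"
    using l2le_add[OF B(2) cs[OF z(2) pl(2)]] by (subst (asm) v[symmetric]) simp
  have tot: "5 * norm x + 3 * norm y + (B + \<kappa> * (2 * B)) \<le> resolvent_const r * (1 + 1 / norm \<Omega>)\<^sup>2 * M"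
  proof -
    have "5 * norm x + 3 * norm y + (B + \<kappa> * (2 * B)) \<le> 5 * ((5 * B * t + 3 * B) * t) + 3 * (5 * B * t) + (B + \<kappa> * (2 * B))"
      using nx ny by simp
    also have "\<dots> = B * (25 * t\<^sup>2 + 30 * t + 1 + 2 * \<kappa>)" by (simp add: power2_eq_square algebra_simps)
    also have "\<dots> \<le> B * ((2 * \<kappa> + 30) * (1 + t)\<^sup>2)"
    proof (rule mult_left_mono[OF _ B0])
      have "0 \<le> \<kappa> * t" "0 \<le> \<kappa> * t\<^sup>2" "0 \<le> t\<^sup>2" using \<kappa> t by simp_all
      moreover have "(2 * \<kappa> + 30) * (1 + t)\<^sup>2
          = 2 * \<kappa> + 4 * (\<kappa> * t) + 2 * (\<kappa> * t\<^sup>2) + 30 + 60 * t + 30 * t\<^sup>2"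
        by (simp add: power2_eq_square algebra_simps)
      ultimately show "25 * t\<^sup>2 + 30 * t + 1 + 2 * \<kappa> \<le> (2 * \<kappa> + 30) * (1 + t)\<^sup>2" using t by linarith
    qed
    also have "\<dots> = resolvent_const r * (1 + 1 / norm \<Omega>)\<^sup>2 * M"
      unfolding B_def \<kappa>_def resolvent_const_def t_def by (simp add: field_simps)
    finally show ?thesis .
  qed
  show ?thesis
    using eq l2le_mono[OF comb_l2(1)[OF ul vl] tot] l2le_mono[OF comb_l2(2)[OF ul vl] tot] by blast
qed

text \<open>Boundedness of the remainder, inherited from square summability, is enough for
  uniqueness of the Dirichlet problem in the open disk, so every solution has the constructed
  form.\<close>

lemma solution_reduced:
  assumes sp: "spectral \<Omega> z \<zeta>" and z: "norm z < 1" "norm \<zeta> < 1"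
    and w: "w \<in> l2_pair" and eq: "shifted H \<Omega> w = (f, g)"
  obtains x y u v B where "w = comb x y u v" "\<And>n. norm (u n) \<le> B" "\<And>n. norm (v n) \<le> B"
    "y - \<Omega> * x + cX u v = coordX f g" "- \<Omega> * y + cY u v = coordY f g"
    "u = cut_solve k z (\<lambda>n. src1 f g n + pert1 u v n)" "v = cut_solve k \<zeta> (\<lambda>n. src2 f g n + pert2 u v n)"
proof -
  obtain x y u v where w': "w = comb x y u v" and uk: "u k = 0" "v k = 0"
    and u: "u = (\<lambda>n. fst w n - x * P n - y * Q n)" and v: "v = (\<lambda>n. snd w n + x * P n - y * Q n)"
    by (rule comb_exists)
  obtain M where M: "l2le (fst w) M" "l2le (snd w) M"
  proof -
    have "l2le (fst w) (max (lqs_norm 2 0 (fst w)) (lqs_norm 2 0 (snd w)))"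
      "l2le (snd w) (max (lqs_norm 2 0 (fst w)) (lqs_norm 2 0 (snd w)))"
      using w by (auto simp: l2le_iff)
    then show ?thesis by (rule that)
  qed
  define B where "B = M + norm x * (11 / 10) + norm y * (3 / 4)"
  have xP: "norm (x * P n) \<le> norm x * (11 / 10)" and yQ: "norm (y * Q n) \<le> norm y * (3 / 4)" for n
    unfolding norm_mult by (intro mult_left_mono P_le Q_le; simp)+
  have ub: "norm (u n) \<le> B" for n
    using norm_triangle_ineq4[of "fst w n - x * P n" "y * Q n"] norm_triangle_ineq4[of "fst w n" "x * P n"]
      xP[of n] yQ[of n] l2le_pointwise[OF M(1), of n] unfolding u B_def by linarith
  have vb: "norm (v n) \<le> B" for n
    using norm_triangle_ineq4[of "snd w n + x * P n" "y * Q n"] norm_triangle_ineq[of "snd w n" "x * P n"]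
      xP[of n] yQ[of n] l2le_pointwise[OF M(2), of n] unfolding v B_def by linarith
  have *: "y - \<Omega> * x + cX u v = coordX f g" "- \<Omega> * y + cY u v = coordY f g"
    and d: "\<And>n. n \<noteq> k \<Longrightarrow> dispersion z u n = src1 f g n + pert1 u v n"
      "\<And>n. n \<noteq> k \<Longrightarrow> dispersion \<zeta> v n = src2 f g n + pert2 u v n"
    using eq unfolding w' shifted_comb_iff[OF sp, of u v, OF uk] by blast+
  have nz: "z \<noteq> 0" "\<zeta> \<noteq> 0" using sp by (auto simp: spectral_def)
  have "u = cut_solve k z (\<lambda>n. src1 f g n + pert1 u v n)"
    by (rule cut_solve_unique[where u = u, OF nz(1) z(1) uk(1) ub d(1)])
  moreover have "v = cut_solve k \<zeta> (\<lambda>n. src2 f g n + pert2 u v n)"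
    by (rule cut_solve_unique[where u = v, OF nz(2) z(2) uk(2) vb d(2)])
  ultimately show ?thesis by (rule that[OF w' ub vb *])
qed

lemma shifted_jordan: "shifted H \<Omega> (comb x y (\<lambda>_. 0) (\<lambda>_. 0)) = comb (y - \<Omega> * x) (- \<Omega> * y) (\<lambda>_. 0) (\<lambda>_. 0)"
proof -
  have "fst (shifted H \<Omega> (\<lambda>_. 0, \<lambda>_. 0)) n = 0" "snd (shifted H \<Omega> (\<lambda>_. 0, \<lambda>_. 0)) n = 0" for n
    by (simp_all only: shifted_fst shifted_snd) (simp_all add: lap_def)
  then show ?thesis
    unfolding prod_eq_iff fun_eq_iff shifted_comb by (simp add: comb_def)
qed

text \<open>For a right-hand side in the Jordan plane both sources vanish, and the reduced estimate
  without defect forces \<open>u\<close> and \<open>v\<close> to be 0. With right-hand side 0 this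
  yields injectivity, and at \<Omega> = 0 it confines the generalized eigenvectors to the
  plane.\<close>

lemma jordan_preimage:
  assumes sp: "spectral \<Omega> z \<zeta>" and z: "norm z < 1" "norm \<zeta> < 1"
    and w: "w \<in> l2_pair" and eq: "shifted H \<Omega> w = comb \<alpha> \<beta> (\<lambda>_. 0) (\<lambda>_. 0)"
  obtains x y where "w = comb x y (\<lambda>_. 0) (\<lambda>_. 0)" "y - \<Omega> * x = \<alpha>" "- \<Omega> * y = \<beta>"
proof -
  let ?f = "\<lambda>n. \<alpha> * P n + \<beta> * Q n" and ?g = "\<lambda>n. - \<alpha> * P n + \<beta> * Q n"
  have eq': "shifted H \<Omega> w = (?f, ?g)" using eq by (simp add: comb_def)
  have X: "coordX ?f ?g = \<alpha>" and Y: "coordY ?f ?g = \<beta>"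
    using PQ_nz by (simp_all add: coordX_def coordY_def)
  have s: "src1 ?f ?g n = 0" "src2 ?f ?g n = 0" for n
    unfolding src1_def src2_def X Y by simp_all
  show ?thesis
  proof (rule solution_reduced[OF sp z w eq'])
    fix x y u v B
    assume w': "w = comb x y u v" and b: "\<And>n. norm (u n) \<le> B" "\<And>n. norm (v n) \<le> B"
      and xy: "y - \<Omega> * x + cX u v = coordX ?f ?g" "- \<Omega> * y + cY u v = coordY ?f ?g"
      and u: "u = cut_solve k z (\<lambda>n. src1 ?f ?g n + pert1 u v n)" and v: "v = cut_solve k \<zeta> (\<lambda>n. src2 ?f ?g n + pert2 u v n)"
    have r: "norm (u n - cut_solve k z (pert1 u v) n) \<le> 0 * (1 + real (gap k n))"
      "norm (v n - cut_solve k \<zeta> (pert2 u v) n) \<le> 0 * (1 + real (gap k n))" for n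
      using fun_cong[OF u[unfolded s add_0], of n] fun_cong[OF v[unfolded s add_0], of n] by simp_all
    have "u n = 0" "v n = 0" for n
      using reduced_estimate[OF _ _ b r, of n] z by simp_all
    then have uv: "u = (\<lambda>_. 0)" "v = (\<lambda>_. 0)" by auto
    show ?thesis
      using xy unfolding X Y by (intro that[of x y]) (simp_all add: w' uv cX_def cY_def)
  qed
qed

lemma comb_zero: "comb 0 0 (\<lambda>_. 0) (\<lambda>_. 0) = 0"
  by (simp add: comb_def zero_prod_def zero_fun_def)

text \<open>The excluded interval of the root equation, with parameter \<open>t\<close>, corresponds
  to \<open>\<Omega> = 1 + \<epsilon> * (2 - t)\<close> for \<open>z\<close> and to the negative of
  this number for \<open>\<zeta>\<close>: these are the two bands.\<close>

lemma spectral_exists: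
  assumes "\<Omega> \<notin> complex_of_real ` bands \<epsilon>"
  obtains z \<zeta> where "spectral \<Omega> z \<zeta>" "norm z < 1" "norm \<zeta> < 1"
proof -
  have 1: "2 + (1 - \<Omega>) / e \<notin> complex_of_real ` {-2..2}"
  proof
    assume "2 + (1 - \<Omega>) / e \<in> complex_of_real ` {-2..2}"
    then obtain t where t: "t \<in> {-2..2}" "2 + (1 - \<Omega>) / e = complex_of_real t" by blast
    then have "\<Omega> = complex_of_real (1 + \<epsilon> * (2 - t))" using e0 by (simp add: field_simps)
    moreover have "1 + \<epsilon> * (2 - t) \<in> bands \<epsilon>"
      using t(1) eps mult_left_mono[of "2 - t" 4 \<epsilon>] by (auto simp: bands_def)
    ultimately show False using assms by blast
  qed
  have 2: "2 + (1 + \<Omega>) / e \<notin> complex_of_real ` {-2..2}"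
  proof
    assume "2 + (1 + \<Omega>) / e \<in> complex_of_real ` {-2..2}"
    then obtain t where t: "t \<in> {-2..2}" "2 + (1 + \<Omega>) / e = complex_of_real t" by blast
    then have "\<Omega> = complex_of_real (- 1 - \<epsilon> * (2 - t))" using e0 by (simp add: field_simps)
    moreover have "- 1 - \<epsilon> * (2 - t) \<in> bands \<epsilon>"
      using t(1) eps mult_left_mono[of "2 - t" 4 \<epsilon>] by (auto simp: bands_def)
    ultimately show False using assms by blast
  qed
  obtain z \<zeta> where "z \<noteq> 0" "norm z < 1" "z + 1 / z = 2 + (1 - \<Omega>) / e"
    "\<zeta> \<noteq> 0" "norm \<zeta> < 1" "\<zeta> + 1 / \<zeta> = 2 + (1 + \<Omega>) / e"
    using joukowski_root[OF 1] joukowski_root[OF 2] by blast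
  then show ?thesis by (intro that[of z \<zeta>]) (auto simp: spectral_def)
qed

lemma shifted_inj:
  assumes \<Omega>: "\<Omega> \<notin> complex_of_real ` bands \<epsilon>" "\<Omega> \<noteq> 0"
  shows "inj_on (shifted H \<Omega>) l2_pair"
proof (rule inj_onI)
  fix w w' assume w: "w \<in> l2_pair" "w' \<in> l2_pair" and "shifted H \<Omega> w = shifted H \<Omega> w'"
  then have "shifted H \<Omega> (w - w') = comb 0 0 (\<lambda>_. 0) (\<lambda>_. 0)"
    by (simp add: shifted_diff comb_zero)
  moreover have "w - w' \<in> l2_pair"
    using w lqs_2_0_diff by (auto simp: mem_Times_iff fun_diff_def)
  moreover obtain z \<zeta> where "spectral \<Omega> z \<zeta>" "norm z < 1" "norm \<zeta> < 1"
    using spectral_exists[OF \<Omega>(1)] .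
  ultimately obtain x y where "w - w' = comb x y (\<lambda>_. 0) (\<lambda>_. 0)" "y - \<Omega> * x = 0" "- \<Omega> * y = 0"
    using jordan_preimage by metis
  then show "w = w'" using \<Omega>(2) comb_zero by simp
qed

lemma op_norm_le_l2_resolvent:
  assumes \<Omega>: "\<Omega> \<notin> complex_of_real ` bands \<epsilon>" "\<Omega> \<noteq> 0"
    and sp: "spectral \<Omega> z \<zeta>" and z: "norm z \<le> r" "norm \<zeta> \<le> r" and r: "r < 1"
  shows "bij_betw (shifted H \<Omega>) l2_pair l2_pair"
    and "op_norm_le_l2 (resolvent H \<Omega>) (2 * resolvent_const r * (1 + 1 / norm \<Omega>)\<^sup>2)"
proof -
  let ?N = "pair_norm (lqs_norm 2 0)" and ?K = "resolvent_const r * (1 + 1 / norm \<Omega>)\<^sup>2"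
  have sol: "\<exists>w. w \<in> l2_pair \<and> shifted H \<Omega> w = F \<and> ?N w \<le> 2 * ?K * ?N F" if F: "F \<in> l2_pair" for F
  proof -
    have "l2le (fst F) (?N F)" "l2le (snd F) (?N F)"
      using F lqs_norm_2_0_nonneg by (auto simp: l2le_iff pair_norm_def)
    from solution_exists[OF sp z r \<Omega>(2) this] obtain w where
      w: "shifted H \<Omega> w = F" "l2le (fst w) (?K * ?N F)" "l2le (snd w) (?K * ?N F)" by auto
    then have "w \<in> l2_pair" "?N w \<le> 2 * ?K * ?N F" by (auto simp: l2le_iff mem_Times_iff pair_norm_def)
    then show ?thesis using w(1) by blast
  qed
  have inj: "inj_on (shifted H \<Omega>) l2_pair" by (rule shifted_inj[OF \<Omega>])
  have "shifted H \<Omega> ` l2_pair = l2_pair"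
  proof
    show "shifted H \<Omega> ` l2_pair \<subseteq> l2_pair" by (rule image_subsetI) (rule shifted_l2_pair)
    show "l2_pair \<subseteq> shifted H \<Omega> ` l2_pair"
    proof
      fix F assume "F \<in> l2_pair"
      from sol[OF this] show "F \<in> shifted H \<Omega> ` l2_pair" by (metis imageI)
    qed
  qed
  then show "bij_betw (shifted H \<Omega>) l2_pair l2_pair" using inj by (simp add: bij_betw_def)
  show "op_norm_le_l2 (resolvent H \<Omega>) (2 * resolvent_const r * (1 + 1 / norm \<Omega>)\<^sup>2)"
    unfolding op_norm_le_def
  proof
    fix F assume "F \<in> l2_pair"
    then obtain w where w: "w \<in> l2_pair" "shifted H \<Omega> w = F" "?N w \<le> 2 * ?K * ?N F" using sol by blast
    then have "resolvent H \<Omega> F = w" unfolding resolvent_def using inj by (intro inv_into_f_eq)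
    then show "resolvent H \<Omega> F \<in> l2_pair \<and> ?N (resolvent H \<Omega> F) \<le> 2 * resolvent_const r * (1 + 1 / norm \<Omega>)\<^sup>2 * ?N F"
      using w by (simp add: mult.assoc)
  qed
qed

lemma resolvent_bounded_off_bands:
  assumes \<Omega>: "\<Omega> \<notin> complex_of_real ` bands \<epsilon>" "\<Omega> \<noteq> 0"
  shows "resolvent_bounded H \<Omega>"
proof -
  obtain z \<zeta> where sp: "spectral \<Omega> z \<zeta>" and z: "norm z < 1" "norm \<zeta> < 1" using spectral_exists[OF \<Omega>(1)] .
  \<comment> \<open>Here \<open>r\<close> varies with \<Omega>; no uniformity up to the bands is
    claimed in \<open>l\<^sup>2\<close>.\<close>
  have "norm z \<le> max (norm z) (norm \<zeta>)" "norm \<zeta> \<le> max (norm z) (norm \<zeta>)" "max (norm z) (norm \<zeta>) < 1" using z by auto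
  from op_norm_le_l2_resolvent[OF \<Omega> sp this] show ?thesis unfolding resolvent_bounded_def by blast
qed

section \<open>The double pole at zero\<close>

lemma near_zero_not_band: "norm \<Omega> < 1 / 2 \<Longrightarrow> \<Omega> \<notin> complex_of_real ` bands \<epsilon>"
  using eps by (auto simp: bands_def)

text \<open>Near zero \<open>(1 + a) / e\<close> has modulus at least 5, so
  \<open>norm (z + 1 / z)\<close> is at least 3 and \<open>1 / norm z\<close> at least 2. A single
  \<open>r = 1 / 2\<close> then serves on the whole disk, which makes the order of the pole
  visible.\<close>

lemma root_near_zero:
  assumes z: "z \<noteq> 0" "norm z \<le> 1" "z + 1 / z = 2 + (1 + a) / e" and a: "norm a < 1 / 2"
  shows "norm z \<le> 1 / 2"
proof -
  have "1 / 2 \<le> norm (1 + a)" using norm_triangle_ineq4[of "1 + a" a] a by simp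
  then have "(1 / 2) / \<epsilon> \<le> norm (1 + a) / \<epsilon>" using eps by (intro divide_right_mono) auto
  moreover have "norm ((1 + a) / e) = norm (1 + a) / \<epsilon>" using eps by (simp add: norm_divide)
  moreover have "5 \<le> (1 / 2) / \<epsilon>" using eps by (simp add: pos_le_divide_eq)
  ultimately have "5 \<le> norm ((1 + a) / e)" by linarith
  moreover have "norm ((1 + a) / e) \<le> norm (z + 1 / z) + 2"
    using norm_triangle_ineq4[of "2 + (1 + a) / e" 2] unfolding z(3) by simp
  moreover have "norm (z + 1 / z) \<le> 1 + 1 / norm z"
    using norm_triangle_ineq[of z "1 / z"] z(2) by (simp add: norm_divide)
  ultimately have "2 \<le> 1 / norm z" by linarith
  then show ?thesis using z(1) by (simp add: pos_le_divide_eq)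
qed

abbreviation jordan :: "complex \<Rightarrow> complex \<Rightarrow> state" where
  "jordan x y \<equiv> comb x y (\<lambda>_. 0) (\<lambda>_. 0)"

lemma jordan_l2_pair: "jordan x y \<in> l2_pair"
  by (rule comb_l2_pair) (auto simp: lqs_2_0)

lemma jordan_eq_zero: "jordan x y = 0 \<Longrightarrow> x = 0 \<and> y = 0"
proof -
  assume "jordan x y = 0"
  then have "x * P k + y * Q k = 0" "- x * P k + y * Q k = 0"
    by (auto simp: comb_def prod_eq_iff fun_eq_iff)
  then have "2 * (y * Q k) = 0" "2 * (x * P k) = 0" by algebra+
  then show ?thesis using PQ_nz by simp
qed

lemma scale_jordan: "scale x (jordan 1 0) + scale y (jordan 0 1) = jordan x y"
  by (simp add: comb_def scale_def prod_eq_iff fun_eq_iff)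

lemma state_span_jordan: "state.span {jordan 1 0, jordan 0 1} = {w. \<exists>x y. w = jordan x y}"
proof -
  have "(w - scale x (jordan 1 0) = scale y (jordan 0 1)) \<longleftrightarrow> w = jordan x y" for w x y
    unfolding scale_jordan[symmetric, of x y] by (simp only: diff_eq_eq add.commute)
  then show ?thesis
    unfolding set_eq_iff state.span_breakdown_eq[of _ "jordan 1 0"] state.span_singleton by (simp add: image_iff)
qed

text \<open>A preimage of the Jordan plane under \<open>shifted H 0\<close> lies in the plane again,
  so longer chains lead nowhere else; conversely the square of the block is zero.\<close>

lemma gen_eigenspace_zero: "gen_eigenspace H 0 = {w. \<exists>x y. w = jordan x y}"
proof (intro set_eqI iffI)
  obtain z \<zeta> where sp: "spectral 0 z \<zeta>" "norm z < 1" "norm \<zeta> < 1"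
    using spectral_exists[OF near_zero_not_band[of 0]] by auto
  have *: "\<exists>x y. w = jordan x y" if "w \<in> l2_pair" "(shifted H 0 ^^ j) w = 0" for j w
    using that
  proof (induction j arbitrary: w)
    case 0
    then show ?case using comb_zero by auto
  next
    case (Suc j)
    have "(shifted H 0 ^^ j) (shifted H 0 w) = 0" using Suc.prems(2) by (simp add: funpow_swap1)
    with Suc.IH[OF shifted_l2_pair[OF Suc.prems(1)]] obtain \<alpha> \<beta> where "shifted H 0 w = jordan \<alpha> \<beta>" by blast
    then show ?case using jordan_preimage[OF sp Suc.prems(1)] by metis
  qed
  show "w \<in> {w. \<exists>x y. w = jordan x y}" if "w \<in> gen_eigenspace H 0" for w
    using * that by (auto simp: gen_eigenspace_def)
  fix w assume "w \<in> {w. \<exists>x y. w = jordan x y}"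
  then obtain x y where w: "w = jordan x y" by blast
  have "(shifted H 0 ^^ 2) w = 0"
    by (simp add: numeral_2_eq_2 w shifted_jordan comb_zero)
  then show "w \<in> gen_eigenspace H 0" using jordan_l2_pair w by (auto simp: gen_eigenspace_def)
qed

lemma alg_multiplicity_zero: "has_alg_multiplicity H 0 2"
  unfolding has_alg_multiplicity_def
proof (intro exI conjI)
  let ?a = "jordan 1 0" and ?b = "jordan 0 1"
  have na: "?a \<notin> state.span {?b}"
  proof
    assume "?a \<in> state.span {?b}"
    then obtain c where "?a = scale c ?b" unfolding state.span_singleton by blast
    moreover have "scale c ?b = jordan 0 c" by (simp add: comb_def scale_def)
    moreover have "?a - jordan 0 c = jordan 1 (- c)" by (simp add: comb_def prod_eq_iff fun_eq_iff)
    ultimately have "jordan 1 (- c) = 0" by simp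
    then show False using jordan_eq_zero by fastforce
  qed
  have nb: "?b \<noteq> 0" using jordan_eq_zero[of 0 1] by auto
  have ab: "?a \<noteq> ?b" using na state.span_base by fastforce
  show "finite {?a, ?b}" "card {?a, ?b} = 2" using ab by auto
  show "state.independent {?a, ?b}"
    using na nb by (simp add: state.independent_insert)
  show "state.span {?a, ?b} = gen_eigenspace H 0" by (simp add: state_span_jordan gen_eigenspace_zero)
qed

lemma pole_zero: "resolvent_pole H 0"
  unfolding resolvent_pole_def
proof (intro conjI exI ballI)
  have "shifted H 0 (jordan 1 0) = 0" by (simp add: shifted_jordan comb_zero)
  then have "H (jordan 1 0) = scale 0 (jordan 1 0)" by (simp add: shifted_def)
  moreover have "jordan 1 0 \<noteq> 0" using jordan_eq_zero[of 1 0] by auto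
  ultimately show "eigenvalue H 0" unfolding eigenvalue_def using jordan_l2_pair by blast
  show "(0::real) < 1 / 2" by simp
  fix \<Omega> :: complex assume \<Omega>: "\<Omega> \<in> ball 0 (1 / 2) - {0}"
  then have nb: "\<Omega> \<notin> complex_of_real ` bands \<epsilon>" "\<Omega> \<noteq> 0" and n: "norm \<Omega> < 1 / 2" using near_zero_not_band by auto
  show "resolvent_bounded H \<Omega>" by (rule resolvent_bounded_off_bands[OF nb])
  obtain z \<zeta> where sp: "spectral \<Omega> z \<zeta>" using spectral_exists[OF nb(1)] .
  have "norm z \<le> 1 / 2" "norm \<zeta> \<le> 1 / 2"
    using root_near_zero[of z "- \<Omega>"] root_near_zero[of \<zeta> \<Omega>] sp n by (auto simp: spectral_def)
  from op_norm_le_l2_resolvent(2)[OF nb sp this]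
  have op: "op_norm_le_l2 (resolvent H \<Omega>) (2 * resolvent_const (1 / 2) * (1 + 1 / norm \<Omega>)\<^sup>2)" by simp
  \<comment> \<open>Since \<open>norm \<Omega> < 1\<close>, the squared factor is dominated by a
    pure pole of order two.\<close>
  have "1 + 1 / norm \<Omega> \<le> 2 / norm \<Omega>" using n nb by (simp add: field_simps)
  then have "(1 + 1 / norm \<Omega>)\<^sup>2 \<le> (2 / norm \<Omega>)\<^sup>2" by (intro power_mono) auto
  then have "2 * resolvent_const (1 / 2) * (1 + 1 / norm \<Omega>)\<^sup>2 \<le> 2 * resolvent_const (1 / 2) * (2 / norm \<Omega>)\<^sup>2"
    using resolvent_const_nonneg[of "1 / 2"] by (intro mult_left_mono) auto
  also have "\<dots> = 8 * resolvent_const (1 / 2) / norm (\<Omega> - 0) ^ 2" by (simp add: power_divide)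
  finally have le: "2 * resolvent_const (1 / 2) * (1 + 1 / norm \<Omega>)\<^sup>2 \<le> 8 * resolvent_const (1 / 2) / norm (\<Omega> - 0) ^ 2" .
  show "op_norm_le_l2 (resolvent H \<Omega>) (8 * resolvent_const (1 / 2) / norm (\<Omega> - 0) ^ 2)"
    unfolding op_norm_le_def
  proof
    fix F assume F: "F \<in> l2_pair"
    have "0 \<le> pair_norm (lqs_norm 2 0) F" by (simp add: pair_norm_def lqs_norm_2_0_nonneg)
    then show "resolvent H \<Omega> F \<in> l2_pair \<and>
        pair_norm (lqs_norm 2 0) (resolvent H \<Omega> F) \<le> 8 * resolvent_const (1 / 2) / norm (\<Omega> - 0) ^ 2 * pair_norm (lqs_norm 2 0) F"
      using op F mult_right_mono[OF le] unfolding op_norm_le_def by fastforce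
  qed
qed

lemma exactly_two_poles: "exactly_poles_in H (ball 0 (1 / 2)) 2"
  unfolding exactly_poles_in_def
proof (intro exI conjI ballI)
  show "finite {0 :: complex}" "{0} \<subseteq> ball (0 :: complex) (1 / 2)" by auto
  show "resolvent_bounded H \<Omega>" if "\<Omega> \<in> ball 0 (1 / 2) - {0}" for \<Omega>
    using that near_zero_not_band by (intro resolvent_bounded_off_bands) auto
  show "resolvent_pole H z" "has_alg_multiplicity H z ((\<lambda>_. 2) z)" if "z \<in> {0}" for z
    using that pole_zero alg_multiplicity_zero by auto
qed simp

end


section \<open>Boundary values on the bands\<close>

lemma tendsto_sqrt_at_right:
  fixes f :: "real \<Rightarrow> complex"
  assumes "\<And>\<mu>. 0 < \<mu> \<Longrightarrow> norm (f \<mu> - l) \<le> C * sqrt \<mu>"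
  shows "(f \<longlongrightarrow> l) (at_right 0)"
proof (rule LIM_zero_cancel, rule Lim_null_comparison)
  show "\<forall>\<^sub>F \<mu> in at_right 0. norm (f \<mu> - l) \<le> C * sqrt \<mu>"
    using assms eventually_at_right_less[of "0::real"] by (auto elim: eventually_mono)
  have "((\<lambda>\<mu>. C * sqrt \<mu>) \<longlongrightarrow> C * sqrt 0) (at_right 0)" by (intro tendsto_intros)
  then show "((\<lambda>\<mu>. C * sqrt \<mu>) \<longlongrightarrow> 0) (at_right 0)" by simp
qed

context soliton_background
begin

text \<open>The division by \<epsilon> in the sources is the origin of the bound of order
  \<open>1 / \<epsilon>\<close> on the bands. The tails of \<open>P\<close> and \<open>Q\<close> add
  at most \<open>M\<close>, as \<open>76 * \<epsilon> \<le> 1\<close>; this raises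
  \<open>1 + |k|\<close> to \<open>2 + |k|\<close>.\<close>

lemma src_l11:
  assumes f: "f \<in> lqs 1 1" and g: "g \<in> lqs 1 1"
  defines "M \<equiv> lqs_norm 1 1 f + lqs_norm 1 1 g"
  shows "cut_l11le k (src1 f g) ((2 + real_of_int \<bar>k\<bar>) * M / \<epsilon>)"
    and "cut_l11le k (src2 f g) ((2 + real_of_int \<bar>k\<bar>) * M / \<epsilon>)"
    and "norm (coordX f g) \<le> M" "norm (coordY f g) \<le> 2 * M"
proof -
  let ?X = "coordX f g" and ?Y = "coordY f g" and ?c = "1 + real_of_int \<bar>k\<bar>"
  have M: "lqs_norm 1 1 f \<le> M" "lqs_norm 1 1 g \<le> M" "0 \<le> M"
    using lqs_norm_1_1_nonneg[of f] lqs_norm_1_1_nonneg[of g] by (auto simp: M_def)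
  have mono: "cut_l11le k h B" if "cut_l11le k h A" "A \<le> B" for h A B
    using that by (fastforce simp: cut_l11le_def l11le_def)
  have cm: "?c * lqs_norm 1 1 f \<le> ?c * M" "?c * lqs_norm 1 1 g \<le> ?c * M"
    by (intro mult_left_mono M; simp)+
  have fl: "cut_l11le k f (?c * M)" by (rule mono[OF cut_l11le_lqs_1_1[OF f] cm(1)])
  have gl: "cut_l11le k (\<lambda>n. - 1 * g n) (?c * M)"
    using cut_l11le_cmult[OF mono[OF cut_l11le_lqs_1_1[OF g] cm(2)], of "- 1"] by simp
  have P: "cut_l11le k P (2 * (4 * \<epsilon>))" and Q: "cut_l11le k Q (2 * (17 * \<epsilon>))"
    by (rule cut_l11le_geometric; use phi_off psi_off in auto)+
  show X: "norm ?X \<le> M" and Y: "norm ?Y \<le> 2 * M"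
    using coord_bounds[OF l2le_pointwise[OF l2le_lqs_1_1[OF f]] l2le_pointwise[OF l2le_lqs_1_1[OF g]]]
    by (auto simp: M_def)
  have "norm ?X * (2 * (4 * \<epsilon>)) + norm ?Y * (2 * (17 * \<epsilon>)) \<le> M * (2 * (4 * \<epsilon>)) + 2 * M * (2 * (17 * \<epsilon>))"
    using X Y eps by (intro add_mono mult_right_mono) auto
  also have "\<dots> = 76 * \<epsilon> * M" by simp
  also have "\<dots> \<le> 1 * M" using eps M by (intro mult_right_mono) auto
  finally have "?c * M + norm ?X * (2 * (4 * \<epsilon>)) + norm ?Y * (2 * (17 * \<epsilon>)) \<le> (2 + real_of_int \<bar>k\<bar>) * M"
    by (simp add: algebra_simps)
  from divide_right_mono[OF this, of \<epsilon>]
  have tot: "norm (1 / e) * (?c * M + norm (- ?X) * (2 * (4 * \<epsilon>)) + norm (- ?Y) * (2 * (17 * \<epsilon>))) \<le> (2 + real_of_int \<bar>k\<bar>) * M / \<epsilon>"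
    and tot': "norm (1 / e) * (?c * M + norm (- ?X) * (2 * (4 * \<epsilon>)) + norm ?Y * (2 * (17 * \<epsilon>))) \<le> (2 + real_of_int \<bar>k\<bar>) * M / \<epsilon>"
    using eps by (simp_all add: norm_divide)
  have "cut_l11le k (\<lambda>n. 1 / e * (f n + - ?X * P n + - ?Y * Q n)) ((2 + real_of_int \<bar>k\<bar>) * M / \<epsilon>)"
    by (rule mono[OF cut_l11le_cmult[OF cut_l11le_add[OF cut_l11le_add[OF fl cut_l11le_cmult[OF P]] cut_l11le_cmult[OF Q]]] tot])
  then show "cut_l11le k (src1 f g) ((2 + real_of_int \<bar>k\<bar>) * M / \<epsilon>)" by (simp add: src1_def[abs_def])
  have "cut_l11le k (\<lambda>n. 1 / e * (- 1 * g n + - ?X * P n + ?Y * Q n)) ((2 + real_of_int \<bar>k\<bar>) * M / \<epsilon>)"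
    by (rule mono[OF cut_l11le_cmult[OF cut_l11le_add[OF cut_l11le_add[OF gl cut_l11le_cmult[OF P]] cut_l11le_cmult[OF Q]]] tot'])
  then show "cut_l11le k (src2 f g) ((2 + real_of_int \<bar>k\<bar>) * M / \<epsilon>)" by (simp add: src2_def[abs_def])
qed

text \<open>The difference of the two solutions solves the reduced system at \<open>z'\<close> and
  \<open>\<zeta>'\<close> up to the change of \<open>cut_solve\<close> on the fixed source and
  perturbation. Each change is at most \<open>2 * B * \<theta> * gap\<close>, and absorption doubles
  their sum. The bound \<open>B'\<close> of the approximating solution does not survive, so it need
  not be uniform.\<close>

lemma reduced_perturb:
  assumes z: "norm z \<le> 1" "norm \<zeta> \<le> 1" and z': "norm z' \<le> 1" "norm \<zeta>' \<le> 1"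
    and \<theta>: "norm (z' - z) \<le> \<theta>" "norm (\<zeta>' - \<zeta>) \<le> \<theta>"
    and B: "cut_l11le k s1 B" "cut_l11le k s2 B"
    and b: "\<And>n. norm (u n) \<le> 2 * B" "\<And>n. norm (v n) \<le> 2 * B"
    and b': "\<And>n. norm (u' n) \<le> B'" "\<And>n. norm (v' n) \<le> B'"
    and u: "\<And>n. u n = cut_solve k z s1 n + cut_solve k z (pert1 u v) n"
    and v: "\<And>n. v n = cut_solve k \<zeta> s2 n + cut_solve k \<zeta> (pert2 u v) n"
    and u': "u' = cut_solve k z' (\<lambda>n. s1 n + pert1 u' v' n)"
    and v': "v' = cut_solve k \<zeta>' (\<lambda>n. s2 n + pert2 u' v' n)"
  shows "norm (u' n - u n) \<le> 8 * B * \<theta> * (1 + real (gap k n))" "norm (v' n - v n) \<le> 8 * B * \<theta> * (1 + real (gap k n))"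
proof -
  have \<theta>0: "0 \<le> \<theta>" using \<theta>(1) norm_ge_zero order_trans by blast
  have B0: "0 \<le> B" using order_trans[OF norm_ge_zero b(1)[of k]] by simp
  have B'0: "0 \<le> B'" using order_trans[OF norm_ge_zero b'(1)[of k]] .
  have w: "c \<le> c * (1 + real (gap k n))" if "0 \<le> c" for c n using that by (simp add: algebra_simps)
  have bw: "norm (u n) \<le> 2 * B * (1 + real (gap k n))" "norm (v n) \<le> 2 * B * (1 + real (gap k n))" for n
    using b[of n] w[of "2 * B" n] B0 by auto
  have bw': "norm (u' n) \<le> B' * (1 + real (gap k n))" "norm (v' n) \<le> B' * (1 + real (gap k n))" for n
    using b'[of n] w[of B' n] B'0 by auto
  note p = pert_l11[OF bw] and p' = pert_l11[OF bw']
  have lip: "norm (cut_solve k a h n - cut_solve k c h n) \<le> 2 * B * \<theta> * real (gap k n)"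
    if "norm a \<le> 1" "norm c \<le> 1" "norm (a - c) \<le> \<theta>" "cut_l11le k h B" for a c h n
  proof -
    have "norm (cut_solve k a h n - cut_solve k c h n) \<le> real (gap k n) * (2 * norm (a - c) * B)"
      by (rule cut_solve_lipschitz[OF that(1,2,4)])
    also have "\<dots> \<le> real (gap k n) * (2 * \<theta> * B)"
      using that(3) B0 by (intro mult_left_mono mult_right_mono) auto
    finally show ?thesis by (simp add: mult_ac)
  qed
  have r: "norm ((x' - x) - cut_solve k a' (\<lambda>n. q' n - q n) n) \<le> 4 * B * \<theta> * (1 + real (gap k n))"
    if a: "norm a \<le> 1" "norm a' \<le> 1" "norm (a' - a) \<le> \<theta>" and s: "cut_l11le k h B" and q: "cut_l11le k q B" and q': "cut_l11le k q' A"
      and x: "x = cut_solve k a h n + cut_solve k a q n" and x': "x' = cut_solve k a' (\<lambda>n. h n + q' n) n"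
    for x x' a a' h q q' n A
  proof -
    note ad = cut_admissible_l11[OF a(2) s] cut_admissible_l11[OF a(2) q] cut_admissible_l11[OF a(2) q']
    have "(x' - x) - cut_solve k a' (\<lambda>n. q' n - q n) n
        = (cut_solve k a' h n - cut_solve k a h n) + (cut_solve k a' q n - cut_solve k a q n)"
      unfolding x x' cut_solve_add[OF ad(1,3)] cut_solve_diff[OF ad(3,2)] by simp
    also have "norm \<dots> \<le> 2 * B * \<theta> * real (gap k n) + 2 * B * \<theta> * real (gap k n)"
      by (intro order_trans[OF norm_triangle_ineq] add_mono lip a s q)
    also have "\<dots> \<le> 4 * B * \<theta> * (1 + real (gap k n))" using B0 \<theta>0 by (simp add: algebra_simps)
    finally show ?thesis .
  qed
  have pB: "cut_l11le k (pert1 u v) B" "cut_l11le k (pert2 u v) B" using p by simp_all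
  have r1: "norm ((u' n - u n) - cut_solve k z' (pert1 (\<lambda>n. u' n - u n) (\<lambda>n. v' n - v n)) n) \<le> 4 * B * \<theta> * (1 + real (gap k n))" for n
    unfolding pert_diff by (rule r[OF z(1) z'(1) \<theta>(1) B(1) pB(1) p'(1) u fun_cong[OF u']])
  have r2: "norm ((v' n - v n) - cut_solve k \<zeta>' (pert2 (\<lambda>n. u' n - u n) (\<lambda>n. v' n - v n)) n) \<le> 4 * B * \<theta> * (1 + real (gap k n))" for n
    unfolding pert_diff by (rule r[OF z(2) z'(2) \<theta>(2) B(2) pB(2) p'(2) v fun_cong[OF v']])
  have bd: "norm (u' n - u n) \<le> B' + 2 * B" "norm (v' n - v n) \<le> B' + 2 * B" for n
    using norm_triangle_ineq4[of "u' n" "u n"] norm_triangle_ineq4[of "v' n" "v n"] b[of n] b'[of n] by linarith+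
  from reduced_estimate[OF z' bd r1 r2, of n]
  show "norm (u' n - u n) \<le> 8 * B * \<theta> * (1 + real (gap k n))" "norm (v' n - v n) \<le> 8 * B * \<theta> * (1 + real (gap k n))"
    by simp_all
qed

text \<open>The candidate limit solves the reduced system with roots in the closed disk, where its
  size is controlled directly. The resolvents at distance \<mu> from the band then converge to it at
  each site, their remainders at rate \<open>sqrt \<mu>\<close>.\<close>

lemma boundary_value:
  assumes \<Omega>: "\<Omega> \<in> bands \<epsilon>" and \<sigma>: "\<sigma> \<in> {1, -1}" and F: "F \<in> l11_pair"
  shows "\<exists>w. (\<forall>n. norm (fst w n) \<le> 9 * (2 + real_of_int \<bar>k\<bar>) / \<epsilon> * pair_norm (lqs_norm 1 1) F) \<and>
    (\<forall>n. norm (snd w n) \<le> 9 * (2 + real_of_int \<bar>k\<bar>) / \<epsilon> * pair_norm (lqs_norm 1 1) F) \<and>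
    (\<forall>n. ((\<lambda>\<mu>. fst (resolvent H (Complex \<Omega> (\<sigma> * \<mu>)) F) n) \<longlongrightarrow> fst w n) (at_right 0) \<and>
      ((\<lambda>\<mu>. snd (resolvent H (Complex \<Omega> (\<sigma> * \<mu>)) F) n) \<longlongrightarrow> snd w n) (at_right 0))"
proof -
  obtain f g where Ffg: "F = (f, g)" by fastforce
  have f: "f \<in> lqs 1 1" and g: "g \<in> lqs 1 1" using F Ffg by auto
  define M where "M = lqs_norm 1 1 f + lqs_norm 1 1 g"
  have M0: "0 \<le> M" using lqs_norm_1_1_nonneg[of f] lqs_norm_1_1_nonneg[of g] by (simp add: M_def)
  define B where "B = (2 + real_of_int \<bar>k\<bar>) * M / \<epsilon>"
  have s: "cut_l11le k (src1 f g) B" "cut_l11le k (src2 f g) B"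
    and X: "norm (coordX f g) \<le> M" and Y: "norm (coordY f g) \<le> 2 * M"
    using src_l11[OF f g] by (auto simp: B_def M_def)
  have MB: "M \<le> B"
  proof -
    have "M * \<epsilon> \<le> M * (2 + real_of_int \<bar>k\<bar>)" using eps M0 by (intro mult_left_mono) auto
    then show ?thesis unfolding B_def using eps by (simp add: pos_le_divide_eq mult.commute)
  qed
  have B0: "0 \<le> B" using M0 MB by linarith
  have F2: "F \<in> l2_pair" using l2le_lqs_1_1[OF f] l2le_lqs_1_1[OF g] Ffg by (auto simp: l2le_iff)
  have \<Omega>1: "1 \<le> \<bar>\<Omega>\<bar>" using \<Omega> eps by (auto simp: bands_def)
  then have \<Omega>0: "complex_of_real \<Omega> \<noteq> 0" by auto
  have lo: "- 2 \<le> 2 + (1 - \<Omega>) / \<epsilon>" "- 2 \<le> 2 + (1 + \<Omega>) / \<epsilon>"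
  proof -
    have "- 4 * \<epsilon> \<le> 1 - \<Omega>" "- 4 * \<epsilon> \<le> 1 + \<Omega>" using \<Omega> eps by (auto simp: bands_def)
    then have "- 4 \<le> (1 - \<Omega>) / \<epsilon>" "- 4 \<le> (1 + \<Omega>) / \<epsilon>" using eps by (simp_all add: pos_le_divide_eq)
    then show "- 2 \<le> 2 + (1 - \<Omega>) / \<epsilon>" "- 2 \<le> 2 + (1 + \<Omega>) / \<epsilon>" by linarith+
  qed
  \<comment> \<open>\<Omega> enters the two root equations with opposite signs, so the roots are
    selected from opposite half planes.\<close>
  have m\<sigma>: "- \<sigma> \<in> {1, -1}" using \<sigma> by auto
  obtain z where z: "z \<noteq> 0" "norm z \<le> 1" "z + 1 / z = complex_of_real (2 + (1 - \<Omega>) / \<epsilon>)"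
    and zc: "\<And>a t. a \<noteq> 0 \<Longrightarrow> norm a < 1 \<Longrightarrow> a + 1 / a = t \<Longrightarrow> \<sigma> * Im t \<le> 0 \<Longrightarrow>
      (norm (a - z))\<^sup>2 \<le> norm (t - complex_of_real (2 + (1 - \<Omega>) / \<epsilon>))"
    using joukowski_boundary[OF lo(1) \<sigma>] by blast
  obtain \<zeta> where \<zeta>: "\<zeta> \<noteq> 0" "norm \<zeta> \<le> 1" "\<zeta> + 1 / \<zeta> = complex_of_real (2 + (1 + \<Omega>) / \<epsilon>)"
    and \<zeta>c: "\<And>a t. a \<noteq> 0 \<Longrightarrow> norm a < 1 \<Longrightarrow> a + 1 / a = t \<Longrightarrow> - \<sigma> * Im t \<le> 0 \<Longrightarrow>
      (norm (a - \<zeta>))\<^sup>2 \<le> norm (t - complex_of_real (2 + (1 + \<Omega>) / \<epsilon>))"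
    using joukowski_boundary[OF lo(2) m\<sigma>] by blast
  obtain u v where b: "\<And>n. norm (u n) \<le> 2 * B" "\<And>n. norm (v n) \<le> 2 * B"
    and u: "\<And>n. u n = cut_solve k z (src1 f g) n + cut_solve k z (pert1 u v) n"
    and v: "\<And>n. v n = cut_solve k \<zeta> (src2 f g) n + cut_solve k \<zeta> (pert2 u v) n"
    using reduced_exists[OF z(2) \<zeta>(2) B0, of "cut_solve k z (src1 f g)" "cut_solve k \<zeta> (src2 f g)"]
      cut_solve_bound_l11[OF z(2) s(1)] cut_solve_bound_l11[OF \<zeta>(2) s(2)] by metis
  define y where "y = (cY u v - coordY f g) / complex_of_real \<Omega>"
  define x where "x = (y + cX u v - coordX f g) / complex_of_real \<Omega>"
  define w where "w = comb x y u v"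
  define R where "R \<mu> = resolvent H (Complex \<Omega> (\<sigma> * \<mu>)) F" for \<mu>
  have bw: "norm (u n) \<le> 2 * B * (1 + real (gap k n))" "norm (v n) \<le> 2 * B * (1 + real (gap k n))" for n
  proof -
    have "2 * B \<le> 2 * B * (1 + real (gap k n))" using B0 by (simp add: algebra_simps)
    then show "norm (u n) \<le> 2 * B * (1 + real (gap k n))" "norm (v n) \<le> 2 * B * (1 + real (gap k n))"
      using b[of n] by auto
  qed
  \<comment> \<open>On the bands the modulus of \<Omega> is at least 1, so the divisions by it are
    harmless. The sum is at most \<open>3.02 * 1.1 + 2.01 * 0.75 + 2 < 9\<close> in units of
    \<open>B\<close>.\<close>
  have bound: "norm (fst w n) \<le> 9 * B \<and> norm (snd w n) \<le> 9 * B" for n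
  proof -
    have small: "c * \<epsilon> * (2 * B) \<le> B / 100" if "0 \<le> c" "c \<le> 16" for c
    proof -
      have "(c * \<epsilon>) * (2 * B) \<le> (16 * (1 / 10000)) * (2 * B)"
        using that eps B0 by (intro mult_mono) auto
      then show ?thesis using B0 by linarith
    qed
    have c: "norm (cX u v) \<le> B / 100" "norm (cY u v) \<le> B / 100"
      using c_bounds[OF bw] small[of 5] small[of 16] by auto
    have div: "norm (a / complex_of_real \<Omega>) \<le> norm a" for a
    proof -
      have "norm a / \<bar>\<Omega>\<bar> \<le> norm a / 1" using \<Omega>1 by (intro divide_left_mono) auto
      then show ?thesis by (simp add: norm_divide)
    qed
    have "norm y \<le> B / 100 + 2 * B"
      using div[of "cY u v - coordY f g"] norm_triangle_ineq4[of "cY u v" "coordY f g"] c Y MB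
      unfolding y_def by linarith
    moreover from this have "norm x \<le> B / 100 + 2 * B + B / 100 + B"
      using div[of "y + cX u v - coordX f g"] norm_triangle_ineq4[of "y + cX u v" "coordX f g"]
        norm_triangle_ineq[of y "cX u v"] c X MB unfolding x_def by linarith
    moreover have "norm (x * P n) \<le> norm x * (11 / 10)" "norm (y * Q n) \<le> norm y * (3 / 4)"
      unfolding norm_mult by (intro mult_left_mono P_le Q_le; simp)+
    moreover have "norm (fst w n) \<le> norm (x * P n) + norm (y * Q n) + norm (u n)"
      using norm_triangle_ineq[of "x * P n + y * Q n" "u n"] norm_triangle_ineq[of "x * P n" "y * Q n"]
      unfolding w_def comb_def fst_conv by linarith
    moreover have "norm (snd w n) \<le> norm (x * P n) + norm (y * Q n) + norm (v n)"
      using norm_triangle_ineq[of "- x * P n + y * Q n" "v n"] norm_triangle_ineq[of "- x * P n" "y * Q n"]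
      unfolding w_def comb_def snd_conv by (simp add: norm_mult)
    ultimately show ?thesis using b[of n] B0 by linarith
  qed
  have "\<exists>xm ym um vm. R \<mu> = comb xm ym um vm \<and>
      ym - Complex \<Omega> (\<sigma> * \<mu>) * xm + cX um vm = coordX f g \<and> - Complex \<Omega> (\<sigma> * \<mu>) * ym + cY um vm = coordY f g \<and>
      (\<forall>n. norm (um n - u n) \<le> 8 * B / sqrt \<epsilon> * (1 + real (gap k n)) * sqrt \<mu> \<and>
           norm (vm n - v n) \<le> 8 * B / sqrt \<epsilon> * (1 + real (gap k n)) * sqrt \<mu>)" if \<mu>: "0 < \<mu>" for \<mu>
  proof -
    let ?\<Omega> = "Complex \<Omega> (\<sigma> * \<mu>)"
    have Im: "Im ?\<Omega> \<noteq> 0" using \<mu> \<sigma> by auto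
    have nb: "?\<Omega> \<notin> complex_of_real ` bands \<epsilon>" "?\<Omega> \<noteq> 0"
      using Im by (force, metis zero_complex.sel(2))
    obtain a c where sp: "spectral ?\<Omega> a c" and a: "norm a < 1" "norm c < 1" using spectral_exists[OF nb(1)] .
    have diff: "?\<Omega> - complex_of_real \<Omega> = \<i> * complex_of_real (\<sigma> * \<mu>)" by (simp add: complex_eq_iff)
    have t1: "2 + (1 - ?\<Omega>) / e - complex_of_real (2 + (1 - \<Omega>) / \<epsilon>) = - \<i> * complex_of_real (\<sigma> * \<mu> / \<epsilon>)"
      using diff e0 by (simp add: field_simps)
    have t2: "2 + (1 + ?\<Omega>) / e - complex_of_real (2 + (1 + \<Omega>) / \<epsilon>) = \<i> * complex_of_real (\<sigma> * \<mu> / \<epsilon>)"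
      using diff e0 by (simp add: field_simps)
    have Im1: "Im (2 + (1 - ?\<Omega>) / e) = - (\<sigma> * \<mu> / \<epsilon>)" and Im2: "Im (2 + (1 + ?\<Omega>) / e) = \<sigma> * \<mu> / \<epsilon>"
      by simp_all
    have pos: "0 \<le> \<mu> / \<epsilon>" using \<mu> eps by simp
    have "(norm (a - z))\<^sup>2 \<le> \<mu> / \<epsilon>"
      using zc[of a "2 + (1 - ?\<Omega>) / e"] sp a(1) pos \<sigma> unfolding t1 Im1 spectral_def
      by (auto simp: norm_mult norm_divide)
    then have d1: "norm (a - z) \<le> sqrt (\<mu> / \<epsilon>)" by (rule real_le_rsqrt)
    have "(norm (c - \<zeta>))\<^sup>2 \<le> \<mu> / \<epsilon>"
      using \<zeta>c[of c "2 + (1 + ?\<Omega>) / e"] sp a(2) pos \<sigma> unfolding t2 Im2 spectral_def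
      by (auto simp: norm_mult norm_divide)
    then have d2: "norm (c - \<zeta>) \<le> sqrt (\<mu> / \<epsilon>)" by (rule real_le_rsqrt)
    have "bij_betw (shifted H ?\<Omega>) l2_pair l2_pair"
      using resolvent_bounded_off_bands[OF nb] by (simp add: resolvent_bounded_def)
    then have R: "R \<mu> \<in> l2_pair" "shifted H ?\<Omega> (R \<mu>) = (f, g)"
      using F2 unfolding R_def resolvent_def Ffg bij_betw_def
      by (metis inv_into_into, metis f_inv_into_f)
    show ?thesis
    proof (rule solution_reduced[OF sp a R])
      fix xm ym um vm B'
      assume c1: "R \<mu> = comb xm ym um vm" and bm: "\<And>n. norm (um n) \<le> B'" "\<And>n. norm (vm n) \<le> B'"
        and c2: "ym - ?\<Omega> * xm + cX um vm = coordX f g" "- ?\<Omega> * ym + cY um vm = coordY f g"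
        and um: "um = cut_solve k a (\<lambda>n. src1 f g n + pert1 um vm n)" and vm: "vm = cut_solve k c (\<lambda>n. src2 f g n + pert2 um vm n)"
      have "8 * B * sqrt (\<mu> / \<epsilon>) * (1 + real (gap k n)) = 8 * B / sqrt \<epsilon> * (1 + real (gap k n)) * sqrt \<mu>" for n
        by (simp add: real_sqrt_divide)
      then have "norm (um n - u n) \<le> 8 * B / sqrt \<epsilon> * (1 + real (gap k n)) * sqrt \<mu>"
        "norm (vm n - v n) \<le> 8 * B / sqrt \<epsilon> * (1 + real (gap k n)) * sqrt \<mu>" for n
        using reduced_perturb[OF z(2) \<zeta>(2) less_imp_le[OF a(1)] less_imp_le[OF a(2)] d1 d2 s b bm u v um vm, of n]
        by simp_all
      then show ?thesis using c1 c2 by blast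
    qed
  qed
  then obtain xm ym um vm where
    Rc: "\<And>\<mu>. 0 < \<mu> \<Longrightarrow> R \<mu> = comb (xm \<mu>) (ym \<mu>) (um \<mu>) (vm \<mu>)"
    and c1: "\<And>\<mu>. 0 < \<mu> \<Longrightarrow> ym \<mu> - Complex \<Omega> (\<sigma> * \<mu>) * xm \<mu> + cX (um \<mu>) (vm \<mu>) = coordX f g"
    and c2: "\<And>\<mu>. 0 < \<mu> \<Longrightarrow> - Complex \<Omega> (\<sigma> * \<mu>) * ym \<mu> + cY (um \<mu>) (vm \<mu>) = coordY f g"
    and du: "\<And>\<mu> n. 0 < \<mu> \<Longrightarrow> norm (um \<mu> n - u n) \<le> 8 * B / sqrt \<epsilon> * (1 + real (gap k n)) * sqrt \<mu>"
    and dv: "\<And>\<mu> n. 0 < \<mu> \<Longrightarrow> norm (vm \<mu> n - v n) \<le> 8 * B / sqrt \<epsilon> * (1 + real (gap k n)) * sqrt \<mu>"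
    by metis
  have lu: "((\<lambda>\<mu>. um \<mu> n) \<longlongrightarrow> u n) (at_right 0)" and lv: "((\<lambda>\<mu>. vm \<mu> n) \<longlongrightarrow> v n) (at_right 0)" for n
    by (rule tendsto_sqrt_at_right, erule du) (rule tendsto_sqrt_at_right, erule dv)
  have lO: "((\<lambda>\<mu>. Complex \<Omega> (\<sigma> * \<mu>)) \<longlongrightarrow> complex_of_real \<Omega>) (at_right 0)"
  proof -
    have "((\<lambda>\<mu>. Complex \<Omega> (\<sigma> * \<mu>)) \<longlongrightarrow> Complex \<Omega> (\<sigma> * 0)) (at_right 0)" by (intro tendsto_intros)
    then show ?thesis by (simp add: complex_of_real_def)
  qed
  have nz: "Complex \<Omega> (\<sigma> * \<mu>) \<noteq> 0" for \<mu> using \<Omega>1 by (auto simp: complex_eq_iff)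
  have lcX: "((\<lambda>\<mu>. cX (um \<mu>) (vm \<mu>)) \<longlongrightarrow> cX u v) (at_right 0)"
    and lcY: "((\<lambda>\<mu>. cY (um \<mu>) (vm \<mu>)) \<longlongrightarrow> cY u v) (at_right 0)"
    unfolding cX_def cY_def using PQ_nz by (intro tendsto_intros lu lv; simp)+
  have ev: "\<forall>\<^sub>F \<mu> in at_right (0::real). 0 < \<mu>" by (rule eventually_at_right_less)
  have ly: "(ym \<longlongrightarrow> y) (at_right 0)"
  proof (rule Lim_transform_eventually)
    show "((\<lambda>\<mu>. (cY (um \<mu>) (vm \<mu>) - coordY f g) / Complex \<Omega> (\<sigma> * \<mu>)) \<longlongrightarrow> y) (at_right 0)"
      unfolding y_def by (intro tendsto_intros lcY lO \<Omega>0)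
    show "\<forall>\<^sub>F \<mu> in at_right 0. (cY (um \<mu>) (vm \<mu>) - coordY f g) / Complex \<Omega> (\<sigma> * \<mu>) = ym \<mu>"
      using ev by eventually_elim (use c2 nz in \<open>simp add: divide_eq_eq algebra_simps flip: c2\<close>)
  qed
  have lx: "(xm \<longlongrightarrow> x) (at_right 0)"
  proof (rule Lim_transform_eventually)
    show "((\<lambda>\<mu>. (ym \<mu> + cX (um \<mu>) (vm \<mu>) - coordX f g) / Complex \<Omega> (\<sigma> * \<mu>)) \<longlongrightarrow> x) (at_right 0)"
      unfolding x_def by (intro tendsto_intros lcX ly lO \<Omega>0)
    show "\<forall>\<^sub>F \<mu> in at_right 0. (ym \<mu> + cX (um \<mu>) (vm \<mu>) - coordX f g) / Complex \<Omega> (\<sigma> * \<mu>) = xm \<mu>"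
      using ev by eventually_elim (use c1 nz in \<open>simp add: divide_eq_eq algebra_simps flip: c1\<close>)
  qed
  have "((\<lambda>\<mu>. fst (R \<mu>) n) \<longlongrightarrow> fst w n) (at_right 0) \<and> ((\<lambda>\<mu>. snd (R \<mu>) n) \<longlongrightarrow> snd w n) (at_right 0)" for n
  proof
    show "((\<lambda>\<mu>. fst (R \<mu>) n) \<longlongrightarrow> fst w n) (at_right 0)"
    proof (rule Lim_transform_eventually)
      show "((\<lambda>\<mu>. xm \<mu> * P n + ym \<mu> * Q n + um \<mu> n) \<longlongrightarrow> fst w n) (at_right 0)"
        unfolding w_def comb_def fst_conv by (intro tendsto_intros lx ly lu)
      show "\<forall>\<^sub>F \<mu> in at_right 0. xm \<mu> * P n + ym \<mu> * Q n + um \<mu> n = fst (R \<mu>) n"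
        using ev by eventually_elim (simp add: Rc comb_def)
    qed
    show "((\<lambda>\<mu>. snd (R \<mu>) n) \<longlongrightarrow> snd w n) (at_right 0)"
    proof (rule Lim_transform_eventually)
      show "((\<lambda>\<mu>. - xm \<mu> * P n + ym \<mu> * Q n + vm \<mu> n) \<longlongrightarrow> snd w n) (at_right 0)"
        unfolding w_def comb_def snd_conv by (intro tendsto_intros lx ly lv)
      show "\<forall>\<^sub>F \<mu> in at_right 0. - xm \<mu> * P n + ym \<mu> * Q n + vm \<mu> n = snd (R \<mu>) n"
        using ev by eventually_elim (simp add: Rc comb_def)
    qed
  qed
  moreover have "9 * (2 + real_of_int \<bar>k\<bar>) / \<epsilon> * pair_norm (lqs_norm 1 1) F = 9 * B"
    by (simp add: B_def M_def Ffg pair_norm_def)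
  ultimately show ?thesis using bound unfolding R_def by (intro exI[of _ w]) simp
qed

lemma band_limits:
  assumes \<Omega>: "\<Omega> \<in> bands \<epsilon>" and \<sigma>: "\<sigma> \<in> {1, -1}"
  shows "\<exists>T. limit_resolvent H \<sigma> \<Omega> T \<and> op_norm_le_l11_linf T (18 * (2 + real_of_int \<bar>k\<bar>) / \<epsilon>)"
proof -
  \<comment> \<open>\<open>T\<close> is chosen separately for each datum. The constant 18 is twice 9
    because the norm of a pair adds its two components.\<close>
  from boundary_value[OF \<Omega> \<sigma>] obtain T where
    T: "\<And>F n. F \<in> l11_pair \<Longrightarrow> norm (fst (T F) n) \<le> 9 * (2 + real_of_int \<bar>k\<bar>) / \<epsilon> * pair_norm (lqs_norm 1 1) F"
      "\<And>F n. F \<in> l11_pair \<Longrightarrow> norm (snd (T F) n) \<le> 9 * (2 + real_of_int \<bar>k\<bar>) / \<epsilon> * pair_norm (lqs_norm 1 1) F"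
    and lim: "\<And>F n. F \<in> l11_pair \<Longrightarrow>
        ((\<lambda>\<mu>. fst (resolvent H (Complex \<Omega> (\<sigma> * \<mu>)) F) n) \<longlongrightarrow> fst (T F) n) (at_right 0) \<and>
        ((\<lambda>\<mu>. snd (resolvent H (Complex \<Omega> (\<sigma> * \<mu>)) F) n) \<longlongrightarrow> snd (T F) n) (at_right 0)"
    by metis
  have linf: "h \<in> linf" "linf_norm h \<le> c" if "\<And>n. norm (h n) \<le> c" for h :: "int \<Rightarrow> complex" and c
    using that unfolding linf_def linf_norm_def by (auto intro!: boundedI cSUP_least)
  have "op_norm_le_l11_linf T (18 * (2 + real_of_int \<bar>k\<bar>) / \<epsilon>)"
    unfolding op_norm_le_def
  proof
    fix F assume F: "F \<in> l11_pair"
    let ?c = "9 * (2 + real_of_int \<bar>k\<bar>) / \<epsilon> * pair_norm (lqs_norm 1 1) F"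
    have "T F \<in> linf_pair" "linf_norm (fst (T F)) \<le> ?c" "linf_norm (snd (T F)) \<le> ?c"
      using linf[where h = "fst (T F)", OF T(1)[OF F]] linf[where h = "snd (T F)", OF T(2)[OF F]]
      by (simp_all only: mem_Times_iff)
    moreover have "18 * (2 + real_of_int \<bar>k\<bar>) / \<epsilon> * pair_norm (lqs_norm 1 1) F = ?c + ?c" by simp
    ultimately show "T F \<in> linf_pair \<and> pair_norm linf_norm (T F) \<le> 18 * (2 + real_of_int \<bar>k\<bar>) / \<epsilon> * pair_norm (lqs_norm 1 1) F"
      unfolding pair_norm_def[of linf_norm] by (auto simp only: intro!: conjI add_mono)
  qed
  then show ?thesis using lim unfolding limit_resolvent_def by blast
qed

end

theorem corollary1:
  fixes Up Um :: "int set" and N :: nat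
  assumes "Up \<inter> Um = {}" and "finite Up" and "finite Um"
    and "N = card Up + card Um" and "N = 1"
  shows "\<exists>\<rho>>0. \<exists>\<epsilon>0>0. \<exists>\<delta>>0. \<exists>C>0. \<forall>\<epsilon>\<in>{0<..<\<epsilon>0}.
    (\<exists>!\<phi>. soliton_near 1 Up Um \<rho> \<epsilon> \<phi>) \<and>
    (\<forall>\<phi>. soliton_near 1 Up Um \<rho> \<epsilon> \<phi> \<longrightarrow>
       (\<forall>\<Omega>. \<Omega> \<notin> ball 0 \<delta> \<union> complex_of_real ` bands \<epsilon> \<longrightarrow>
          resolvent_bounded (H_op 1 \<epsilon> \<phi>) \<Omega>) \<and>
       exactly_poles_in (H_op 1 \<epsilon> \<phi>) (ball 0 \<delta>) (2 * N) \<and>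
       (\<forall>\<sigma>\<in>{1, -1}. \<forall>\<Omega>\<in>bands \<epsilon>. \<exists>T.
          limit_resolvent (H_op 1 \<epsilon> \<phi>) \<sigma> \<Omega> T \<and>
          op_norm_le_l11_linf T (C / \<epsilon>)))"
proof -
  obtain k s where s: "s \<in> {1, -1 :: real}" and lim: "limit_soliton Up Um = peak k s"
  proof -
    consider "card Up = 1" "card Um = 0" | "card Up = 0" "card Um = 1" using assms by linarith
    then show ?thesis
    proof cases
      case 1
      then obtain k where "Up = {k}" "Um = {}" using assms by (auto simp: card_1_singleton_iff)
      then show ?thesis by (intro that[of 1 k]) (auto simp: limit_soliton_def peak_def fun_eq_iff)
    next
      case 2
      then obtain k where "Um = {k}" "Up = {}" using assms by (auto simp: card_1_singleton_iff)
      then show ?thesis by (intro that[of "-1" k]) (auto simp: limit_soliton_def peak_def fun_eq_iff)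
    qed
  qed
  \<comment> \<open>\<open>C\<close> depends on the site \<open>k\<close> only, not on \<epsilon> or
    on the point of the band.\<close>
  define C where "C = 18 * (2 + real_of_int \<bar>k\<bar>)"
  \<comment> \<open>The radius 1/10 is the region where \<open>soliton_map\<close> contracts, and
    the disk of radius 1/2 stays clear of the bands while keeping the roots of modulus at most
    1/2.\<close>
  have main: "(\<exists>!\<phi>. soliton_near 1 Up Um (1 / 10) \<epsilon> \<phi>) \<and>
    (\<forall>\<phi>. soliton_near 1 Up Um (1 / 10) \<epsilon> \<phi> \<longrightarrow>
       (\<forall>\<Omega>. \<Omega> \<notin> ball 0 (1 / 2) \<union> complex_of_real ` bands \<epsilon> \<longrightarrow> resolvent_bounded (H_op 1 \<epsilon> \<phi>) \<Omega>) \<and>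
       exactly_poles_in (H_op 1 \<epsilon> \<phi>) (ball 0 (1 / 2)) (2 * N) \<and>
       (\<forall>\<sigma>\<in>{1, -1}. \<forall>\<Omega>\<in>bands \<epsilon>. \<exists>T.
          limit_resolvent (H_op 1 \<epsilon> \<phi>) \<sigma> \<Omega> T \<and> op_norm_le_l11_linf T (C / \<epsilon>)))"
    if \<epsilon>: "\<epsilon> \<in> {0<..<1 / 10000}" for \<epsilon>
  proof -
    have e: "0 < \<epsilon>" "\<epsilon> \<le> 1 / 10000" "\<epsilon> \<le> 1 / 1000" "\<epsilon> \<le> 1 / 100" using \<epsilon> by auto
    obtain \<eta> where \<eta>: "\<And>n. \<bar>\<eta> n\<bar> \<le> 4 * \<epsilon> * (1 / 2) ^ gap k n" "soliton_map k s \<epsilon> \<eta> = \<eta>"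
      using soliton_exists[OF s e(1,4)] by blast
    note near = soliton_near_iff[OF s lim e(1,3) \<eta>]
    define \<phi> where "\<phi> n = peak k s n + \<eta> n" for n
    have near\<phi>: "soliton_near 1 Up Um (1 / 10) \<epsilon> \<phi>' \<longleftrightarrow> \<phi>' = \<phi>" for \<phi>'
      using near by (simp add: \<phi>_def[abs_def])
    have \<phi>k: "\<bar>\<phi> k - s\<bar> \<le> 4 * \<epsilon>" using \<eta>(1)[of k] by (simp add: \<phi>_def peak_def)
    have \<phi>off: "\<bar>\<phi> n\<bar> \<le> 4 * \<epsilon> * (1 / 2) ^ gap k n" if "n \<noteq> k" for n
      using \<eta>(1)[of n] that by (simp add: \<phi>_def peak_def)
    have \<phi>eq: "(1 - (\<phi> n)\<^sup>2) * \<phi> n = \<epsilon> * lap \<phi> n" for n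
      using soliton_map_fixed[OF s, of k \<epsilon> \<eta> n] \<eta>(2) by (simp add: \<phi>_def[abs_def])
    obtain \<psi> where \<psi>: "\<And>n. - \<epsilon> * lap \<psi> n + \<psi> n - 3 * (\<phi> n)\<^sup>2 * \<psi> n = \<phi> n"
      "\<bar>\<psi> k + s / 2\<bar> \<le> 1 / 4" "\<And>n. n \<noteq> k \<Longrightarrow> \<bar>\<psi> n\<bar> \<le> 17 * \<epsilon> * (1 / 2) ^ gap k n"
      using jordan_exists[OF s e(1,3) \<phi>k \<phi>off] by blast
    interpret soliton_background k s \<epsilon> \<phi> \<psi>
      by unfold_locales (fact s e \<phi>k \<phi>off \<phi>eq \<psi>)+
    have "resolvent_bounded (H_op 1 \<epsilon> \<phi>) \<Omega>" if "\<Omega> \<notin> ball 0 (1 / 2) \<union> complex_of_real ` bands \<epsilon>" for \<Omega>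
      using resolvent_bounded_off_bands[of \<Omega>] that by (cases "\<Omega> = 0") (auto simp: H_def)
    moreover have "exactly_poles_in (H_op 1 \<epsilon> \<phi>) (ball 0 (1 / 2)) (2 * N)"
      using exactly_two_poles assms(5) by (simp add: H_def)
    moreover have "\<exists>T. limit_resolvent (H_op 1 \<epsilon> \<phi>) \<sigma> \<Omega> T \<and> op_norm_le_l11_linf T (C / \<epsilon>)"
      if "\<sigma> \<in> {1, -1}" "\<Omega> \<in> bands \<epsilon>" for \<sigma> \<Omega>
      using band_limits[OF that(2,1)] by (simp add: H_def C_def)
    ultimately show ?thesis unfolding near\<phi> by blast
  qed
  have "0 < C" by (simp add: C_def)
  with main show ?thesis
    by (intro exI[of _ "1 / 10"] exI[of _ "1 / 10000"] exI[of _ "1 / 2"] exI[of _ C] conjI) auto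
qed

end
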